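(* Let $\mathbf{App}$ be the category of sets $X$ with functions $\delta_X:X\times\mathcal P(X)\to[0,\infty]$ ($\mathcal P(X)$ the power set) satisfying, for all $x\in X$ and $A,B\subseteq X$, $$\delta_X(x,\{x\})=0,\qquad\delta_X(x,\varnothing)=\infty,\qquad\delta_X(x,A\cup B)=\min\{\delta_X(x,A),\delta_X(x,B)\},$$ $$\delta_X(x,A)\le\delta_X(x,A^{(\varepsilon)})+\varepsilon,\qquad A^{(\varepsilon)}=\{y:\delta_X(y,A)\le\varepsilon\}\quad(0\le\varepsilon<\infty).$$ Morphisms are contractions $f:X\to Y$, meaning $\delta_Y(fx,fA)\le\delta_X(x,A)$ for all $x\in X$ and $A\subseteq X$. This category of approach spaces, without a separation assumption, admits a noetherian form inducing the factorization system of surjective contractions (left class) and initial embeddings (right class); the induced structure on a subset restricts $\delta_X$ to that subset's points and subsets.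
   Context: An initial embedding is an injective contraction $m:A\to X$ that is initial for the underlying-set functor: a function $h:Z\to A$ from an approach space $Z$ is a contraction whenever $mh$ is. Equivalently, $m$ is, up to isomorphism, the inclusion of a subset carrying the induced structure described in the claim. Conventions: categories are locally small; "set" is relative to a fixed universe. A proper factorization system $(\mathcal E,\mathcal M)$ is an orthogonal factorization system with every morphism in $\mathcal E$ an epimorphism and every morphism in $\mathcal M$ a monomorphism. Forms. An (orean) form $\mathsf F$ on a category $\mathcal C$ assigns to each object $X$ a set-sized bounded lattice $\mathsf F(X)$ (the fibre over $X$; its elements are called clusters) and to each morphism $f:X\to Y$ monotone maps $f_!:\mathsf F(X)\to\mathsf F(Y)$ and $f^*:\mathsf F(Y)\to\mathsf F(X)$ with $f_!S\le T\iff S\le f^*T$, such that $(gf)_!=g_!f_!$, $(gf)^*=f^*g^*$, and identities act as identities. Put $\operatorname{Im}f=f_!\top_X$ and $\operatorname{Ker}f=f^*\bot_Y$. A cluster in $\mathsf F(X)$ is conormal if it is the image of some morphism of $\mathcal C$ with codomain $X$, and normal if it is the kernel of some morphism of $\mathcal C$ with domain $X$. An embedding of a conormal $S\in\mathsf F(X)$ is a morphism $\iota$ into $X$ with $\operatorname{Im}\iota=S$ such that every morphism $f$ into $X$ with $\operatorname{Im}f\le S$ factors as $f=\iota h$ for a unique $h$. A quotient of a normal $K\in\mathsf F(X)$ is a morphism $\pi$ out of $X$ with $\operatorname{Ker}\pi=K$ such that every morphism $g$ out of $X$ with $K\le\operatorname{Ker}g$ factors as $g=h\pi$ for a unique $h$.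 The form is noetherian if: (N1) $f^*f_!S=S\vee\operatorname{Ker}f$ and $f_!f^*T=T\wedge\operatorname{Im}f$ for all $f,S,T$; (N2) every morphism $f$ factors as $f=me$ with $e$ a quotient of $\operatorname{Ker}f$ and $m$ an embedding of $\operatorname{Im}f$; (N3) the join of two normal clusters (in the same fibre) is normal, and the meet of two conormal clusters is conormal. For a noetherian form, the class of all quotients (of normal clusters) and the class of all embeddings (of conormal clusters) form a proper factorization system, the one induced by the form (quotients as left class, embeddings as right class). *)

theory Defs
  imports
    "HOL-Algebra.Lattice"
    "HOL-Library.Extended_Nonnegative_Real"
    "HOL-Library.FuncSet"
begin

unbundle cardinal_syntax

text \<open>
  A Grothendieck universe (containing the set of natural numbers) is rendered as a type whose
  cardinality is an uncountable regular strong limit.  Its sets are the subsets of the type having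
  smaller cardinality than the type itself: the elements of the universe
  $V_\kappa$ ($\kappa$ inaccessible) are exactly the subsets of $V_\kappa$ of cardinality
  below $\kappa = |V_\kappa|$.
\<close>

definition universe :: "'u itself \<Rightarrow> bool" where
  "universe _ \<longleftrightarrow>
     natLeq <o |UNIV :: 'u set| \<and>
     (\<forall>A :: 'u set. |A| <o |UNIV :: 'u set| \<longrightarrow> |Pow A| <o |UNIV :: 'u set| ) \<and>
     regularCard |UNIV :: 'u set|"

text \<open>For collections living in any type: being in bijection with a set of the universe.\<close>

definition small :: "'u itself \<Rightarrow> 'a set \<Rightarrow> bool" where
  "small _ A \<longleftrightarrow> |A| <o |UNIV :: 'u set|"


section \<open>Categories and factorization systems\<close>

record ('o, 'm) cat =
  Ob :: "'o set"
  Ar :: "'m set"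
  Dom :: "'m \<Rightarrow> 'o"
  Cod :: "'m \<Rightarrow> 'o"
  Id :: "'o \<Rightarrow> 'm"
  Comp :: "'m \<Rightarrow> 'm \<Rightarrow> 'm" (infixr \<open>\<cdot>\<index>\<close> 70)

definition hom :: "('o, 'm) cat \<Rightarrow> 'o \<Rightarrow> 'o \<Rightarrow> 'm set" where
  "hom C X Y = {f \<in> Ar C. Dom C f = X \<and> Cod C f = Y}"

locale category =
  fixes C :: "('o, 'm) cat" (structure)
  assumes dom_cod: "f \<in> Ar C \<Longrightarrow> Dom C f \<in> Ob C \<and> Cod C f \<in> Ob C"
    and id_hom: "X \<in> Ob C \<Longrightarrow> Id C X \<in> hom C X X"
    and comp_hom: "f \<in> hom C X Y \<Longrightarrow> g \<in> hom C Y Z \<Longrightarrow> g \<cdot> f \<in> hom C X Z"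
    and id_left: "f \<in> hom C X Y \<Longrightarrow> Id C Y \<cdot> f = f"
    and id_right: "f \<in> hom C X Y \<Longrightarrow> f \<cdot> Id C X = f"
    and comp_assoc: "f \<in> hom C W X \<Longrightarrow> g \<in> hom C X Y \<Longrightarrow> h \<in> hom C Y Z \<Longrightarrow>
      (h \<cdot> g) \<cdot> f = h \<cdot> (g \<cdot> f)"
begin

definition iso :: "'m \<Rightarrow> bool" where
  "iso f \<longleftrightarrow> f \<in> Ar C \<and>
     (\<exists>g \<in> hom C (Cod C f) (Dom C f). g \<cdot> f = Id C (Dom C f) \<and> f \<cdot> g = Id C (Cod C f))"

definition epi :: "'m \<Rightarrow> bool" where
  "epi f \<longleftrightarrow> f \<in> Ar C \<and>
     (\<forall>Z \<in> Ob C. \<forall>g \<in> hom C (Cod C f) Z. \<forall>h \<in> hom C (Cod C f) Z. g \<cdot> f = h \<cdot> f \<longrightarrow> g = h)"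

definition mono :: "'m \<Rightarrow> bool" where
  "mono f \<longleftrightarrow> f \<in> Ar C \<and>
     (\<forall>Z \<in> Ob C. \<forall>g \<in> hom C Z (Dom C f). \<forall>h \<in> hom C Z (Dom C f). f \<cdot> g = f \<cdot> h \<longrightarrow> g = h)"

definition orthogonal :: "'m \<Rightarrow> 'm \<Rightarrow> bool" where
  "orthogonal e m \<longleftrightarrow>
     (\<forall>u \<in> hom C (Dom C e) (Dom C m). \<forall>v \<in> hom C (Cod C e) (Cod C m). m \<cdot> u = v \<cdot> e \<longrightarrow>
        (\<exists>!d. d \<in> hom C (Cod C e) (Dom C m) \<and> d \<cdot> e = u \<and> m \<cdot> d = v))"

definition orthogonal_factorization_system :: "'m set \<Rightarrow> 'm set \<Rightarrow> bool" where
  "orthogonal_factorization_system E M \<longleftrightarrow>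
     E \<subseteq> Ar C \<and> M \<subseteq> Ar C \<and>
     (\<forall>f. iso f \<longrightarrow> f \<in> E \<and> f \<in> M) \<and>
     (\<forall>f \<in> E. \<forall>g \<in> E. Cod C f = Dom C g \<longrightarrow> g \<cdot> f \<in> E) \<and>
     (\<forall>f \<in> M. \<forall>g \<in> M. Cod C f = Dom C g \<longrightarrow> g \<cdot> f \<in> M) \<and>
     (\<forall>f \<in> Ar C. \<exists>e \<in> E. \<exists>m \<in> M. Cod C e = Dom C m \<and> f = m \<cdot> e) \<and>
     (\<forall>e \<in> E. \<forall>m \<in> M. orthogonal e m)"

definition proper_factorization_system :: "'m set \<Rightarrow> 'm set \<Rightarrow> bool" where
  "proper_factorization_system E M \<longleftrightarrow>
     orthogonal_factorization_system E M \<and> (\<forall>e \<in> E. epi e) \<and> (\<forall>m \<in> M. mono m)"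

end


section \<open>Forms\<close>

record ('o, 'm, 'c) form =
  Fib :: "'o \<Rightarrow> 'c gorder"
  Push :: "'m \<Rightarrow> 'c \<Rightarrow> 'c"
  Pull :: "'m \<Rightarrow> 'c \<Rightarrow> 'c"

text \<open>
  The type of clusters serves as the universe relative to which the fibres and the hom-sets are
  small.  The values of \<open>Push\<close> and \<open>Pull\<close> outside the relevant fibres are irrelevant.
\<close>

locale orean_form = category C
  for C :: "('o, 'm) cat" (structure) +
  fixes F :: "('o, 'm, 'u) form"
  assumes locally_small: "X \<in> Ob C \<Longrightarrow> Y \<in> Ob C \<Longrightarrow> small TYPE('u) (hom C X Y)"
    and fibre_lattice: "X \<in> Ob C \<Longrightarrow> bounded_lattice (Fib F X)"
    and fibre_small: "X \<in> Ob C \<Longrightarrow> small TYPE('u) (carrier (Fib F X))"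
    and push_closed: "f \<in> hom C X Y \<Longrightarrow> Push F f \<in> carrier (Fib F X) \<rightarrow> carrier (Fib F Y)"
    and pull_closed: "f \<in> hom C X Y \<Longrightarrow> Pull F f \<in> carrier (Fib F Y) \<rightarrow> carrier (Fib F X)"
    and push_mono: "f \<in> hom C X Y \<Longrightarrow> isotone (Fib F X) (Fib F Y) (Push F f)"
    and pull_mono: "f \<in> hom C X Y \<Longrightarrow> isotone (Fib F Y) (Fib F X) (Pull F f)"
    and adjoint: "f \<in> hom C X Y \<Longrightarrow> S \<in> carrier (Fib F X) \<Longrightarrow> T \<in> carrier (Fib F Y) \<Longrightarrow>
      Push F f S \<sqsubseteq>\<^bsub>Fib F Y\<^esub> T \<longleftrightarrow> S \<sqsubseteq>\<^bsub>Fib F X\<^esub> Pull F f T"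
    and push_comp: "f \<in> hom C X Y \<Longrightarrow> g \<in> hom C Y Z \<Longrightarrow> S \<in> carrier (Fib F X) \<Longrightarrow>
      Push F (g \<cdot> f) S = Push F g (Push F f S)"
    and pull_comp: "f \<in> hom C X Y \<Longrightarrow> g \<in> hom C Y Z \<Longrightarrow> T \<in> carrier (Fib F Z) \<Longrightarrow>
      Pull F (g \<cdot> f) T = Pull F f (Pull F g T)"
    and push_id: "X \<in> Ob C \<Longrightarrow> S \<in> carrier (Fib F X) \<Longrightarrow> Push F (Id C X) S = S"
    and pull_id: "X \<in> Ob C \<Longrightarrow> S \<in> carrier (Fib F X) \<Longrightarrow> Pull F (Id C X) S = S"
begin

definition Im :: "'m \<Rightarrow> 'u" where
  "Im f = Push F f \<top>\<^bsub>Fib F (Dom C f)\<^esub>"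

definition Ker :: "'m \<Rightarrow> 'u" where
  "Ker f = Pull F f \<bottom>\<^bsub>Fib F (Cod C f)\<^esub>"

definition conormal :: "'o \<Rightarrow> 'u \<Rightarrow> bool" where
  "conormal X S \<longleftrightarrow> (\<exists>f \<in> Ar C. Cod C f = X \<and> Im f = S)"

definition normal :: "'o \<Rightarrow> 'u \<Rightarrow> bool" where
  "normal X K \<longleftrightarrow> (\<exists>f \<in> Ar C. Dom C f = X \<and> Ker f = K)"

definition is_embedding :: "'o \<Rightarrow> 'u \<Rightarrow> 'm \<Rightarrow> bool" where
  "is_embedding X S i \<longleftrightarrow>
     conormal X S \<and> i \<in> Ar C \<and> Cod C i = X \<and> Im i = S \<and>
     (\<forall>f \<in> Ar C. Cod C f = X \<and> Im f \<sqsubseteq>\<^bsub>Fib F X\<^esub> S \<longrightarrow>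
        (\<exists>!h. h \<in> hom C (Dom C f) (Dom C i) \<and> f = i \<cdot> h))"

definition is_quotient :: "'o \<Rightarrow> 'u \<Rightarrow> 'm \<Rightarrow> bool" where
  "is_quotient X K p \<longleftrightarrow>
     normal X K \<and> p \<in> Ar C \<and> Dom C p = X \<and> Ker p = K \<and>
     (\<forall>g \<in> Ar C. Dom C g = X \<and> K \<sqsubseteq>\<^bsub>Fib F X\<^esub> Ker g \<longrightarrow>
        (\<exists>!h. h \<in> hom C (Cod C p) (Cod C g) \<and> g = h \<cdot> p))"

definition embeddings :: "'m set" where
  "embeddings = {i. \<exists>X \<in> Ob C. \<exists>S \<in> carrier (Fib F X). is_embedding X S i}"

definition quotients :: "'m set" where
  "quotients = {p. \<exists>X \<in> Ob C. \<exists>K \<in> carrier (Fib F X). is_quotient X K p}"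

definition induces :: "'m set \<Rightarrow> 'm set \<Rightarrow> bool" where
  "induces E M \<longleftrightarrow> proper_factorization_system E M \<and> quotients = E \<and> embeddings = M"

end

locale noetherian_form = orean_form C F
  for C :: "('o, 'm) cat" (structure) and F :: "('o, 'm, 'u) form" +
  assumes pull_push: "f \<in> hom C X Y \<Longrightarrow> S \<in> carrier (Fib F X) \<Longrightarrow>
      Pull F f (Push F f S) = S \<squnion>\<^bsub>Fib F X\<^esub> Ker f"
    and push_pull: "f \<in> hom C X Y \<Longrightarrow> T \<in> carrier (Fib F Y) \<Longrightarrow>
      Push F f (Pull F f T) = T \<sqinter>\<^bsub>Fib F Y\<^esub> Im f"
    and factorization: "f \<in> hom C X Y \<Longrightarrow>
      \<exists>e m. is_quotient X (Ker f) e \<and> is_embedding Y (Im f) m \<and> Cod C e = Dom C m \<and> f = m \<cdot> e"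
    and normal_join: "X \<in> Ob C \<Longrightarrow> normal X K \<Longrightarrow> normal X L \<Longrightarrow> normal X (K \<squnion>\<^bsub>Fib F X\<^esub> L)"
    and conormal_meet: "X \<in> Ob C \<Longrightarrow> conormal X S \<Longrightarrow> conormal X T \<Longrightarrow>
      conormal X (S \<sqinter>\<^bsub>Fib F X\<^esub> T)"


section \<open>Approach spaces\<close>

record 'u aspace =
  pts :: "'u set"
  dist :: "'u \<times> 'u set \<Rightarrow> ennreal"

text \<open>
  Functions are extensional (undefined outside their domain), so that equality of spaces and
  of contractions is equality of the set-theoretic functions.
\<close>

definition enlarge :: "'u aspace \<Rightarrow> 'u set \<Rightarrow> ennreal \<Rightarrow> 'u set" where
  "enlarge X A \<epsilon> = {y \<in> pts X. dist X (y, A) \<le> \<epsilon>}"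

definition approach_space :: "'u aspace \<Rightarrow> bool" where
  "approach_space X \<longleftrightarrow>
     dist X \<in> extensional (pts X \<times> Pow (pts X)) \<and>
     (\<forall>x \<in> pts X. dist X (x, {x}) = 0) \<and>
     (\<forall>x \<in> pts X. dist X (x, {}) = \<infinity>) \<and>
     (\<forall>x \<in> pts X. \<forall>A \<subseteq> pts X. \<forall>B \<subseteq> pts X.
        dist X (x, A \<union> B) = min (dist X (x, A)) (dist X (x, B))) \<and>
     (\<forall>x \<in> pts X. \<forall>A \<subseteq> pts X. \<forall>\<epsilon> < \<infinity>. dist X (x, A) \<le> dist X (x, enlarge X A \<epsilon>) + \<epsilon>)"

definition contraction :: "'u aspace \<Rightarrow> 'u aspace \<Rightarrow> ('u \<Rightarrow> 'u) \<Rightarrow> bool" where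
  "contraction X Y f \<longleftrightarrow>
     f \<in> pts X \<rightarrow> pts Y \<and>
     (\<forall>x \<in> pts X. \<forall>A \<subseteq> pts X. dist Y (f x, f ` A) \<le> dist X (x, A))"

type_synonym 'u amap = "'u aspace \<times> ('u \<Rightarrow> 'u) \<times> 'u aspace"

definition App :: "('u aspace, 'u amap) cat" where
  "App = \<lparr>
     Ob = {X. approach_space X \<and> small TYPE('u) (pts X)},
     Ar = {(X, f, Y). approach_space X \<and> small TYPE('u) (pts X) \<and>
                      approach_space Y \<and> small TYPE('u) (pts Y) \<and>
                      f \<in> extensional (pts X) \<and> contraction X Y f},
     Dom = (\<lambda>(X, f, Y). X),
     Cod = (\<lambda>(X, f, Y). Y),
     Id = (\<lambda>X. (X, restrict id (pts X), X)),
     Comp = (\<lambda>(Y, g, Z) (X, f, Y'). (X, compose (pts X) g f, Z))\<rparr>"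

definition surjective_contractions :: "'u amap set" where
  "surjective_contractions = {(X, f, Y). (X, f, Y) \<in> Ar App \<and> f ` pts X = pts Y}"

definition initial_embeddings :: "'u amap set" where
  "initial_embeddings = {(A, m, X). (A, m, X) \<in> Ar App \<and> inj_on m (pts A) \<and>
     (\<forall>Z \<in> Ob App. \<forall>h \<in> pts Z \<rightarrow> pts A. contraction Z X (m \<circ> h) \<longrightarrow> contraction Z A h)}"

definition subspace :: "'u aspace \<Rightarrow> 'u set \<Rightarrow> 'u aspace" where
  "subspace X S = \<lparr>pts = S, dist = restrict (dist X) (S \<times> Pow S)\<rparr>"

end

(*
  A surjection out of X is determined up to isomorphism by an equivalence relation on X together
  with a coarser approach structure compatible with it; a subspace is determined by its set of
  points.  Freely adjoining what the axioms of a noetherian form force, a cluster over X is taken to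
  be the record, for every subset A of X, of the largest kernel on A below the cluster (or of the
  fact that A itself lies below it).  The only condition besides monotonicity is that these data
  descend along quotients, i.e. are determined by any subset meeting all classes.  Such records are
  closed under pointwise meets, inverse images act by pulling structures back and preserve meets,
  so direct images exist.  The inverse image along f has image the up-set of Ker f and is
  order-reflecting on the down-set of Im f, and these two facts are equivalent to the two
  identities of a noetherian form.  Clusters are finally encoded as elements of the universe,
  of which there are enough since it is an inaccessible cardinal.
*)
theory Submission
  imports Defs "HOL-Algebra.Complete_Lattice"
begin

section \<open>Structures coarser than a given approach structure\<close>

text \<open>The descent condition is dictated by exactness. A cluster above the kernel of f must be
  an inverse image along f, and the evident way to produce a cluster over the codomain is to
  transport the data along a section s of f over its image. What is seen on a subset A must then
  agree with what is seen on s(f(A)). These two subsets are in general incomparable, but each meets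
  every class of their union, because a cluster above the kernel relates a to s(f(a)). Descent along
  both inclusions gives the agreement; this is why the data range over all subsets and not only over
  the whole space.

  General direct images are never described. They exist because inverse images preserve meets, and
  only the image of the top is computed, by comparing upper bounds. The obstacle to preservation of
  meets is that, over a fixed subset, the distance of a meet is not a pointwise supremum: it
  involves finite covers. It is overcome because the finite covers of h(S) are precisely the images
  of the finite covers of S.\<close>

type_synonym 'u str = "'u rel \<times> ('u \<Rightarrow> 'u set \<Rightarrow> ennreal)"

text \<open>When distances to the empty set are infinite, such a pair encodes a surjection out of
  \<open>A\<close>: the relation says which points are identified, and the distance is that of the
  target, pulled back. The relation may be strictly finer than being at mutual distance 0, since
  spaces need not be separated. Distances outside \<open>A\<close> are set to 0, so that equality of
  pairs is equality of structures and the largest structure has distance constantly 0.\<close>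

definition strs :: "'u set \<Rightarrow> 'u str set" where
  "strs A = {(E, d). equiv A E \<and>
     (\<forall>x S. \<not> (x \<in> A \<and> S \<subseteq> A) \<longrightarrow> d x S = 0) \<and>
     (\<forall>(x, y) \<in> E. d x {y} = 0) \<and>
     (\<forall>x \<in> A. \<forall>S \<subseteq> A. \<forall>T \<subseteq> A. d x (S \<union> T) = min (d x S) (d x T)) \<and>
     (\<forall>x \<in> A. \<forall>S \<subseteq> A. \<forall>\<epsilon> < \<infinity>. d x S \<le> d x {y \<in> A. d y S \<le> \<epsilon>} + \<epsilon>)}"

text \<open>Distances are compared in reverse: a larger structure is a coarser one, just as a larger
  kernel identifies more.\<close>

definition str_le :: "'u str \<Rightarrow> 'u str \<Rightarrow> bool" where
  "str_le K L \<longleftrightarrow> fst K \<subseteq> fst L \<and> (\<forall>x S. snd L x S \<le> snd K x S)"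

definition pb :: "('u \<Rightarrow> 'u) \<Rightarrow> 'u set \<Rightarrow> 'u str \<Rightarrow> 'u str" where
  "pb h A K = ({(x, y). x \<in> A \<and> y \<in> A \<and> (h x, h y) \<in> fst K},
     \<lambda>x S. if x \<in> A \<and> S \<subseteq> A then snd K (h x) (h ` S) else 0)"

lemma strsI:
  assumes "equiv A (fst K)"
    and "\<And>x S. \<not> (x \<in> A \<and> S \<subseteq> A) \<Longrightarrow> snd K x S = 0"
    and "\<And>x y. (x, y) \<in> fst K \<Longrightarrow> snd K x {y} = 0"
    and "\<And>x S T. x \<in> A \<Longrightarrow> S \<subseteq> A \<Longrightarrow> T \<subseteq> A \<Longrightarrow> snd K x (S \<union> T) = min (snd K x S) (snd K x T)"
    and "\<And>x S \<epsilon>. x \<in> A \<Longrightarrow> S \<subseteq> A \<Longrightarrow> \<epsilon> < \<infinity> \<Longrightarrow> snd K x S \<le> snd K x {y \<in> A. snd K y S \<le> \<epsilon>} + \<epsilon>"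
  shows "K \<in> strs A"
  using assms unfolding strs_def by (cases K) auto

lemma
  assumes "K \<in> strs A"
  shows strs_equiv: "equiv A (fst K)"
    and strs_outside: "\<not> (x \<in> A \<and> S \<subseteq> A) \<Longrightarrow> snd K x S = 0"
    and strs_zero: "(x, y) \<in> fst K \<Longrightarrow> snd K x {y} = 0"
    and strs_Un: "x \<in> A \<Longrightarrow> S \<subseteq> A \<Longrightarrow> T \<subseteq> A \<Longrightarrow> snd K x (S \<union> T) = min (snd K x S) (snd K x T)"
    and strs_tri: "x \<in> A \<Longrightarrow> S \<subseteq> A \<Longrightarrow> \<epsilon> < \<infinity> \<Longrightarrow> snd K x S \<le> snd K x {y \<in> A. snd K y S \<le> \<epsilon>} + \<epsilon>"
  using assms unfolding strs_def by (cases K; auto)+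

lemma strs_rel_subset: "K \<in> strs A \<Longrightarrow> (x, y) \<in> fst K \<Longrightarrow> x \<in> A \<and> y \<in> A"
  using strs_equiv[of K A] by (auto simp: equiv_def)

lemma strs_refl: "K \<in> strs A \<Longrightarrow> x \<in> A \<Longrightarrow> (x, x) \<in> fst K"
  using strs_equiv[of K A] by (auto simp: equiv_def refl_on_def)

lemma strs_sym: "K \<in> strs A \<Longrightarrow> (x, y) \<in> fst K \<Longrightarrow> (y, x) \<in> fst K"
  using strs_equiv[of K A] by (auto simp: equiv_def dest: symD)

lemma strs_trans: "K \<in> strs A \<Longrightarrow> (x, y) \<in> fst K \<Longrightarrow> (y, z) \<in> fst K \<Longrightarrow> (x, z) \<in> fst K"
  using strs_equiv[of K A] by (auto simp: equiv_def dest: transD)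

lemma strs_antimono:
  assumes "K \<in> strs A" "S \<subseteq> T" "T \<subseteq> A" "x \<in> A"
  shows "snd K x T \<le> snd K x S"
proof -
  have "S \<subseteq> A" "S \<union> T = T" using assms(2,3) by auto
  then have "snd K x T = min (snd K x S) (snd K x T)"
    using strs_Un[OF assms(1,4), of S T] assms(3) by simp
  then show ?thesis by (metis min.cobounded1)
qed

text \<open>Moving points within their classes costs nothing: \<open>S\<close> lies in the
  enlargement of \<open>T\<close> by 0, so the triangle axiom with \<open>\<epsilon> = 0\<close>
  applies.\<close>

lemma strs_saturate:
  assumes K: "K \<in> strs A" and x: "x \<in> A" and S: "S \<subseteq> A" and T: "T \<subseteq> A"
    and *: "\<And>s. s \<in> S \<Longrightarrow> \<exists>t \<in> T. (s, t) \<in> fst K"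
  shows "snd K x T \<le> snd K x S"
proof -
  have "S \<subseteq> {y \<in> A. snd K y T \<le> 0}"
  proof
    fix s assume s: "s \<in> S"
    then obtain t where t: "t \<in> T" "(s, t) \<in> fst K" using * by blast
    have "snd K s T \<le> snd K s {t}"
      using strs_antimono[OF K, of "{t}" T s] t T s S by auto
    then show "s \<in> {y \<in> A. snd K y T \<le> 0}"
      using s S strs_zero[OF K t(2)] by auto
  qed
  then have "snd K x {y \<in> A. snd K y T \<le> 0} \<le> snd K x S"
    using strs_antimono[OF K _ _ x] by simp
  then show ?thesis using strs_tri[OF K x T, of 0] by simp
qed

text \<open>The triangle axiom is used with \<epsilon> equal to the distance from \<open>y\<close>
  to \<open>S\<close>: that enlargement of \<open>S\<close> contains \<open>y\<close>, and
  \<open>x\<close> has distance 0 from \<open>y\<close>. Together with \<open>strs_saturate\<close>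
  this makes distances depend on classes only.\<close>

lemma strs_related_le:
  assumes K: "K \<in> strs A" and xy: "(x, y) \<in> fst K" and S: "S \<subseteq> A"
  shows "snd K x S \<le> snd K y S"
proof (cases "snd K y S = \<infinity>")
  case False
  note xyA = strs_rel_subset[OF K xy]
  let ?S = "{z \<in> A. snd K z S \<le> snd K y S}"
  have "snd K x S \<le> snd K x ?S + snd K y S"
    using strs_tri[OF K _ S, of x "snd K y S"] xyA False by (simp add: top.not_eq_extremum)
  moreover have "snd K x ?S \<le> snd K x {y}"
    using strs_antimono[OF K, of "{y}" ?S x] xyA by auto
  ultimately show ?thesis using strs_zero[OF K xy] by simp
qed simp

section \<open>Inverse images of structures\<close>

lemma str_eqI:
  assumes "\<And>x y. (x, y) \<in> fst K \<longleftrightarrow> (x, y) \<in> fst L" and "\<And>x S. snd K x S = snd L x S"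
  shows "K = L"
  using assms by (intro prod_eqI ext Set.set_eqI) auto

text \<open>Distances depend only on the classes of the point and of the members of the set, so a
  map may be replaced by one with related values. Applied to the identity and a choice of
  representatives, this turns descent into an equation.\<close>

lemma pb_cong:
  assumes K: "K \<in> strs B" and rel: "\<And>a. a \<in> A \<Longrightarrow> (h a, g a) \<in> fst K"
  shows "pb h A K = pb g A K"
proof -
  have in_B: "h a \<in> B" "g a \<in> B" if "a \<in> A" for a
    using strs_rel_subset[OF K rel[OF that]] by simp_all
  have E: "(h x, h y) \<in> fst K \<longleftrightarrow> (g x, g y) \<in> fst K" if "x \<in> A" "y \<in> A" for x y
  proof
    assume "(h x, h y) \<in> fst K"
    then show "(g x, g y) \<in> fst K"
      using strs_trans[OF K strs_trans[OF K strs_sym[OF K rel[OF that(1)]]] rel[OF that(2)]] by simp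
  next
    assume "(g x, g y) \<in> fst K"
    then show "(h x, h y) \<in> fst K"
      using strs_trans[OF K strs_trans[OF K rel[OF that(1)]] strs_sym[OF K rel[OF that(2)]]] by simp
  qed
  have d: "snd K (h x) (h ` S) = snd K (g x) (g ` S)" if "x \<in> A" "S \<subseteq> A" for x S
  proof (rule order.antisym)
    have sub: "h ` S \<subseteq> B" "g ` S \<subseteq> B" using in_B \<open>S \<subseteq> A\<close> by blast+
    show "snd K (h x) (h ` S) \<le> snd K (g x) (g ` S)"
    proof (rule order.trans[OF strs_related_le[OF K rel[OF that(1)] sub(1)] strs_saturate[OF K in_B(2)[OF that(1)] sub(2,1)]])
      show "\<exists>t \<in> h ` S. (s, t) \<in> fst K" if "s \<in> g ` S" for s
        using that rel strs_sym[OF K] \<open>S \<subseteq> A\<close> by blast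
    qed
    show "snd K (g x) (g ` S) \<le> snd K (h x) (h ` S)"
    proof (rule order.trans[OF strs_related_le[OF K strs_sym[OF K rel[OF that(1)]] sub(2)] strs_saturate[OF K in_B(1)[OF that(1)] sub]])
      show "\<exists>t \<in> g ` S. (s, t) \<in> fst K" if "s \<in> h ` S" for s
        using that rel \<open>S \<subseteq> A\<close> by blast
    qed
  qed
  show ?thesis
    by (rule str_eqI) (simp_all add: pb_def E d cong: conj_cong)
qed

lemma pb_fun_cong: "(\<And>a. a \<in> A \<Longrightarrow> h a = g a) \<Longrightarrow> pb h A K = pb g A K"
  by (rule str_eqI) (simp_all add: pb_def subset_iff cong: conj_cong image_cong_simp)

lemma pb_comp:
  assumes "\<And>a. a \<in> A \<Longrightarrow> h a \<in> B"
  shows "pb h A (pb g B K) = pb (g \<circ> h) A K"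
proof -
  have "h ` S \<subseteq> B" if "S \<subseteq> A" for S using that assms by auto
  then show ?thesis
    using assms by (intro str_eqI) (simp_all add: pb_def image_image cong: conj_cong)
qed

lemma pb_id: "K \<in> strs A \<Longrightarrow> pb id A K = K"
  using strs_rel_subset[of K A] strs_outside[of K A]
  by (intro str_eqI) (auto simp: pb_def)

lemma pb_strs:
  assumes K: "K \<in> strs B" and h: "\<And>a. a \<in> A \<Longrightarrow> h a \<in> B"
  shows "pb h A K \<in> strs A"
proof (rule strsI)
  have sub: "h ` S \<subseteq> B" if "S \<subseteq> A" for S using that h by auto
  show "equiv A (fst (pb h A K))"
  proof (rule equivI)
    show "sym (fst (pb h A K))" using strs_sym[OF K] by (auto simp: pb_def sym_def)
    show "trans (fst (pb h A K))"
    proof (rule transI)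
      show "(x, z) \<in> fst (pb h A K)"
        if "(x, y) \<in> fst (pb h A K)" "(y, z) \<in> fst (pb h A K)" for x y z
        using that strs_trans[OF K, of "h x" "h y" "h z"] by (simp add: pb_def)
    qed
  qed (use strs_refl[OF K h] in \<open>auto simp: pb_def refl_on_def\<close>)
  show "snd (pb h A K) x S = 0" if "\<not> (x \<in> A \<and> S \<subseteq> A)" for x S
    using that by (auto simp: pb_def)
  show "snd (pb h A K) x {y} = 0" if "(x, y) \<in> fst (pb h A K)" for x y
    using that strs_zero[OF K] by (auto simp: pb_def)
  show "snd (pb h A K) x (S \<union> T) = min (snd (pb h A K) x S) (snd (pb h A K) x T)"
    if "x \<in> A" "S \<subseteq> A" "T \<subseteq> A" for x S T
    using that strs_Un[OF K h sub sub] by (simp add: pb_def image_Un)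
  show "snd (pb h A K) x S \<le> snd (pb h A K) x {y \<in> A. snd (pb h A K) y S \<le> \<epsilon>} + \<epsilon>"
    if *: "x \<in> A" "S \<subseteq> A" "\<epsilon> < \<infinity>" for x S \<epsilon>
  proof -
    \<comment> \<open>The map carries the enlargement taken in \<open>A\<close> into the one taken
      in \<open>B\<close>; antitonicity of distances turns this inclusion into the required
      inequality.\<close>
    have "h ` {y \<in> A. snd (pb h A K) y S \<le> \<epsilon>} \<subseteq> {z \<in> B. snd K z (h ` S) \<le> \<epsilon>}"
      using h *(2) by (auto simp: pb_def)
    then have "snd K (h x) {z \<in> B. snd K z (h ` S) \<le> \<epsilon>}
        \<le> snd K (h x) (h ` {y \<in> A. snd (pb h A K) y S \<le> \<epsilon>})"
      using strs_antimono[OF K _ _ h[OF *(1)]] by simp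
    moreover have "snd K (h x) (h ` S) \<le> snd K (h x) {z \<in> B. snd K z (h ` S) \<le> \<epsilon>} + \<epsilon>"
      using strs_tri[OF K h sub] * by simp
    ultimately have "snd K (h x) (h ` S)
        \<le> snd K (h x) (h ` {y \<in> A. snd (pb h A K) y S \<le> \<epsilon>}) + \<epsilon>"
      by (meson add_right_mono order.trans)
    moreover have "snd (pb h A K) x T = snd K (h x) (h ` T)" if "T \<subseteq> A" for T
      using that *(1) by (simp add: pb_def)
    ultimately show ?thesis using *(2) by simp
  qed
qed

lemma str_le_refl: "str_le K K"
  by (simp add: str_le_def)

lemma str_le_trans: "str_le K L \<Longrightarrow> str_le L M \<Longrightarrow> str_le K M"
  unfolding str_le_def by (meson order.trans)

lemma str_le_antisym: "str_le K L \<Longrightarrow> str_le L K \<Longrightarrow> K = L"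
  unfolding str_le_def by (intro str_eqI) (auto intro: order.antisym)

lemma pb_mono: "str_le K L \<Longrightarrow> str_le (pb h A K) (pb h A L)"
  unfolding str_le_def pb_def by auto

text \<open>Along a surjection every point and every subset below is the image of one above, so the
  pulled-back data already contain all comparisons.\<close>

lemma pb_reflect:
  assumes K: "K \<in> strs (h ` A)" and L: "L \<in> strs (h ` A)" and le: "str_le (pb h A K) (pb h A L)"
  shows "str_le K L"
proof -
  have "(x, y) \<in> fst L" if xy: "(x, y) \<in> fst K" for x y
  proof -
    obtain a b where "a \<in> A" "b \<in> A" "x = h a" "y = h b"
      using strs_rel_subset[OF K xy] by auto
    then show ?thesis using le xy by (auto simp: str_le_def pb_def)
  qed
  moreover have "snd L x S \<le> snd K x S" for x S
  proof (cases "x \<in> h ` A \<and> S \<subseteq> h ` A")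
    case True
    then obtain a T where "a \<in> A" "T \<subseteq> A" "x = h a" "S = h ` T"
      by (auto simp: subset_image_iff)
    moreover have "snd (pb h A L) a T \<le> snd (pb h A K) a T"
      using le by (simp add: str_le_def)
    ultimately show ?thesis by (simp add: pb_def)
  next
    case False
    then show ?thesis using strs_outside[OF L] by auto
  qed
  ultimately show ?thesis by (auto simp: str_le_def)
qed

section \<open>Meets of structures\<close>

text \<open>The empty family is excluded because it would cover the empty set with infimum infinity.
  A structure with finite distance to the empty set, such as \<open>str_top\<close>, would then not
  be the meet of itself alone.\<close>

definition covers :: "'u set \<Rightarrow> 'u set set set" where
  "covers S = {\<C>. finite \<C> \<and> \<C> \<noteq> {} \<and> \<Union>\<C> = S}"

text \<open>
  A pointwise supremum of distances need not turn finite unions into minima; the initial structure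
  of a family repairs this by a supremum over finite covers.
\<close>

definition str_Inf :: "'u set \<Rightarrow> 'u str set \<Rightarrow> 'u str" where
  "str_Inf A \<K> = ({(x, y). x \<in> A \<and> y \<in> A \<and> (\<forall>K \<in> \<K>. (x, y) \<in> fst K)},
     \<lambda>x S. if x \<in> A \<and> S \<subseteq> A then SUP \<C> \<in> covers S. INF C \<in> \<C>. SUP K \<in> \<K>. snd K x C else 0)"

lemma str_Inf_lower:
  assumes \<K>: "\<K> \<subseteq> strs A" and K: "K \<in> \<K>"
  shows "str_le (str_Inf A \<K>) K"
proof -
  have "snd K x S \<le> snd (str_Inf A \<K>) x S" for x S
  proof (cases "x \<in> A \<and> S \<subseteq> A")
    case True
    have "snd K x S \<le> (INF C \<in> {S}. SUP K \<in> \<K>. snd K x C)"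
      using SUP_upper[OF K, of "\<lambda>K. snd K x S"] by simp
    also have "\<dots> \<le> (SUP \<C> \<in> covers S. INF C \<in> \<C>. SUP K \<in> \<K>. snd K x C)"
      by (rule SUP_upper) (simp add: covers_def)
    finally show ?thesis using True by (simp add: str_Inf_def)
  next
    case False
    have "snd K x S = 0" using \<K> K by (intro strs_outside[OF _ False]) auto
    then show ?thesis by simp
  qed
  then show ?thesis using K by (auto simp: str_le_def str_Inf_def)
qed

lemma additive_cover:
  fixes g :: "'u set \<Rightarrow> ennreal"
  assumes add: "\<And>S T. S \<subseteq> A \<Longrightarrow> T \<subseteq> A \<Longrightarrow> g (S \<union> T) = min (g S) (g T)"
    and "finite \<C>" "\<C> \<noteq> {}" "\<Union>\<C> \<subseteq> A"
  shows "(INF C \<in> \<C>. g C) = g (\<Union>\<C>)"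
  using assms(2-4)
proof (induction rule: finite_ne_induct)
  case (insert C \<C>)
  then show ?case using add[of C "\<Union>\<C>"] by (auto simp: inf_min)
qed simp

text \<open>An additive distance equals the minimum of its values over any finite cover of the set,
  so the passage to covers in the meet cannot exceed the distance of a lower bound.\<close>

lemma str_Inf_greatest:
  assumes eq: "fst L \<subseteq> A \<times> A" and add: "\<And>x S T. x \<in> A \<Longrightarrow> S \<subseteq> A \<Longrightarrow> T \<subseteq> A \<Longrightarrow> snd L x (S \<union> T) = min (snd L x S) (snd L x T)"
    and le: "\<And>K. K \<in> \<K> \<Longrightarrow> str_le L K"
  shows "str_le L (str_Inf A \<K>)"
proof -
  have "(SUP \<C> \<in> covers S. INF C \<in> \<C>. SUP K \<in> \<K>. snd K x C) \<le> snd L x S"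
    if x: "x \<in> A" and S: "S \<subseteq> A" for x S
  proof (rule SUP_least)
    fix \<C> assume \<C>: "\<C> \<in> covers S"
    have "(INF C \<in> \<C>. SUP K \<in> \<K>. snd K x C) \<le> (INF C \<in> \<C>. snd L x C)"
    proof (rule INF_mono)
      fix C assume "C \<in> \<C>"
      moreover have "(SUP K \<in> \<K>. snd K x C) \<le> snd L x C"
        using le by (intro SUP_least) (simp add: str_le_def)
      ultimately show "\<exists>C' \<in> \<C>. (SUP K \<in> \<K>. snd K x C') \<le> snd L x C" by blast
    qed
    also have "\<dots> = snd L x S"
      using additive_cover[of A "snd L x" \<C>] add[OF x] \<C> S by (auto simp: covers_def)
    finally show "(INF C \<in> \<C>. SUP K \<in> \<K>. snd K x C) \<le> snd L x S" .
  qed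
  moreover have "fst L \<subseteq> fst (str_Inf A \<K>)"
  proof (intro subrelI)
    fix x y assume xy: "(x, y) \<in> fst L"
    then have "(x, y) \<in> fst K" if "K \<in> \<K>" for K
      using le[OF that] by (auto simp: str_le_def)
    then show "(x, y) \<in> fst (str_Inf A \<K>)" using xy eq by (auto simp: str_Inf_def)
  qed
  ultimately show ?thesis by (simp add: str_le_def str_Inf_def)
qed

text \<open>Finite covers of an image are the images of finite covers of the set: given a cover
  downstairs, intersect \<open>S\<close> with the preimages of its members. Both suprema therefore
  run over the same values. Preservation of meets by inverse images rests on this.\<close>

lemma pb_str_Inf:
  assumes h: "\<And>a. a \<in> A \<Longrightarrow> h a \<in> B"
  shows "pb h A (str_Inf B \<K>) = str_Inf A (pb h A ` \<K>)"
proof -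
  have d: "(SUP \<C> \<in> covers (h ` S). INF C \<in> \<C>. SUP K \<in> \<K>. snd K (h x) C)
      = (SUP \<C> \<in> covers S. INF C \<in> \<C>. SUP K \<in> pb h A ` \<K>. snd K x C)"
    if x: "x \<in> A" and S: "S \<subseteq> A" for x S
  proof -
    have cov: "covers (h ` S) = (\<lambda>\<C>. (`) h ` \<C>) ` covers S"
    proof (intro Set.set_eqI iffI)
      fix \<D> assume \<D>: "\<D> \<in> covers (h ` S)"
      let ?\<C> = "(\<lambda>D. S \<inter> h -` D) ` \<D>"
      have im: "h ` (S \<inter> h -` D) = D" if "D \<in> \<D>" for D
      proof -
        have "D \<subseteq> h ` S" using \<D> that by (auto simp: covers_def)
        then show ?thesis by blast
      qed
      then have "\<D> = (\<lambda>\<C>. (`) h ` \<C>) ?\<C>"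
        by (simp add: image_image)
      moreover have "?\<C> \<in> covers S" using \<D> by (auto simp: covers_def)
      ultimately show "\<D> \<in> (\<lambda>\<C>. (`) h ` \<C>) ` covers S" by blast
    qed (auto simp: covers_def)
    have inf: "(INF C \<in> (`) h ` \<C>. SUP K \<in> \<K>. snd K (h x) C)
        = (INF C \<in> \<C>. SUP K \<in> pb h A ` \<K>. snd K x C)" if "\<C> \<in> covers S" for \<C>
    proof -
      have "C \<subseteq> A" if "C \<in> \<C>" for C using that \<open>\<C> \<in> covers S\<close> S by (auto simp: covers_def)
      then show ?thesis using x by (auto simp: image_image pb_def intro!: INF_cong)
    qed
    have "(SUP \<C> \<in> covers (h ` S). INF C \<in> \<C>. SUP K \<in> \<K>. snd K (h x) C)
        = (SUP \<C> \<in> covers S. INF C \<in> (`) h ` \<C>. SUP K \<in> \<K>. snd K (h x) C)"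
      by (simp only: cov image_image)
    also have "\<dots> = (SUP \<C> \<in> covers S. INF C \<in> \<C>. SUP K \<in> pb h A ` \<K>. snd K x C)"
      by (intro SUP_cong refl inf)
    finally show ?thesis .
  qed
  have "h ` S \<subseteq> B" if "S \<subseteq> A" for S using that h by auto
  with h d show ?thesis
    by (intro str_eqI) (auto simp: pb_def str_Inf_def)
qed

text \<open>Finiteness of covers is what saves the axioms: a finite infimum is attained, so a bound
  on it is a bound on a single member of the cover.\<close>

lemma str_Inf_strs:
  assumes \<K>: "\<K> \<subseteq> strs A"
  shows "str_Inf A \<K> \<in> strs A"
proof (rule strsI)
  let ?d = "\<lambda>x C. SUP K \<in> \<K>. snd K x C"
  let ?D = "snd (str_Inf A \<K>)"
  have D: "?D x S = (SUP \<C> \<in> covers S. INF C \<in> \<C>. ?d x C)" if "x \<in> A" "S \<subseteq> A" for x S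
    using that by (simp add: str_Inf_def)
  have D_upper: "(INF C \<in> \<C>. ?d x C) \<le> ?D x S" if "\<C> \<in> covers S" "x \<in> A" "S \<subseteq> A" for \<C> x S
    unfolding D[OF that(2,3)] using that(1) by (rule SUP_upper)
  have D_least: "?D x S \<le> u"
    if "x \<in> A" "S \<subseteq> A" "\<And>\<C>. \<C> \<in> covers S \<Longrightarrow> (INF C \<in> \<C>. ?d x C) \<le> u" for x S u
    unfolding D[OF that(1,2)] using that(3) by (rule SUP_least)
  have d_anti: "?d x T \<le> ?d x S" if "x \<in> A" "S \<subseteq> T" "T \<subseteq> A" for x S T
    using \<K> that by (intro SUP_mono) (auto intro: strs_antimono)
  have inf_fin: "(INF C \<in> \<C>. f C) = Min (f ` \<C>)" if "\<C> \<in> covers S" for \<C> S and f :: "_ \<Rightarrow> ennreal"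
    using that by (simp add: covers_def Min_Inf)
  show "equiv A (fst (str_Inf A \<K>))"
  proof (rule equivI)
    show "sym (fst (str_Inf A \<K>))"
      using \<K> strs_sym by (fastforce simp: str_Inf_def sym_def)
    show "trans (fst (str_Inf A \<K>))"
    proof (rule transI)
      show "(x, z) \<in> fst (str_Inf A \<K>)"
        if *: "(x, y) \<in> fst (str_Inf A \<K>)" "(y, z) \<in> fst (str_Inf A \<K>)" for x y z
      proof -
        have "(x, z) \<in> fst K" if "K \<in> \<K>" for K
        proof (rule strs_trans)
          show "K \<in> strs A" using \<K> that by blast
          show "(x, y) \<in> fst K" "(y, z) \<in> fst K"
            using * that by (simp_all add: str_Inf_def)
        qed
        then show ?thesis using * by (simp add: str_Inf_def)
      qed
    qed
    show "refl_on A (fst (str_Inf A \<K>))"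
      using \<K> strs_refl by (fastforce simp: str_Inf_def refl_on_def)
  qed (auto simp: str_Inf_def)
  show "?D x S = 0" if "\<not> (x \<in> A \<and> S \<subseteq> A)" for x S
    using that by (auto simp: str_Inf_def)
  show "?D x {y} = 0" if xy: "(x, y) \<in> fst (str_Inf A \<K>)" for x y
  proof -
    have A: "x \<in> A" "y \<in> A" using xy by (auto simp: str_Inf_def)
    have "(INF C \<in> \<C>. ?d x C) = 0" if "\<C> \<in> covers {y}" for \<C>
    proof -
      \<comment> \<open>The member of the cover that contains the point can only be the singleton
        itself, and there every distance in the family vanishes.\<close>
      have "y \<in> \<Union>\<C>" using that by (simp add: covers_def)
      then obtain C where C: "C \<in> \<C>" "y \<in> C" by blast
      then have "C = {y}" using that by (auto simp: covers_def)
      moreover have "?d x {y} \<le> 0"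
        using xy \<K> strs_zero by (intro SUP_least) (fastforce simp: str_Inf_def)
      ultimately show ?thesis using INF_lower2[OF C(1), of "?d x" 0] by simp
    qed
    moreover have "{y} \<subseteq> A" using A by simp
    ultimately have "?D x {y} \<le> 0" unfolding D[OF A(1) \<open>{y} \<subseteq> A\<close>] by (intro SUP_least) simp
    then show ?thesis by simp
  qed
  show "?D x (S \<union> T) = min (?D x S) (?D x T)" if *: "x \<in> A" "S \<subseteq> A" "T \<subseteq> A" for x S T
  proof (rule order.antisym)
    have mono: "?D x T \<le> ?D x S" if "S \<subseteq> T" "T \<subseteq> A" for S T
    proof -
      have "(INF C \<in> \<C>. ?d x C) \<le> ?D x S" if \<C>: "\<C> \<in> covers T" for \<C>
      proof -
        have "(INF C \<in> \<C>. ?d x C) \<le> (INF C \<in> (\<lambda>C. S \<inter> C) ` \<C>. ?d x C)"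
        proof (rule INF_mono)
          fix B assume "B \<in> (\<lambda>C. S \<inter> C) ` \<C>"
          then obtain C where C: "C \<in> \<C>" "B = S \<inter> C" by blast
          then have "C \<subseteq> A" using \<C> \<open>T \<subseteq> A\<close> by (auto simp: covers_def)
          then have "?d x C \<le> ?d x B" using C(2) d_anti[OF *(1), of B C] by blast
          then show "\<exists>C \<in> \<C>. ?d x C \<le> ?d x B" using C(1) by blast
        qed
        also have "\<dots> \<le> ?D x S"
          using \<C> \<open>S \<subseteq> T\<close> \<open>T \<subseteq> A\<close> *(1)
          by (intro D_upper) (auto simp: covers_def)
        finally show ?thesis .
      qed
      then show ?thesis using that * by (intro D_least)
    qed
    show "?D x (S \<union> T) \<le> min (?D x S) (?D x T)" using mono * by simp
    \<comment> \<open>If the value at the union were strictly smaller than both others, some cover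
      of \<open>S\<close> and some cover of \<open>T\<close> would already exceed it, and together
      they cover the union.\<close>
    show "min (?D x S) (?D x T) \<le> ?D x (S \<union> T)"
    proof (rule ccontr)
      assume "\<not> ?thesis"
      then have "?D x (S \<union> T) < ?D x S \<and> ?D x (S \<union> T) < ?D x T"
        by (simp only: not_le min_less_iff_conj)
      then obtain \<C> \<D> where c: "\<C> \<in> covers S" "\<D> \<in> covers T"
        "?D x (S \<union> T) < (INF C \<in> \<C>. ?d x C)" "?D x (S \<union> T) < (INF C \<in> \<D>. ?d x C)"
        using * by (auto simp only: D less_SUP_iff)
      then have "?D x (S \<union> T) < (INF C \<in> \<C> \<union> \<D>. ?d x C)"
        by (simp add: INF_union inf_min)
      also have "\<dots> \<le> ?D x (S \<union> T)"
        using c * by (intro D_upper) (auto simp: covers_def)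
      finally show False by simp
    qed
  qed
  show "?D x S \<le> ?D x {y \<in> A. ?D y S \<le> \<epsilon>} + \<epsilon>" if *: "x \<in> A" "S \<subseteq> A" "\<epsilon> < \<infinity>" for x S \<epsilon>
  proof -
    let ?T = "{y \<in> A. ?D y S \<le> \<epsilon>}"
    have "(INF C \<in> \<C>. ?d x C) \<le> ?D x ?T + \<epsilon>" if \<C>: "\<C> \<in> covers S" for \<C>
    proof -
      \<comment> \<open>A cover of \<open>S\<close> induces one of the enlargement
        \<open>?T\<close>, since each point of \<open>?T\<close> is within \<epsilon> of a single
        member. The triangle axiom is then applied member by member, and the member whose induced
        set is nearest to \<open>x\<close> is selected.\<close>
      let ?e = "\<lambda>C. {y \<in> ?T. ?d y C \<le> \<epsilon>}"
      have sub: "C \<subseteq> A" if "C \<in> \<C>" for C using that \<C> * by (auto simp: covers_def)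
      have "\<exists>C \<in> \<C>. ?d y C \<le> \<epsilon>" if y: "y \<in> ?T" for y
      proof -
        have "(INF C \<in> \<C>. ?d y C) \<le> ?D y S"
          using y \<C> * by (intro D_upper) auto
        then have "(INF C \<in> \<C>. ?d y C) \<le> \<epsilon>" using y by auto
        then show ?thesis using \<C> by (simp add: inf_fin[OF \<C>] covers_def Min_le_iff)
      qed
      then have cov: "?e ` \<C> \<in> covers ?T" using \<C> by (fastforce simp: covers_def)
      have *: "?d x C \<le> ?d x (?e C) + \<epsilon>" if C: "C \<in> \<C>" for C
      proof (rule SUP_least)
        fix K assume K: "K \<in> \<K>"
        then have KA: "K \<in> strs A" using \<K> by auto
        have "?e C \<subseteq> {y \<in> A. snd K y C \<le> \<epsilon>}"
          using K by (auto intro: order.trans[OF SUP_upper])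
        then have "snd K x {y \<in> A. snd K y C \<le> \<epsilon>} \<le> snd K x (?e C)"
          by (intro strs_antimono[OF KA]) (use \<open>x \<in> A\<close> in auto)
        also have "\<dots> \<le> ?d x (?e C)" using K by (intro SUP_upper)
        finally show "snd K x C \<le> ?d x (?e C) + \<epsilon>"
          using strs_tri[OF KA \<open>x \<in> A\<close> sub[OF C] \<open>\<epsilon> < \<infinity>\<close>] by (meson add_right_mono order.trans)
      qed
      have "Min (?d x ` ?e ` \<C>) \<in> ?d x ` ?e ` \<C>"
        using \<C> by (intro Min_in) (simp_all add: covers_def)
      then have "(INF C \<in> ?e ` \<C>. ?d x C) \<in> ?d x ` ?e ` \<C>"
        by (simp only: inf_fin[OF cov])
      then obtain C where C: "C \<in> \<C>" "(INF C \<in> ?e ` \<C>. ?d x C) = ?d x (?e C)"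
        by blast
      have "(INF C \<in> \<C>. ?d x C) \<le> ?d x C" using C by (intro INF_lower)
      also have "\<dots> \<le> (INF C \<in> ?e ` \<C>. ?d x C) + \<epsilon>" using *[OF C(1)] C(2) by simp
      also have "\<dots> \<le> ?D x ?T + \<epsilon>"
        using cov \<open>x \<in> A\<close> by (intro add_right_mono D_upper) auto
      finally show ?thesis .
    qed
    then show ?thesis by (rule D_least[OF *(1,2)])
  qed
qed

section \<open>Clusters\<close>

definition coarse :: "'u aspace \<Rightarrow> 'u set \<Rightarrow> 'u str set" where
  "coarse X A = {K \<in> strs A. \<forall>x \<in> A. \<forall>S \<subseteq> A. snd K x S \<le> dist X (x, S)}"

definition str_bot :: "'u aspace \<Rightarrow> 'u set \<Rightarrow> 'u str" where
  "str_bot X A = (Id_on A, \<lambda>x S. if x \<in> A \<and> S \<subseteq> A then dist X (x, S) else 0)"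

definition str_top :: "'u set \<Rightarrow> 'u str" where
  "str_top A = (A \<times> A, \<lambda>_ _. 0)"

lemma
  assumes "approach_space X"
  shows aspace_singleton: "x \<in> pts X \<Longrightarrow> dist X (x, {x}) = 0"
    and aspace_empty: "x \<in> pts X \<Longrightarrow> dist X (x, {}) = \<infinity>"
    and aspace_Un: "x \<in> pts X \<Longrightarrow> A \<subseteq> pts X \<Longrightarrow> B \<subseteq> pts X \<Longrightarrow>
      dist X (x, A \<union> B) = min (dist X (x, A)) (dist X (x, B))"
    and aspace_tri: "x \<in> pts X \<Longrightarrow> A \<subseteq> pts X \<Longrightarrow> \<epsilon> < \<infinity> \<Longrightarrow>
      dist X (x, A) \<le> dist X (x, {y \<in> pts X. dist X (y, A) \<le> \<epsilon>}) + \<epsilon>"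
  using assms unfolding approach_space_def enlarge_def by auto

lemma str_bot_whole_strs:
  assumes X: "approach_space X"
  shows "str_bot X (pts X) \<in> strs (pts X)"
proof (rule strsI)
  show "equiv (pts X) (fst (str_bot X (pts X)))"
    by (auto simp: str_bot_def equiv_def refl_on_def sym_def trans_def)
  show "snd (str_bot X (pts X)) x S \<le>
      snd (str_bot X (pts X)) x {y \<in> pts X. snd (str_bot X (pts X)) y S \<le> \<epsilon>} + \<epsilon>"
    if "x \<in> pts X" "S \<subseteq> pts X" "\<epsilon> < \<infinity>" for x S \<epsilon>
    using aspace_tri[OF X that] that by (simp add: str_bot_def cong: conj_cong)
qed (use aspace_singleton[OF X] aspace_Un[OF X] in \<open>auto simp: str_bot_def\<close>)

lemma str_bot_restrict: "B \<subseteq> A \<Longrightarrow> pb id B (str_bot X A) = str_bot X B"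
  by (intro str_eqI) (auto simp: pb_def str_bot_def Id_on_def)

lemma str_bot_coarse:
  assumes X: "approach_space X" and A: "A \<subseteq> pts X"
  shows "str_bot X A \<in> coarse X A"
  using pb_strs[OF str_bot_whole_strs[OF X], of A id] str_bot_restrict[OF A, of X] A
  by (auto simp: coarse_def str_bot_def)

lemma str_top_coarse: "str_top A \<in> coarse X A"
  by (auto simp: coarse_def str_top_def equiv_def refl_on_def sym_def trans_def intro!: strsI)

text \<open>The two extremes coincide over the empty set, so the empty subset lies below every
  cluster and the cluster of the empty subset can be the bottom.\<close>

lemma str_top_empty: "str_top {} = str_bot X {}"
  by (simp add: str_top_def str_bot_def)

lemma coarse_strs: "K \<in> coarse X A \<Longrightarrow> K \<in> strs A"
  by (simp add: coarse_def)

lemma str_bot_least: "K \<in> coarse X A \<Longrightarrow> str_le (str_bot X A) K"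
  using strs_refl[of K A] strs_outside[of K A] by (auto simp: str_le_def str_bot_def coarse_def)

lemma str_top_greatest: "K \<in> strs A \<Longrightarrow> str_le K (str_top A)"
  using strs_rel_subset[of K A] by (auto simp: str_le_def str_top_def)

lemma pb_top: "h ` A \<subseteq> B \<Longrightarrow> pb h A (str_top B) = str_top A"
  by (intro str_eqI) (auto simp: pb_def str_top_def)

lemma pb_coarse:
  assumes K: "K \<in> coarse Y B" and h: "\<And>a. a \<in> A \<Longrightarrow> h a \<in> B"
    and le: "\<And>x S. x \<in> A \<Longrightarrow> S \<subseteq> A \<Longrightarrow> dist Y (h x, h ` S) \<le> dist X (x, S)"
  shows "pb h A K \<in> coarse X A"
proof -
  have "snd K (h x) (h ` S) \<le> dist X (x, S)" if "x \<in> A" "S \<subseteq> A" for x S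
  proof -
    have "h ` S \<subseteq> B" using that h by auto
    then have "snd K (h x) (h ` S) \<le> dist Y (h x, h ` S)"
      using K h[OF that(1)] by (simp add: coarse_def)
    then show ?thesis using le[OF that] by (rule order.trans)
  qed
  then show ?thesis
    using pb_strs[OF coarse_strs[OF K] h] by (simp add: coarse_def) (simp add: pb_def)
qed

text \<open>
  The value \<open>str_top A\<close> at \<open>A\<close> stands for the conormal cluster \<open>A\<close> lying below \<open>\<kappa>\<close>; it is not a kernel
  (unless \<open>A\<close> is empty), which is why the distances in \<open>strs A\<close> may be finite at the empty set.  The
  last condition holds because \<open>\<kappa> A\<close> and its restriction to \<open>B\<close> are both pulled back from the
  quotient of \<open>A\<close> as soon as \<open>B\<close> meets every class.
\<close>

type_synonym 'u cluster = "'u set \<Rightarrow> 'u str"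

definition clusters :: "'u aspace \<Rightarrow> 'u cluster set" where
  "clusters X = {\<kappa>. (\<forall>A \<subseteq> pts X. \<kappa> A \<in> coarse X A) \<and>
     (\<forall>A. \<not> A \<subseteq> pts X \<longrightarrow> \<kappa> A = str_top {}) \<and>
     (\<forall>A \<subseteq> pts X. \<forall>B \<subseteq> A. str_le (pb id B (\<kappa> A)) (\<kappa> B)) \<and>
     (\<forall>A \<subseteq> pts X. \<forall>B \<subseteq> A. (\<forall>a \<in> A. \<exists>b \<in> B. (a, b) \<in> fst (\<kappa> A)) \<longrightarrow> pb id B (\<kappa> A) = \<kappa> B)}"

definition cl_le :: "'u cluster \<Rightarrow> 'u cluster \<Rightarrow> bool" where
  "cl_le \<kappa> \<mu> \<longleftrightarrow> (\<forall>A. str_le (\<kappa> A) (\<mu> A))"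

definition cl_Inf :: "'u aspace \<Rightarrow> 'u cluster set \<Rightarrow> 'u cluster" where
  "cl_Inf X \<S> = (\<lambda>A. if A \<subseteq> pts X then str_Inf A ((\<lambda>\<kappa>. \<kappa> A) ` \<S>) else str_top {})"

text \<open>The restriction of \<open>f\<close> to \<open>A\<close> factors through the surjection
  onto its image, so only the value of \<kappa> at that image can matter.\<close>

definition cl_pull :: "'u aspace \<Rightarrow> ('u \<Rightarrow> 'u) \<Rightarrow> 'u cluster \<Rightarrow> 'u cluster" where
  "cl_pull X f \<kappa> = (\<lambda>A. if A \<subseteq> pts X then pb f A (\<kappa> (f ` A)) else str_top {})"

text \<open>This is the conormal cluster of \<open>S\<close>. A subset not contained in
  \<open>S\<close> has only its trivial kernel below it, even when it meets \<open>S\<close>. The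
  cases \<open>S = {}\<close> and \<open>S = pts X\<close> are the bottom and the top.\<close>

definition cl_sub :: "'u aspace \<Rightarrow> 'u set \<Rightarrow> 'u cluster" where
  "cl_sub X S = (\<lambda>A. if A \<subseteq> pts X then if A \<subseteq> S then str_top A else str_bot X A else str_top {})"

lemma
  assumes "\<kappa> \<in> clusters X"
  shows cl_coarse: "A \<subseteq> pts X \<Longrightarrow> \<kappa> A \<in> coarse X A"
    and cl_strs: "A \<subseteq> pts X \<Longrightarrow> \<kappa> A \<in> strs A"
    and cl_outside: "\<not> A \<subseteq> pts X \<Longrightarrow> \<kappa> A = str_top {}"
    and cl_restrict: "A \<subseteq> pts X \<Longrightarrow> B \<subseteq> A \<Longrightarrow> str_le (pb id B (\<kappa> A)) (\<kappa> B)"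
    and cl_dense: "A \<subseteq> pts X \<Longrightarrow> B \<subseteq> A \<Longrightarrow> (\<And>a. a \<in> A \<Longrightarrow> \<exists>b \<in> B. (a, b) \<in> fst (\<kappa> A)) \<Longrightarrow>
      pb id B (\<kappa> A) = \<kappa> B"
  using assms by (auto simp: clusters_def coarse_def)

lemma clustersI:
  assumes "\<And>A. A \<subseteq> pts X \<Longrightarrow> \<kappa> A \<in> coarse X A"
    and "\<And>A. \<not> A \<subseteq> pts X \<Longrightarrow> \<kappa> A = str_top {}"
    and "\<And>A B. A \<subseteq> pts X \<Longrightarrow> B \<subseteq> A \<Longrightarrow> str_le (pb id B (\<kappa> A)) (\<kappa> B)"
    and "\<And>A B. A \<subseteq> pts X \<Longrightarrow> B \<subseteq> A \<Longrightarrow> \<forall>a \<in> A. \<exists>b \<in> B. (a, b) \<in> fst (\<kappa> A) \<Longrightarrow>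
      pb id B (\<kappa> A) = \<kappa> B"
  shows "\<kappa> \<in> clusters X"
  using assms by (simp add: clusters_def)

lemma cl_le_refl: "cl_le \<kappa> \<kappa>"
  by (simp add: cl_le_def str_le_refl)

lemma cl_le_trans: "cl_le \<kappa> \<mu> \<Longrightarrow> cl_le \<mu> \<nu> \<Longrightarrow> cl_le \<kappa> \<nu>"
  unfolding cl_le_def by (meson str_le_trans)

lemma cl_le_antisym: "cl_le \<kappa> \<mu> \<Longrightarrow> cl_le \<mu> \<kappa> \<Longrightarrow> \<kappa> = \<mu>"
  unfolding cl_le_def by (meson str_le_antisym ext)

lemma cl_leD: "cl_le \<kappa> \<mu> \<Longrightarrow> str_le (\<kappa> A) (\<mu> A)"
  by (simp add: cl_le_def)

lemma cl_pull_at: "A \<subseteq> pts X \<Longrightarrow> cl_pull X f \<kappa> A = pb f A (\<kappa> (f ` A))"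
  by (simp add: cl_pull_def)

lemma cl_sub_in: "A \<subseteq> pts X \<Longrightarrow> A \<subseteq> S \<Longrightarrow> cl_sub X S A = str_top A"
  by (simp add: cl_sub_def)

lemma cl_sub_out: "A \<subseteq> pts X \<Longrightarrow> \<not> A \<subseteq> S \<Longrightarrow> cl_sub X S A = str_bot X A"
  by (simp add: cl_sub_def)

lemma cl_sub_empty: "A \<subseteq> pts X \<Longrightarrow> cl_sub X {} A = str_bot X A"
  using str_top_empty[of X] by (cases "A = {}") (simp_all add: cl_sub_def)

lemma cl_leI:
  assumes "\<kappa> \<in> clusters X" "\<mu> \<in> clusters X" "\<And>A. A \<subseteq> pts X \<Longrightarrow> str_le (\<kappa> A) (\<mu> A)"
  shows "cl_le \<kappa> \<mu>"
  unfolding cl_le_def using assms cl_outside str_le_refl by metis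

lemma pb_image: "pb g B (pb id (g ` B) K) = pb g B K"
  by (subst pb_comp) auto

text \<open>Restricting after pulling back is pulling back after restricting to the image, so both
  cluster conditions pass along an arbitrary \<open>g\<close>. This serves inverse images along
  contractions and also transport along a section, which need not be a contraction.\<close>

lemma
  assumes \<kappa>: "\<kappa> \<in> clusters X" and B: "g ` B \<subseteq> pts X" and C: "C \<subseteq> B"
  shows pb_family_restrict: "str_le (pb id C (pb g B (\<kappa> (g ` B)))) (pb g C (\<kappa> (g ` C)))"
    and pb_family_dense: "\<forall>b \<in> B. \<exists>c \<in> C. (b, c) \<in> fst (pb g B (\<kappa> (g ` B))) \<Longrightarrow>
      pb id C (pb g B (\<kappa> (g ` B))) = pb g C (\<kappa> (g ` C))"
proof -
  have eq: "pb id C (pb g B (\<kappa> (g ` B))) = pb g C (pb id (g ` C) (\<kappa> (g ` B)))"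
    using C by (simp only: pb_image) (subst pb_comp, auto)
  have sub: "g ` C \<subseteq> g ` B" using C by auto
  show "str_le (pb id C (pb g B (\<kappa> (g ` B)))) (pb g C (\<kappa> (g ` C)))"
    unfolding eq by (intro pb_mono cl_restrict[OF \<kappa> B sub])
  show "pb id C (pb g B (\<kappa> (g ` B))) = pb g C (\<kappa> (g ` C))"
    if "\<forall>b \<in> B. \<exists>c \<in> C. (b, c) \<in> fst (pb g B (\<kappa> (g ` B)))"
  proof -
    have "\<exists>b \<in> g ` C. (a, b) \<in> fst (\<kappa> (g ` B))" if "a \<in> g ` B" for a
      using that \<open>\<forall>b \<in> B. _\<close> by (auto simp: pb_def)
    then show ?thesis unfolding eq by (subst cl_dense[OF \<kappa> B sub]) auto
  qed
qed

section \<open>Inverse images of clusters\<close>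

lemma cl_pull_closed:
  assumes f: "contraction X Y f" and \<kappa>: "\<kappa> \<in> clusters Y"
  shows "cl_pull X f \<kappa> \<in> clusters X"
proof (rule clustersI)
  have im: "f ` A \<subseteq> pts Y" if "A \<subseteq> pts X" for A
    using f that by (auto simp: contraction_def)
  show "cl_pull X f \<kappa> A \<in> coarse X A" if A: "A \<subseteq> pts X" for A
    using A f pb_coarse[OF cl_coarse[OF \<kappa> im[OF A]], of A f X]
    by (auto simp: cl_pull_def contraction_def subset_iff)
  fix A B assume A: "A \<subseteq> pts X" and B: "B \<subseteq> A"
  then have "B \<subseteq> pts X" by auto
  then show "str_le (pb id B (cl_pull X f \<kappa> A)) (cl_pull X f \<kappa> B)"
    using A pb_family_restrict[OF \<kappa> im[OF A] B] by (simp add: cl_pull_def)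
  show "pb id B (cl_pull X f \<kappa> A) = cl_pull X f \<kappa> B"
    if "\<forall>a \<in> A. \<exists>b \<in> B. (a, b) \<in> fst (cl_pull X f \<kappa> A)"
    using that A \<open>B \<subseteq> pts X\<close> pb_family_dense[OF \<kappa> im[OF A] B] by (simp add: cl_pull_def)
qed (simp add: cl_pull_def)

lemma cl_pull_id: "\<kappa> \<in> clusters X \<Longrightarrow> (\<And>x. x \<in> pts X \<Longrightarrow> f x = x) \<Longrightarrow> cl_pull X f \<kappa> = \<kappa>"
proof
  fix A assume \<kappa>: "\<kappa> \<in> clusters X" and f: "\<And>x. x \<in> pts X \<Longrightarrow> f x = x"
  show "cl_pull X f \<kappa> A = \<kappa> A"
  proof (cases "A \<subseteq> pts X")
    case True
    then have "f ` A = A" using f by force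
    moreover have "pb f A (\<kappa> A) = pb id A (\<kappa> A)"
      using True f by (intro pb_fun_cong) auto
    ultimately show ?thesis using True pb_id[OF cl_strs[OF \<kappa> True]] by (simp add: cl_pull_def)
  qed (simp add: cl_pull_def cl_outside[OF \<kappa>])
qed

lemma cl_pull_comp:
  assumes f: "contraction X Y f" and h: "\<And>x. x \<in> pts X \<Longrightarrow> h x = g (f x)"
  shows "cl_pull X h \<kappa> = cl_pull X f (cl_pull Y g \<kappa>)"
proof
  fix A
  show "cl_pull X h \<kappa> A = cl_pull X f (cl_pull Y g \<kappa>) A"
  proof (cases "A \<subseteq> pts X")
    case True
    then have fA: "f ` A \<subseteq> pts Y" using f by (auto simp: contraction_def)
    have "h ` A = g ` f ` A" using h True by force
    moreover have "pb h A K = pb f A (pb g (f ` A) K)" for K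
    proof -
      have "pb h A K = pb (g \<circ> f) A K" using True h by (intro pb_fun_cong) auto
      then show ?thesis using pb_comp[of A f "f ` A" g K] by simp
    qed
    ultimately show ?thesis using True fA by (simp add: cl_pull_def)
  qed (simp add: cl_pull_def)
qed

section \<open>Meets of clusters\<close>

lemma str_Inf_coarse:
  assumes "\<K> \<subseteq> coarse X A" and "A \<subseteq> pts X" and X: "approach_space X"
  shows "str_Inf A \<K> \<in> coarse X A"
proof -
  have "str_le (str_bot X A) (str_Inf A \<K>)"
  proof (rule str_Inf_greatest)
    note bot = str_bot_coarse[OF X assms(2), THEN coarse_strs]
    show "fst (str_bot X A) \<subseteq> A \<times> A" using strs_rel_subset[OF bot] by auto
    show "str_le (str_bot X A) K" if "K \<in> \<K>" for K
      using that assms(1) by (intro str_bot_least) auto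
  qed (rule strs_Un[OF str_bot_coarse[OF X assms(2), THEN coarse_strs]])
  then have "snd (str_Inf A \<K>) x S \<le> snd (str_bot X A) x S" for x S
    by (simp add: str_le_def)
  then show ?thesis
    using str_Inf_strs[of \<K> A] assms(1) unfolding coarse_def
    by (auto simp: str_bot_def if_distrib[of "(\<le>) _"] split: if_splits)
qed

text \<open>Classes of a meet are contained in those of each member, so a subset meeting all classes
  of the meet does so for every member and descent holds memberwise. Restriction commutes with
  meets, being an inverse image along an inclusion.\<close>

lemma cl_Inf_closed:
  assumes X: "approach_space X" and \<S>: "\<S> \<subseteq> clusters X"
  shows "cl_Inf X \<S> \<in> clusters X"
proof (rule clustersI)
  show "cl_Inf X \<S> A \<in> coarse X A" if "A \<subseteq> pts X" for A
    using that \<S> cl_coarse by (fastforce simp: cl_Inf_def intro!: str_Inf_coarse[OF _ _ X])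
  fix A B assume A: "A \<subseteq> pts X" and B: "B \<subseteq> A"
  then have BX: "B \<subseteq> pts X" by auto
  have eq: "pb id B (cl_Inf X \<S> A) = str_Inf B ((\<lambda>\<kappa>. pb id B (\<kappa> A)) ` \<S>)"
    using A pb_str_Inf[of B id A "(\<lambda>\<kappa>. \<kappa> A) ` \<S>"] subsetD[OF B]
    by (simp add: cl_Inf_def image_image)
  have fstB: "(\<lambda>\<kappa>. \<kappa> B) ` \<S> \<subseteq> strs B" "(\<lambda>\<kappa>. pb id B (\<kappa> A)) ` \<S> \<subseteq> strs B"
  proof (intro image_subsetI)
    show "\<kappa> B \<in> strs B" if "\<kappa> \<in> \<S>" for \<kappa>
      using that \<S> BX by (intro cl_strs) auto
    show "(\<lambda>\<kappa>. pb id B (\<kappa> A)) ` \<S> \<subseteq> strs B"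
    proof (intro image_subsetI)
      show "pb id B (\<kappa> A) \<in> strs B" if "\<kappa> \<in> \<S>" for \<kappa>
        using that \<S> A B by (intro pb_strs[where B = A] cl_strs) auto
    qed
  qed
  show "str_le (pb id B (cl_Inf X \<S> A)) (cl_Inf X \<S> B)"
  proof -
    have mem: "str_Inf B ((\<lambda>\<kappa>. pb id B (\<kappa> A)) ` \<S>) \<in> strs B" by (rule str_Inf_strs[OF fstB(2)])
    have "str_le (str_Inf B ((\<lambda>\<kappa>. pb id B (\<kappa> A)) ` \<S>)) (str_Inf B ((\<lambda>\<kappa>. \<kappa> B) ` \<S>))"
    proof (rule str_Inf_greatest)
      fix K assume "K \<in> (\<lambda>\<kappa>. \<kappa> B) ` \<S>"
      then obtain \<kappa> where \<kappa>: "\<kappa> \<in> \<S>" "K = \<kappa> B" by blast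
      then have "str_le (str_Inf B ((\<lambda>\<kappa>. pb id B (\<kappa> A)) ` \<S>)) (pb id B (\<kappa> A))"
        by (intro str_Inf_lower[OF fstB(2)]) auto
      then show "str_le (str_Inf B ((\<lambda>\<kappa>. pb id B (\<kappa> A)) ` \<S>)) K"
        using cl_restrict[of \<kappa> X A B] \<kappa> \<S> A B by (auto intro: str_le_trans)
    qed (use strs_Un[OF mem] strs_rel_subset[OF mem] in auto)
    then show ?thesis using BX unfolding eq by (simp add: cl_Inf_def)
  qed
  show "pb id B (cl_Inf X \<S> A) = cl_Inf X \<S> B"
    if dense: "\<forall>a \<in> A. \<exists>b \<in> B. (a, b) \<in> fst (cl_Inf X \<S> A)"
  proof -
    have "pb id B (\<kappa> A) = \<kappa> B" if \<kappa>: "\<kappa> \<in> \<S>" for \<kappa>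
    proof (rule cl_dense)
      show "\<kappa> \<in> clusters X" using \<S> \<kappa> by auto
      show "\<exists>b \<in> B. (a, b) \<in> fst (\<kappa> A)" if "a \<in> A" for a
        using dense that \<kappa> A by (fastforce simp: cl_Inf_def str_Inf_def)
    qed (use A B in auto)
    then show ?thesis unfolding eq using BX by (simp add: cl_Inf_def cong: image_cong)
  qed
qed (simp add: cl_Inf_def)

lemma cl_Inf_lower:
  assumes \<S>: "\<S> \<subseteq> clusters X" and \<kappa>: "\<kappa> \<in> \<S>"
  shows "cl_le (cl_Inf X \<S>) \<kappa>"
  unfolding cl_le_def
proof
  fix A
  show "str_le (cl_Inf X \<S> A) (\<kappa> A)"
  proof (cases "A \<subseteq> pts X")
    case True
    then have "(\<lambda>\<kappa>. \<kappa> A) ` \<S> \<subseteq> strs A" using \<S> cl_strs by blast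
    then show ?thesis using True \<kappa> by (auto simp: cl_Inf_def intro: str_Inf_lower)
  next
    case False
    moreover have "\<kappa> \<in> clusters X" using \<S> \<kappa> by auto
    ultimately show ?thesis by (simp add: cl_Inf_def cl_outside str_le_refl)
  qed
qed

lemma cl_Inf_greatest:
  assumes \<mu>: "\<mu> \<in> clusters X" and le: "\<And>\<kappa>. \<kappa> \<in> \<S> \<Longrightarrow> cl_le \<mu> \<kappa>"
  shows "cl_le \<mu> (cl_Inf X \<S>)"
  unfolding cl_le_def
proof
  fix A
  show "str_le (\<mu> A) (cl_Inf X \<S> A)"
  proof (cases "A \<subseteq> pts X")
    case True
    note A = cl_strs[OF \<mu> True]
    have "str_le (\<mu> A) (str_Inf A ((\<lambda>\<kappa>. \<kappa> A) ` \<S>))"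
      using strs_Un[OF A] strs_rel_subset[OF A] le
      by (intro str_Inf_greatest) (auto simp: cl_le_def)
    then show ?thesis using True by (simp add: cl_Inf_def)
  qed (simp add: cl_Inf_def cl_outside[OF \<mu>] str_le_refl)
qed

lemma cl_pull_Inf:
  assumes f: "contraction X Y f"
  shows "cl_pull X f (cl_Inf Y \<S>) = cl_Inf X (cl_pull X f ` \<S>)"
proof
  fix A
  show "cl_pull X f (cl_Inf Y \<S>) A = cl_Inf X (cl_pull X f ` \<S>) A"
  proof (cases "A \<subseteq> pts X")
    case True
    then have fA: "f ` A \<subseteq> pts Y" using f by (auto simp: contraction_def)
    then show ?thesis using True pb_str_Inf[of A f "f ` A"]
      by (simp add: cl_pull_def cl_Inf_def image_image)
  qed (simp add: cl_pull_def cl_Inf_def)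
qed

section \<open>Clusters of subsets\<close>

lemma cl_sub_closed:
  assumes X: "approach_space X"
  shows "cl_sub X S \<in> clusters X"
proof (rule clustersI)
  show "cl_sub X S A \<in> coarse X A" if "A \<subseteq> pts X" for A
    using that str_bot_coarse[OF X] str_top_coarse by (auto simp: cl_sub_def)
  fix A B assume A: "A \<subseteq> pts X" and B: "B \<subseteq> A"
  then have BX: "B \<subseteq> pts X" by auto
  show "str_le (pb id B (cl_sub X S A)) (cl_sub X S B)"
    using A B BX str_bot_least[OF str_top_coarse]
    by (auto simp: cl_sub_def str_le_refl pb_top str_bot_restrict)
  show "pb id B (cl_sub X S A) = cl_sub X S B" if "\<forall>a \<in> A. \<exists>b \<in> B. (a, b) \<in> fst (cl_sub X S A)"
  proof (cases "A \<subseteq> S")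
    case True
    then show ?thesis using A B BX by (auto simp: cl_sub_def pb_top)
  next
    case False
    then have "A = B" using that A B by (auto simp: cl_sub_def str_bot_def)
    then show ?thesis using False A by (auto simp: cl_sub_def str_bot_restrict)
  qed
qed (simp add: cl_sub_def)

lemma cl_sub_bot:
  assumes \<kappa>: "\<kappa> \<in> clusters X" and X: "approach_space X"
  shows "cl_le (cl_sub X {}) \<kappa>"
  using str_bot_least[OF cl_coarse[OF \<kappa>]]
  by (intro cl_leI[OF cl_sub_closed[OF X] \<kappa>]) (auto simp: cl_sub_def str_top_empty[of X])

lemma cl_sub_top:
  assumes \<kappa>: "\<kappa> \<in> clusters X" and X: "approach_space X"
  shows "cl_le \<kappa> (cl_sub X (pts X))"
  using str_top_greatest[OF cl_strs[OF \<kappa>]]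
  by (intro cl_leI[OF \<kappa> cl_sub_closed[OF X]]) (auto simp: cl_sub_def)

text \<open>The empty set tells the two kinds of values apart: its distance is 0 in
  \<open>str_top\<close> and infinite in an approach space. Over a one-point subset nothing else
  would.\<close>

lemma cl_sub_le_iff:
  assumes X: "approach_space X" and S: "S \<subseteq> pts X"
  shows "cl_le (cl_sub X S) (cl_sub X T) \<longleftrightarrow> S \<subseteq> T"
proof
  assume le: "cl_le (cl_sub X S) (cl_sub X T)"
  show "S \<subseteq> T"
  proof (rule ccontr)
    assume *: "\<not> S \<subseteq> T"
    then obtain x where x: "x \<in> S" by auto
    have "str_le (str_top S) (str_bot X S)"
      using cl_leD[OF le, of S] S * by (simp add: cl_sub_in cl_sub_out)
    then have "snd (str_bot X S) x {} \<le> snd (str_top S) x {}" by (simp add: str_le_def)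
    then have "dist X (x, {}) \<le> 0"
      using x by (simp add: str_top_def str_bot_def)
    then show False using aspace_empty[OF X, of x] x S by auto
  qed
next
  assume "S \<subseteq> T"
  then show "cl_le (cl_sub X S) (cl_sub X T)"
    using str_bot_least[OF str_top_coarse]
    by (intro cl_leI[OF cl_sub_closed cl_sub_closed] X) (auto simp: cl_sub_def str_le_refl)
qed

text \<open>Read through the adjunction, this computes the image of \<open>f\<close>. Subsets of the
  image are images of subsets, and there pulling back reflects the order; on all other subsets the
  cluster of the image takes the least value.\<close>

lemma cl_sub_image_iff:
  assumes f: "contraction X Y f" and X: "approach_space X" and Y: "approach_space Y"
    and \<kappa>: "\<kappa> \<in> clusters Y"
  shows "cl_le (cl_sub X (pts X)) (cl_pull X f \<kappa>) \<longleftrightarrow> cl_le (cl_sub Y (f ` pts X)) \<kappa>"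
proof
  have fX: "f ` pts X \<subseteq> pts Y" using f by (auto simp: contraction_def)
  assume le: "cl_le (cl_sub X (pts X)) (cl_pull X f \<kappa>)"
  show "cl_le (cl_sub Y (f ` pts X)) \<kappa>"
  proof (rule cl_leI[OF cl_sub_closed[OF Y] \<kappa>])
    fix B assume B: "B \<subseteq> pts Y"
    show "str_le (cl_sub Y (f ` pts X) B) (\<kappa> B)"
    proof (cases "B \<subseteq> f ` pts X")
      case True
      then obtain A where A: "A \<subseteq> pts X" "B = f ` A" by (auto simp: subset_image_iff)
      then have "str_le (str_top A) (pb f A (\<kappa> (f ` A)))"
        using cl_leD[OF le, of A] by (simp add: cl_sub_in cl_pull_at)
      then have "str_le (str_top (f ` A)) (\<kappa> (f ` A))"
        using cl_strs[OF \<kappa> B] A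
        by (intro pb_reflect[OF str_top_coarse[THEN coarse_strs]]) (simp_all add: pb_top)
      then show ?thesis using A B True by (simp add: cl_sub_def)
    next
      case False
      then show ?thesis using B str_bot_least[OF cl_coarse[OF \<kappa> B]] by (simp add: cl_sub_def)
    qed
  qed
next
  have fX: "f ` pts X \<subseteq> pts Y" using f by (auto simp: contraction_def)
  assume le: "cl_le (cl_sub Y (f ` pts X)) \<kappa>"
  show "cl_le (cl_sub X (pts X)) (cl_pull X f \<kappa>)"
  proof (rule cl_leI[OF cl_sub_closed[OF X] cl_pull_closed[OF f \<kappa>]])
    fix A assume A: "A \<subseteq> pts X"
    then have "str_le (str_top (f ` A)) (\<kappa> (f ` A))"
      using cl_leD[OF le, of "f ` A"] fX cl_sub_in[of "f ` A" Y "f ` pts X"]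
        image_mono[OF A, of f] by simp
    then have "str_le (pb f A (str_top (f ` A))) (pb f A (\<kappa> (f ` A)))" by (rule pb_mono)
    then show "str_le (cl_sub X (pts X) A) (cl_pull X f \<kappa> A)"
      using A by (simp add: cl_sub_def cl_pull_def pb_top)
  qed
qed

section \<open>Order reflection and exactness of inverse images\<close>

text \<open>Inside the image this is \<open>pb_reflect\<close>; on the remaining subsets the bound
  by the image forces \<kappa> to take the least value.\<close>

lemma cl_pull_reflect:
  assumes f: "contraction X Y f" and \<kappa>: "\<kappa> \<in> clusters Y" and \<mu>: "\<mu> \<in> clusters Y"
    and le: "cl_le (cl_pull X f \<kappa>) (cl_pull X f \<mu>)" and im: "cl_le \<kappa> (cl_sub Y (f ` pts X))"
  shows "cl_le \<kappa> \<mu>"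
proof (rule cl_leI[OF \<kappa> \<mu>])
  fix B assume B: "B \<subseteq> pts Y"
  show "str_le (\<kappa> B) (\<mu> B)"
  proof (cases "B \<subseteq> f ` pts X")
    case True
    then obtain A where A: "A \<subseteq> pts X" "B = f ` A" by (auto simp: subset_image_iff)
    then have "str_le (pb f A (\<kappa> B)) (pb f A (\<mu> B))"
      using cl_leD[OF le, of A] by (simp add: cl_pull_at)
    then show ?thesis
      using pb_reflect cl_strs[OF \<kappa> B] cl_strs[OF \<mu> B] A by blast
  next
    case False
    then have "str_le (\<kappa> B) (str_bot Y B)"
      using cl_leD[OF im, of B] B by (simp add: cl_sub_out)
    then show ?thesis using str_bot_least[OF cl_coarse[OF \<mu> B]] by (rule str_le_trans)
  qed
qed

text \<open>The witness is \<kappa> transported along a section of \<open>f\<close>. Lying above the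
  kernel is used twice: to bound the transported distances by those of \<open>Y\<close>, and to
  relate each point to its chosen representative.\<close>

lemma cl_pull_exact:
  assumes f: "contraction X Y f" and X: "approach_space X" and Y: "approach_space Y"
    and \<kappa>: "\<kappa> \<in> clusters X" and ker: "cl_le (cl_pull X f (cl_sub Y {})) \<kappa>"
  shows "\<exists>\<mu> \<in> clusters Y. \<kappa> = cl_pull X f \<mu>"
proof
  have fX: "f ` pts X \<subseteq> pts Y" using f by (auto simp: contraction_def)
  define s where "s = inv_into (pts X) f"
  have s: "s y \<in> pts X" "f (s y) = y" if "y \<in> f ` pts X" for y
    using that by (auto simp: s_def inv_into_into f_inv_into_f)
  have kerA: "str_le (pb f A (str_bot Y (f ` A))) (\<kappa> A)" if A: "A \<subseteq> pts X" for A
  proof -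
    have "f ` A \<subseteq> pts Y" using A fX by auto
    then have "cl_pull X f (cl_sub Y {}) A = pb f A (str_bot Y (f ` A))"
      using A by (simp add: cl_pull_at cl_sub_empty)
    then show ?thesis using cl_leD[OF ker, of A] by simp
  qed
  \<comment> \<open>Inverse images do not see subsets that leave the image, and the least structure
    is put there. It is monotone because its restriction is again least, and it descends because its
    classes are single points.\<close>
  let ?\<mu> = "\<lambda>B. if B \<subseteq> f ` pts X then pb s B (\<kappa> (s ` B))
    else if B \<subseteq> pts Y then str_bot Y B else str_top {}"
  have sB: "s ` B \<subseteq> pts X" if "B \<subseteq> f ` pts X" for B using that s by auto
  have coarse: "?\<mu> B \<in> coarse Y B" if B: "B \<subseteq> pts Y" for B
    proof (cases "B \<subseteq> f ` pts X")
      case True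
      have "snd (\<kappa> (s ` B)) (s y) (s ` S) \<le> dist Y (y, S)" if "y \<in> B" "S \<subseteq> B" for y S
      proof -
        have fs: "f ` s ` T = T" if "T \<subseteq> B" for T
        proof -
          have "(\<lambda>y. f (s y)) ` T = (\<lambda>y. y) ` T"
            using s(2) True that by (intro image_cong) auto
          then show ?thesis by (simp add: image_image)
        qed
        have "snd (\<kappa> (s ` B)) (s y) (s ` S) \<le> snd (pb f (s ` B) (str_bot Y (f ` s ` B))) (s y) (s ` S)"
          using kerA[OF sB[OF True]] by (simp only: str_le_def)
        also have "\<dots> = dist Y (y, S)"
          using that True s by (simp add: pb_def str_bot_def fs image_mono subset_iff)
        finally show ?thesis .
      qed
      then show ?thesis
        using True pb_strs[OF cl_strs[OF \<kappa> sB[OF True]], of B s]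
        by (simp add: coarse_def) (simp add: pb_def)
    qed (use B str_bot_coarse[OF Y B] in auto)
  show "?\<mu> \<in> clusters Y"
  proof (rule clustersI)
    fix B assume B: "B \<subseteq> pts Y"
    show "?\<mu> B \<in> coarse Y B" by (rule coarse[OF B])
    fix C assume C: "C \<subseteq> B"
    show "str_le (pb id C (?\<mu> B)) (?\<mu> C)"
    proof (cases "B \<subseteq> f ` pts X")
      case True
      then have "C \<subseteq> f ` pts X" using C by auto
      then show ?thesis using True pb_family_restrict[OF \<kappa> sB[OF True] C] by simp
    next
      case False
      then have "pb id C (?\<mu> B) = str_bot Y C" using B C by (simp add: str_bot_restrict)
      then show ?thesis using str_bot_least[OF coarse[of C]] B C by simp
    qed
    show "pb id C (?\<mu> B) = ?\<mu> C" if dense: "\<forall>b \<in> B. \<exists>c \<in> C. (b, c) \<in> fst (?\<mu> B)"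
    proof (cases "B \<subseteq> f ` pts X")
      case True
      then have "C \<subseteq> f ` pts X" using C by auto
      then show ?thesis using True dense pb_family_dense[OF \<kappa> sB[OF True] C] by simp
    next
      case False
      then have "B = C" using dense B C by (auto simp: str_bot_def)
      then show ?thesis using False B by (simp add: str_bot_restrict)
    qed
  next
    fix B assume "\<not> B \<subseteq> pts Y"
    then show "?\<mu> B = str_top {}"
      using order.trans[OF _ fX, of B] by auto
  qed
  show "\<kappa> = cl_pull X f ?\<mu>"
  proof
    fix A
    show "\<kappa> A = cl_pull X f ?\<mu> A"
    proof (cases "A \<subseteq> pts X")
      case True
      let ?r = "s \<circ> f"
      \<comment> \<open>The union bridges two possibly incomparable subsets: descent from it to
        \<open>A\<close>, replacement of points by their representatives via \<open>pb_cong\<close>,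
        then descent from it to the representatives.\<close>
      let ?C = "A \<union> ?r ` A"
      have r: "?r a \<in> pts X" "f (?r a) = f a" if "a \<in> A" for a
        using that True s by auto
      have C: "?C \<subseteq> pts X" using True r by auto
      note C_strs = cl_strs[OF \<kappa> C]
      have rel: "(?r a, a) \<in> fst (\<kappa> ?C)" if "a \<in> A" for a
      proof -
        have "(?r a, a) \<in> fst (pb f ?C (str_bot Y (f ` ?C)))"
          using that r(2)[OF that] by (auto simp: pb_def str_bot_def)
        then show ?thesis using kerA[OF C] by (auto simp: str_le_def)
      qed
      have "\<kappa> A = pb id A (\<kappa> ?C)"
      proof (rule cl_dense[OF \<kappa> C, symmetric])
        show "\<exists>b \<in> A. (c, b) \<in> fst (\<kappa> ?C)" if "c \<in> ?C" for c
          using that rel strs_refl[OF C_strs that] by blast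
      qed auto
      also have "\<dots> = pb ?r A (\<kappa> ?C)"
        using strs_sym[OF C_strs rel] by (intro pb_cong[OF C_strs]) auto
      also have "\<dots> = pb ?r A (pb id (?r ` A) (\<kappa> ?C))"
        by (simp only: pb_image)
      also have "pb id (?r ` A) (\<kappa> ?C) = \<kappa> (?r ` A)"
      proof (rule cl_dense[OF \<kappa> C])
        show "\<exists>b \<in> ?r ` A. (c, b) \<in> fst (\<kappa> ?C)" if "c \<in> ?C" for c
          using that rel strs_sym[OF C_strs rel] strs_refl[OF C_strs that] by blast
      qed auto
      also have "pb ?r A (\<kappa> (?r ` A)) = pb f A (pb s (f ` A) (\<kappa> (s ` f ` A)))"
        by (subst pb_comp) (auto simp: image_comp)
      also have "\<dots> = cl_pull X f ?\<mu> A"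
        using True by (simp add: cl_pull_def image_mono)
      finally show ?thesis .
    qed (simp add: cl_pull_def cl_outside[OF \<kappa>])
  qed
qed

section \<open>Kernels and their realization by quotients\<close>

definition cl_ker :: "'u aspace \<Rightarrow> ('u \<Rightarrow> 'u) \<Rightarrow> 'u aspace \<Rightarrow> 'u cluster" where
  "cl_ker X f Y = cl_pull X f (cl_sub Y {})"

lemma cl_ker_eq:
  assumes f: "contraction X Y f" and A: "A \<subseteq> pts X"
  shows "cl_ker X f Y A = ({(x, y). x \<in> A \<and> y \<in> A \<and> f x = f y},
    \<lambda>x S. if x \<in> A \<and> S \<subseteq> A then dist Y (f x, f ` S) else 0)"
proof -
  have "f ` A \<subseteq> pts Y" using f A by (auto simp: contraction_def)
  then have "cl_ker X f Y A = pb f A (str_bot Y (f ` A))"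
    using A by (simp add: cl_ker_def cl_pull_at cl_sub_empty)
  then show ?thesis
    by (simp only:, intro str_eqI) (auto simp: pb_def str_bot_def image_mono)
qed

text \<open>A kernel on a subset is the restriction of the kernel on the whole space, and \<kappa>
  is monotone under restriction, so a comparison at \<open>pts X\<close> propagates to every
  subset.\<close>

lemma cl_ker_le_iff:
  assumes f: "contraction X Y f" and Y: "approach_space Y" and \<kappa>: "\<kappa> \<in> clusters X"
  shows "cl_le (cl_ker X f Y) \<kappa> \<longleftrightarrow> str_le (cl_ker X f Y (pts X)) (\<kappa> (pts X))"
proof
  assume le: "str_le (cl_ker X f Y (pts X)) (\<kappa> (pts X))"
  have ker: "cl_ker X f Y \<in> clusters X"
    unfolding cl_ker_def by (intro cl_pull_closed[OF f] cl_sub_closed Y)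
  show "cl_le (cl_ker X f Y) \<kappa>"
  proof (rule cl_leI[OF ker \<kappa>])
    fix A assume A: "A \<subseteq> pts X"
    have "cl_ker X f Y A = pb id A (cl_ker X f Y (pts X))"
      using A by (intro str_eqI) (auto simp: cl_ker_eq[OF f] pb_def)
    then show "str_le (cl_ker X f Y A) (\<kappa> A)"
      using pb_mono[OF le] cl_restrict[OF \<kappa> order.refl A] by (metis str_le_trans)
  qed
qed (simp add: cl_le_def)

lemma approach_spaceI:
  assumes K: "K \<in> strs A" and empty: "\<And>x. x \<in> A \<Longrightarrow> snd K x {} = \<infinity>"
  shows "approach_space \<lparr>pts = A, dist = restrict (\<lambda>(x, S). snd K x S) (A \<times> Pow A)\<rparr>"
  unfolding approach_space_def enlarge_def
  using strs_zero[OF K strs_refl[OF K]] empty strs_Un[OF K] strs_tri[OF K]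
  by (auto cong: conj_cong)

text \<open>The quotient is built on representatives inside \<open>pts X\<close>, which keeps it in
  the same type and as small as \<open>X\<close>. The infinite distance to the empty set is what
  distinguishes kernels among the coarser structures.\<close>

lemma kernel_exists:
  assumes K: "K \<in> coarse X (pts X)" and empty: "\<And>x. x \<in> pts X \<Longrightarrow> snd K x {} = \<infinity>"
  shows "\<exists>Y f. approach_space Y \<and> pts Y \<subseteq> pts X \<and> f \<in> extensional (pts X) \<and> contraction X Y f \<and>
    cl_ker X f Y (pts X) = K"
proof -
  note Ks = coarse_strs[OF K]
  \<comment> \<open>Related points satisfy the same predicate, so the choice depends only on the
    class and picks equal representatives for related points.\<close>
  define r where "r = restrict (\<lambda>x. SOME y. (x, y) \<in> fst K) (pts X)"
  define R where "R = r ` pts X"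
  have r: "(x, r x) \<in> fst K" if "x \<in> pts X" for x
    using that someI[of "\<lambda>y. (x, y) \<in> fst K", OF strs_refl[OF Ks that]] by (simp add: r_def)
  have R: "R \<subseteq> pts X"
    using r strs_rel_subset[OF Ks] by (auto simp: R_def)
  have r_eq: "r x = r y \<longleftrightarrow> (x, y) \<in> fst K" if "x \<in> pts X" "y \<in> pts X" for x y
  proof
    assume "r x = r y"
    then show "(x, y) \<in> fst K"
      using strs_trans[OF Ks r[OF that(1)]] strs_sym[OF Ks r[OF that(2)]] by simp
  next
    assume "(x, y) \<in> fst K"
    then have "(x, z) \<in> fst K \<longleftrightarrow> (y, z) \<in> fst K" for z
      using strs_trans[OF Ks] strs_sym[OF Ks] by blast
    then show "r x = r y" using that by (simp add: r_def)
  qed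
  define Y where "Y = \<lparr>pts = R, dist = restrict (\<lambda>(x, S). snd (pb id R K) x S) (R \<times> Pow R)\<rparr>"
  have d: "dist Y (r x, r ` S) = snd K x S" if x: "x \<in> pts X" and S: "S \<subseteq> pts X" for x S
  proof -
    have "dist Y (r x, r ` S) = snd (pb r (pts X) K) x S"
      using x S by (auto simp: Y_def R_def pb_def)
    also have "pb r (pts X) K = pb id (pts X) K"
      using strs_sym[OF Ks r] by (intro pb_cong[OF Ks]) simp
    finally show ?thesis by (simp add: pb_id[OF Ks])
  qed
  have Ya: "approach_space Y"
    unfolding Y_def using R empty by (intro approach_spaceI pb_strs[OF Ks]) (auto simp: pb_def)
  moreover have c: "contraction X Y r"
    using K d by (auto simp: contraction_def coarse_def Y_def R_def)
  moreover have "cl_ker X r Y (pts X) = K"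
  proof (rule str_eqI)
    show "(x, y) \<in> fst (cl_ker X r Y (pts X)) \<longleftrightarrow> (x, y) \<in> fst K" for x y
      using r_eq strs_rel_subset[OF Ks] by (auto simp: cl_ker_eq[OF c])
    show "snd (cl_ker X r Y (pts X)) x S = snd K x S" for x S
      using d strs_outside[OF Ks] by (auto simp: cl_ker_eq[OF c])
  qed
  ultimately show ?thesis using R by (intro exI[of _ Y] exI[of _ r]) (auto simp: Y_def r_def)
qed

section \<open>Forms from infimum-preserving inverse images\<close>

lemma complete_lattice_imp_bounded:
  assumes "complete_lattice L"
  shows "bounded_lattice L"
proof -
  interpret complete_lattice L by fact
  show ?thesis
    by unfold_locales (use bottom_exists top_exists in auto)
qed

text \<open>Only inverse images are given. Since they preserve all meets of complete lattices,
  direct images are recovered as left adjoints, and their functoriality follows by comparing upper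
  bounds.\<close>

locale inverse_image_form = category C
  for C :: "('o, 'm) cat" (structure) +
  fixes L :: "'o \<Rightarrow> 'u gorder" and pull :: "'m \<Rightarrow> 'u \<Rightarrow> 'u"
  assumes small_hom: "X \<in> Ob C \<Longrightarrow> Y \<in> Ob C \<Longrightarrow> small TYPE('u) (hom C X Y)"
    and small_fibre: "X \<in> Ob C \<Longrightarrow> small TYPE('u) (carrier (L X))"
    and fibre_complete: "X \<in> Ob C \<Longrightarrow> complete_lattice (L X)"
    and pull_carrier: "f \<in> hom C X Y \<Longrightarrow> T \<in> carrier (L Y) \<Longrightarrow> pull f T \<in> carrier (L X)"
    and pull_inf: "f \<in> hom C X Y \<Longrightarrow> \<T> \<subseteq> carrier (L Y) \<Longrightarrow>
      pull f (\<Sqinter>\<^bsub>L Y\<^esub>\<T>) = \<Sqinter>\<^bsub>L X\<^esub>(pull f ` \<T>)"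
    and pull_funct: "f \<in> hom C X Y \<Longrightarrow> g \<in> hom C Y Z \<Longrightarrow> T \<in> carrier (L Z) \<Longrightarrow>
      pull (g \<cdot> f) T = pull f (pull g T)"
    and pull_ident: "X \<in> Ob C \<Longrightarrow> T \<in> carrier (L X) \<Longrightarrow> pull (Id C X) T = T"
begin

definition push :: "'m \<Rightarrow> 'u \<Rightarrow> 'u" where
  "push f S = \<Sqinter>\<^bsub>L (Cod C f)\<^esub>{T \<in> carrier (L (Cod C f)). S \<sqsubseteq>\<^bsub>L (Dom C f)\<^esub> pull f T}"

definition the_form :: "('o, 'm, 'u) form" where
  "the_form = \<lparr>Fib = L, Push = push, Pull = pull\<rparr>"

lemma the_form_simps [simp]: "Fib the_form = L" "Push the_form = push" "Pull the_form = pull"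
  by (simp_all add: the_form_def)

lemma hom_Ob: "f \<in> hom C X Y \<Longrightarrow> X \<in> Ob C \<and> Y \<in> Ob C"
  using dom_cod[of f] by (auto simp: hom_def)

lemma push_eq:
  "f \<in> hom C X Y \<Longrightarrow> push f S = \<Sqinter>\<^bsub>L Y\<^esub>{T \<in> carrier (L Y). S \<sqsubseteq>\<^bsub>L X\<^esub> pull f T}"
  by (simp add: push_def hom_def)

lemma push_carrier: "f \<in> hom C X Y \<Longrightarrow> push f S \<in> carrier (L Y)"
proof -
  assume f: "f \<in> hom C X Y"
  interpret complete_lattice "L Y" using hom_Ob[OF f] fibre_complete by auto
  show ?thesis unfolding push_eq[OF f] by (rule inf_closed) auto
qed

lemma pull_le_pull:
  assumes f: "f \<in> hom C X Y" and ST: "S \<in> carrier (L Y)" "T \<in> carrier (L Y)" and le: "S \<sqsubseteq>\<^bsub>L Y\<^esub> T"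
  shows "pull f S \<sqsubseteq>\<^bsub>L X\<^esub> pull f T"
proof -
  interpret X: complete_lattice "L X" using hom_Ob[OF f] fibre_complete by auto
  interpret Y: complete_lattice "L Y" using hom_Ob[OF f] fibre_complete by auto
  \<comment> \<open>Monotonicity is preservation of the meet of a comparable pair.\<close>
  have "\<Sqinter>\<^bsub>L Y\<^esub>{S, T} = S"
    using ST le by (intro Y.le_antisym Y.inf_lower Y.inf_greatest) auto
  then have "pull f S = \<Sqinter>\<^bsub>L X\<^esub>{pull f S, pull f T}"
    using pull_inf[OF f, of "{S, T}"] ST by simp
  then show ?thesis
    using X.inf_lower[of "{pull f S, pull f T}" "pull f T"] pull_carrier[OF f] ST by simp
qed

lemma push_pull_adjoint:
  assumes f: "f \<in> hom C X Y" and S: "S \<in> carrier (L X)" and T: "T \<in> carrier (L Y)"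
  shows "push f S \<sqsubseteq>\<^bsub>L Y\<^esub> T \<longleftrightarrow> S \<sqsubseteq>\<^bsub>L X\<^esub> pull f T"
proof -
  interpret X: complete_lattice "L X" using hom_Ob[OF f] fibre_complete by auto
  interpret Y: complete_lattice "L Y" using hom_Ob[OF f] fibre_complete by auto
  let ?U = "{T \<in> carrier (L Y). S \<sqsubseteq>\<^bsub>L X\<^esub> pull f T}"
  \<comment> \<open>Preservation of arbitrary meets enters here: \<open>S\<close> lies below the
    inverse image of every candidate, hence below the inverse image of their meet.\<close>
  have unit: "S \<sqsubseteq>\<^bsub>L X\<^esub> pull f (push f S)"
    unfolding push_eq[OF f] using S pull_carrier[OF f]
    by (subst pull_inf[OF f]) (auto intro!: X.inf_greatest)
  show ?thesis
  proof
    assume "push f S \<sqsubseteq>\<^bsub>L Y\<^esub> T"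
    then have "pull f (push f S) \<sqsubseteq>\<^bsub>L X\<^esub> pull f T"
      by (rule pull_le_pull[OF f push_carrier[OF f] T])
    then show "S \<sqsubseteq>\<^bsub>L X\<^esub> pull f T"
      using X.le_trans[OF unit] S T pull_carrier[OF f] push_carrier[OF f] by simp
  next
    assume "S \<sqsubseteq>\<^bsub>L X\<^esub> pull f T"
    then show "push f S \<sqsubseteq>\<^bsub>L Y\<^esub> T"
      unfolding push_eq[OF f] using T by (intro Y.inf_lower) auto
  qed
qed

lemma push_le_push:
  assumes f: "f \<in> hom C X Y" and ST: "S \<in> carrier (L X)" "T \<in> carrier (L X)" and le: "S \<sqsubseteq>\<^bsub>L X\<^esub> T"
  shows "push f S \<sqsubseteq>\<^bsub>L Y\<^esub> push f T"
proof -
  interpret X: complete_lattice "L X" using hom_Ob[OF f] fibre_complete by auto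
  interpret Y: complete_lattice "L Y" using hom_Ob[OF f] fibre_complete by auto
  have "T \<sqsubseteq>\<^bsub>L X\<^esub> pull f (push f T)"
    using push_pull_adjoint[OF f ST(2) push_carrier[OF f, of T]] push_carrier[OF f, of T] by simp
  then have "S \<sqsubseteq>\<^bsub>L X\<^esub> pull f (push f T)"
    using X.le_trans[OF le] ST push_carrier[OF f] pull_carrier[OF f] by simp
  then show ?thesis using push_pull_adjoint[OF f ST(1) push_carrier[OF f]] by simp
qed

lemma push_funct:
  assumes f: "f \<in> hom C X Y" and g: "g \<in> hom C Y Z" and S: "S \<in> carrier (L X)"
  shows "push (g \<cdot> f) S = push g (push f S)"
proof -
  interpret Z: complete_lattice "L Z" using hom_Ob[OF g] fibre_complete by auto
  note gf = comp_hom[OF f g]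
  have *: "push (g \<cdot> f) S \<sqsubseteq>\<^bsub>L Z\<^esub> T \<longleftrightarrow> push g (push f S) \<sqsubseteq>\<^bsub>L Z\<^esub> T" if T: "T \<in> carrier (L Z)" for T
    using push_pull_adjoint[OF gf S T] push_pull_adjoint[OF g push_carrier[OF f] T]
      push_pull_adjoint[OF f S pull_carrier[OF g T]] pull_funct[OF f g T] by simp
  show ?thesis
    using *[OF push_carrier[OF gf, of S]] *[OF push_carrier[OF g, of "push f S"]]
      push_carrier[OF gf, of S] push_carrier[OF g, of "push f S"]
    by (intro Z.le_antisym) auto
qed

lemma push_ident:
  assumes X: "X \<in> Ob C" and S: "S \<in> carrier (L X)"
  shows "push (Id C X) S = S"
proof -
  interpret X: complete_lattice "L X" using X fibre_complete by auto
  note i = id_hom[OF X]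
  have *: "push (Id C X) S \<sqsubseteq>\<^bsub>L X\<^esub> T \<longleftrightarrow> S \<sqsubseteq>\<^bsub>L X\<^esub> T" if "T \<in> carrier (L X)" for T
    using push_pull_adjoint[OF i S that] pull_ident[OF X that] by simp
  show ?thesis
    using *[OF push_carrier[OF i, of S]] *[OF S] push_carrier[OF i, of S] S by (intro X.le_antisym) auto
qed

lemma
  assumes f: "f \<in> hom C X Y"
  shows isotone_push: "isotone (L X) (L Y) (push f)"
    and isotone_pull: "isotone (L Y) (L X) (pull f)"
proof -
  interpret X: complete_lattice "L X" using hom_Ob[OF f] fibre_complete by auto
  interpret Y: complete_lattice "L Y" using hom_Ob[OF f] fibre_complete by auto
  show "isotone (L X) (L Y) (push f)" "isotone (L Y) (L X) (pull f)"
    using push_le_push[OF f] pull_le_pull[OF f] X.weak_partial_order_axioms Y.weak_partial_order_axioms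
    by (auto simp: isotone_def)
qed

lemma orean: "orean_form C the_form"
  by (intro orean_form.intro orean_form_axioms.intro category_axioms)
    (simp_all add: small_hom small_fibre complete_lattice_imp_bounded fibre_complete push_carrier
      pull_carrier isotone_push isotone_pull push_pull_adjoint push_funct pull_funct push_ident pull_ident)

sublocale orean_form C the_form
  by (rule orean)

text \<open>The join with the kernel lies above the kernel, so it is the inverse image of some
  \<open>T\<close>. Adjunction puts \<open>push f S\<close> below \<open>T\<close>, which is the
  nontrivial inequality.\<close>

lemma pull_push_if_exact:
  assumes f: "f \<in> hom C X Y" and S: "S \<in> carrier (L X)"
    and exact: "\<And>R. R \<in> carrier (L X) \<Longrightarrow> Ker f \<sqsubseteq>\<^bsub>L X\<^esub> R \<Longrightarrow> \<exists>T \<in> carrier (L Y). R = pull f T"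
  shows "pull f (push f S) = S \<squnion>\<^bsub>L X\<^esub> Ker f"
proof -
  interpret X: complete_lattice "L X" using hom_Ob[OF f] fibre_complete by auto
  interpret Y: complete_lattice "L Y" using hom_Ob[OF f] fibre_complete by auto
  note cl = push_carrier[OF f] pull_carrier[OF f]
  have Ker: "Ker f = pull f \<bottom>\<^bsub>L Y\<^esub>" using f by (simp add: Ker_def hom_def)
  then have K: "Ker f \<in> carrier (L X)" using cl by simp
  have SK: "S \<squnion>\<^bsub>L X\<^esub> Ker f \<in> carrier (L X)" using S K by simp
  obtain T where T: "T \<in> carrier (L Y)" "S \<squnion>\<^bsub>L X\<^esub> Ker f = pull f T"
    using exact[OF SK] X.join_right[OF S K] by auto
  have "S \<sqsubseteq>\<^bsub>L X\<^esub> pull f T" using X.join_left[OF S K] T by simp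
  then have "push f S \<sqsubseteq>\<^bsub>L Y\<^esub> T" using push_pull_adjoint[OF f S T(1)] by simp
  then have "pull f (push f S) \<sqsubseteq>\<^bsub>L X\<^esub> S \<squnion>\<^bsub>L X\<^esub> Ker f"
    using pull_le_pull[OF f cl(1) T(1)] T(2) by simp
  moreover have "S \<squnion>\<^bsub>L X\<^esub> Ker f \<sqsubseteq>\<^bsub>L X\<^esub> pull f (push f S)"
  proof (rule X.join_le)
    show "S \<sqsubseteq>\<^bsub>L X\<^esub> pull f (push f S)"
      using push_pull_adjoint[OF f S cl(1)[of S]] cl(1)[of S] by simp
    show "Ker f \<sqsubseteq>\<^bsub>L X\<^esub> pull f (push f S)"
      unfolding Ker using cl by (intro pull_le_pull[OF f]) auto
  qed (use S K cl in auto)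
  ultimately show ?thesis using SK cl S by (intro X.le_antisym) auto
qed

text \<open>The meet with the image lies below the image, so it can be compared with
  \<open>push f (pull f T)\<close> after pulling back, where the unit of the adjunction
  decides.\<close>

lemma push_pull_if_reflecting:
  assumes f: "f \<in> hom C X Y" and T: "T \<in> carrier (L Y)"
    and reflect: "\<And>R R'. R \<in> carrier (L Y) \<Longrightarrow> R' \<in> carrier (L Y) \<Longrightarrow> R \<sqsubseteq>\<^bsub>L Y\<^esub> Im f \<Longrightarrow>
      pull f R \<sqsubseteq>\<^bsub>L X\<^esub> pull f R' \<Longrightarrow> R \<sqsubseteq>\<^bsub>L Y\<^esub> R'"
  shows "push f (pull f T) = T \<sqinter>\<^bsub>L Y\<^esub> Im f"
proof -
  interpret X: complete_lattice "L X" using hom_Ob[OF f] fibre_complete by auto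
  interpret Y: complete_lattice "L Y" using hom_Ob[OF f] fibre_complete by auto
  note cl = push_carrier[OF f] pull_carrier[OF f]
  have Im: "Im f = push f \<top>\<^bsub>L X\<^esub>" using f by (simp add: Im_def hom_def)
  then have I: "Im f \<in> carrier (L Y)" using cl by simp
  have TI: "T \<sqinter>\<^bsub>L Y\<^esub> Im f \<in> carrier (L Y)" using T I by simp
  have unit: "pull f T \<sqsubseteq>\<^bsub>L X\<^esub> pull f (push f (pull f T))"
    using push_pull_adjoint[OF f cl(2)[OF T] cl(1)[of "pull f T"]] cl(1)[of "pull f T"] by simp
  have "pull f (T \<sqinter>\<^bsub>L Y\<^esub> Im f) \<sqsubseteq>\<^bsub>L X\<^esub> pull f T"
    using Y.meet_left[OF T I] by (rule pull_le_pull[OF f TI T])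
  then have "pull f (T \<sqinter>\<^bsub>L Y\<^esub> Im f) \<sqsubseteq>\<^bsub>L X\<^esub> pull f (push f (pull f T))"
    using X.le_trans[OF _ unit] cl T TI by simp
  then have "T \<sqinter>\<^bsub>L Y\<^esub> Im f \<sqsubseteq>\<^bsub>L Y\<^esub> push f (pull f T)"
    using Y.meet_right[OF T I] by (intro reflect[OF TI cl(1)])
  moreover have "push f (pull f T) \<sqsubseteq>\<^bsub>L Y\<^esub> T \<sqinter>\<^bsub>L Y\<^esub> Im f"
  proof (rule Y.meet_le)
    show "push f (pull f T) \<sqsubseteq>\<^bsub>L Y\<^esub> T"
      using push_pull_adjoint[OF f cl(2)[OF T] T] cl T by simp
    show "push f (pull f T) \<sqsubseteq>\<^bsub>L Y\<^esub> Im f"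
      unfolding Im using cl T by (intro push_le_push[OF f]) auto
  qed (use T I cl in auto)
  ultimately show ?thesis using TI cl by (intro Y.le_antisym) auto
qed

end

section \<open>Cardinality\<close>

lemma small_inj:
  assumes "inj_on f A" "f ` A \<subseteq> B" "small TYPE('u) B"
  shows "small TYPE('u) A"
  using assms card_of_ordLeqI[of f A B] ordLeq_ordLess_trans unfolding small_def by blast

lemma universe_infinite: "universe TYPE('u) \<Longrightarrow> infinite (UNIV :: 'u set)"
  using universe_def ordLess_imp_ordLeq infinite_iff_natLeq_ordLeq by blast

lemma small_countable:
  assumes U: "universe TYPE('u)" and A: "countable A"
  shows "small TYPE('u) A"
proof -
  obtain f :: "_ \<Rightarrow> nat" where "inj_on f A" using A by (rule countableE)
  then have "|A| \<le>o |UNIV :: nat set|" by (rule card_of_ordLeqI) simp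
  moreover have "|UNIV :: nat set| <o |UNIV :: 'u set|"
    using U card_of_nat unfolding universe_def by (blast intro: ordIso_ordLess_trans)
  ultimately show ?thesis unfolding small_def by (rule ordLeq_ordLess_trans)
qed

lemma small_Pow:
  assumes U: "universe TYPE('u)" and A: "small TYPE('u) A"
  shows "small TYPE('u) (Pow A)"
proof -
  obtain f :: "_ \<Rightarrow> 'u" where f: "inj_on f A"
    using A ordLess_imp_ordLeq card_of_ordLeq unfolding small_def by metis
  have "|f ` A| <o |UNIV :: 'u set|"
    using A card_of_image ordLeq_ordLess_trans unfolding small_def by blast
  then have "small TYPE('u) (Pow (f ` A))" using U unfolding universe_def small_def by blast
  then show ?thesis
    using f inj_on_image_Pow by (intro small_inj[of "image f" "Pow A"]) auto
qed

text \<open>Coding a pair as a two-element subset of the disjoint sum reduces products to sums and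
  power sets.\<close>

lemma small_Times:
  assumes U: "universe TYPE('u)" and A: "small TYPE('u) A" and B: "small TYPE('u) B"
  shows "small TYPE('u) (A \<times> B)"
proof (rule small_inj)
  show "small TYPE('u) (Pow (A <+> B))"
    using card_of_Plus_ordLess_infinite[OF universe_infinite[OF U]] A B
    by (intro small_Pow[OF U]) (simp add: small_def)
  show "inj_on (\<lambda>(a, b). {Inl a, Inr b}) (A \<times> B)" by (auto simp: inj_on_def doubleton_eq_iff)
qed auto

text \<open>An extended nonnegative real is determined by the set of rationals whose image lies
  strictly below it, because rationals are dense.\<close>

lemma small_ennreal:
  assumes U: "universe TYPE('u)"
  shows "small TYPE('u) (UNIV :: ennreal set)"
proof (rule small_inj[OF _ _ small_Pow[OF U small_countable[OF U]]])
  show "inj_on (\<lambda>x. {q. ennreal (real_of_rat q) < x}) (UNIV :: ennreal set)"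
  proof (rule inj_onI)
    have "\<not> x < y" if eq: "{q. ennreal (real_of_rat q) < x} = {q. ennreal (real_of_rat q) < y}"
      for x y :: ennreal
    proof
      assume "x < y"
      then obtain q where q: "x < ennreal (real_of_rat q)" "ennreal (real_of_rat q) < y"
        using ennreal_rat_dense by blast
      then have "ennreal (real_of_rat q) < x" using eq by blast
      then show False using q(1) by simp
    qed
    then show "x = y" if "{q. ennreal (real_of_rat q) < x} = {q. ennreal (real_of_rat q) < y}"
      for x y :: ennreal
      using that by (metis linorder_neqE)
  qed
  show "countable (UNIV :: rat set)" by simp
qed simp

text \<open>A cluster is recorded by graphs lying in products and power sets of small sets; on all
  other arguments its values are fixed by the defaults.\<close>

lemma small_clusters:
  assumes U: "universe TYPE('u)" and X: "small TYPE('u) (pts (X :: 'u aspace))"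
  shows "small TYPE('u) (clusters X)"
proof -
  let ?X = "pts X"
  let ?P = "Pow (Pow ?X \<times> (?X \<times> ?X)) \<times> Pow (Pow ?X \<times> (?X \<times> (Pow ?X \<times> (UNIV :: ennreal set))))"
  let ?F = "\<lambda>\<kappa> :: 'u cluster. ({(A, x, y). A \<subseteq> ?X \<and> (x, y) \<in> fst (\<kappa> A)},
    {(A, x, S, snd (\<kappa> A) x S) | A x S. A \<subseteq> ?X \<and> x \<in> A \<and> S \<subseteq> A})"
  have "small TYPE('u) ?P"
    using X small_ennreal[OF U] by (intro small_Times[OF U] small_Pow[OF U]) simp_all
  moreover have "?F ` clusters X \<subseteq> ?P"
  proof (intro image_subsetI)
    fix \<kappa> assume \<kappa>: "\<kappa> \<in> clusters X"
    have "x \<in> ?X \<and> y \<in> ?X" if "A \<subseteq> ?X" "(x, y) \<in> fst (\<kappa> A)" for A x y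
      using strs_rel_subset[OF cl_strs[OF \<kappa> that(1)] that(2)] that(1) by auto
    then show "?F \<kappa> \<in> ?P" by auto
  qed
  moreover have "inj_on ?F (clusters X)"
  proof (rule inj_onI)
    fix \<kappa> \<mu> assume \<kappa>: "\<kappa> \<in> clusters X" and \<mu>: "\<mu> \<in> clusters X" and eq: "?F \<kappa> = ?F \<mu>"
    show "\<kappa> = \<mu>"
    proof
      fix A
      show "\<kappa> A = \<mu> A"
      proof (cases "A \<subseteq> ?X")
        case True
        show ?thesis
        proof (rule str_eqI)
          show "(x, y) \<in> fst (\<kappa> A) \<longleftrightarrow> (x, y) \<in> fst (\<mu> A)" for x y
            using eq True by (auto simp: set_eq_iff)
          show "snd (\<kappa> A) x S = snd (\<mu> A) x S" for x S
          proof (cases "x \<in> A \<and> S \<subseteq> A")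
            case in_A: True
            then have "(A, x, S, snd (\<kappa> A) x S) \<in> snd (?F \<kappa>)" using True by auto
            then have "(A, x, S, snd (\<kappa> A) x S) \<in> snd (?F \<mu>)" by (simp only: eq)
            then show ?thesis by auto
          next
            case False
            then show ?thesis
              using strs_outside[OF cl_strs[OF \<kappa> True]] strs_outside[OF cl_strs[OF \<mu> True]] by simp
          qed
        qed
      qed (simp add: cl_outside[OF \<kappa>] cl_outside[OF \<mu>])
    qed
  qed
  ultimately show ?thesis by (intro small_inj[of ?F])
qed

section \<open>The category of approach spaces\<close>

lemma App_simps [simp]:
  "X \<in> Ob App \<longleftrightarrow> approach_space X \<and> small TYPE('u) (pts (X :: 'u aspace))"
  "Dom App (X, f, Y) = X" "Cod App (X, f, Y) = Y"
  "Id App X = (X, restrict id (pts X), X)"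
  "(Y', g, Z) \<cdot>\<^bsub>App\<^esub> (X, f, Y) = (X, compose (pts X) g f, Z)"
  by (simp_all add: App_def)

lemma App_Ar_iff:
  "(X, f, Y) \<in> Ar App \<longleftrightarrow> X \<in> Ob App \<and> Y \<in> Ob App \<and> f \<in> extensional (pts X) \<and> contraction X Y f"
  by (auto simp: App_def)

lemma App_hom_iff:
  "\<phi> \<in> hom App X Y \<longleftrightarrow> (\<exists>f. \<phi> = (X, f, Y) \<and> (X, f, Y) \<in> Ar App)"
  by (cases \<phi>) (auto simp: hom_def)

lemma App_hom_iff' [simp]: "(X', f, Y') \<in> hom App X Y \<longleftrightarrow> X' = X \<and> Y' = Y \<and> (X, f, Y) \<in> Ar App"
  by (auto simp: App_hom_iff)

lemma contraction_in: "contraction X Y f \<Longrightarrow> x \<in> pts X \<Longrightarrow> f x \<in> pts Y"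
  by (auto simp: contraction_def)

lemma contraction_image: "contraction X Y f \<Longrightarrow> S \<subseteq> pts X \<Longrightarrow> f ` S \<subseteq> pts Y"
  by (auto simp: contraction_def)

lemma contraction_dist:
  "contraction X Y f \<Longrightarrow> x \<in> pts X \<Longrightarrow> S \<subseteq> pts X \<Longrightarrow> dist Y (f x, f ` S) \<le> dist X (x, S)"
  by (simp add: contraction_def)

lemma contractionI:
  assumes "\<And>x. x \<in> pts X \<Longrightarrow> f x \<in> pts Y"
    and "\<And>x S. x \<in> pts X \<Longrightarrow> S \<subseteq> pts X \<Longrightarrow> dist Y (f x, f ` S) \<le> dist X (x, S)"
  shows "contraction X Y f"
  using assms by (auto simp: contraction_def)

lemma contraction_cong:
  assumes "contraction X Y f" and eq: "\<And>x. x \<in> pts X \<Longrightarrow> f x = g x"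
  shows "contraction X Y g"
proof -
  have im: "g ` S = f ` S" if "S \<subseteq> pts X" for S using that eq by (intro image_cong) auto
  show ?thesis
    by (rule contractionI)
      (simp_all add: im eq[symmetric] contraction_in[OF assms(1)] contraction_dist[OF assms(1)])
qed

lemma contraction_comp:
  assumes f: "contraction X Y f" and g: "contraction Y Z g"
  shows "contraction X Z (\<lambda>x. g (f x))"
proof (rule contractionI)
  show "dist Z (g (f x), (\<lambda>x. g (f x)) ` S) \<le> dist X (x, S)" if "x \<in> pts X" "S \<subseteq> pts X" for x S
  proof -
    have "dist Z (g (f x), g ` f ` S) \<le> dist Y (f x, f ` S)"
      using that by (intro contraction_dist[OF g] contraction_in[OF f] contraction_image[OF f])
    then show ?thesis using contraction_dist[OF f that] by (simp add: image_image)
  qed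
qed (auto intro: contraction_in[OF f] contraction_in[OF g])

lemma contraction_compose:
  assumes "contraction X Y f" "contraction Y Z g"
  shows "contraction X Z (compose (pts X) g f)"
  by (rule contraction_cong[OF contraction_comp[OF assms]]) (simp add: compose_def)

lemma contraction_id: "contraction X X (restrict id (pts X))"
  by (rule contraction_cong[where f = id]) (auto simp: contraction_def)

lemma category_App: "category (App :: ('u aspace, 'u amap) cat)"
proof
  show "f \<in> Ar App \<Longrightarrow> Dom App f \<in> Ob App \<and> Cod App f \<in> Ob App" for f :: "'u amap"
    by (cases f) (auto simp: App_Ar_iff)
  show "Id App X \<in> hom App X X" if "X \<in> Ob App" for X :: "'u aspace"
    using that by (auto simp: App_Ar_iff contraction_id)
  show "g \<cdot>\<^bsub>App\<^esub> f \<in> hom App X Z" if "f \<in> hom App X Y" "g \<in> hom App Y Z"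
    for f g :: "'u amap" and X Y Z
    using that by (auto simp: App_hom_iff App_Ar_iff intro: contraction_compose compose_extensional)
  show "Id App Y \<cdot>\<^bsub>App\<^esub> f = f" if f: "f \<in> hom App X Y" for f :: "'u amap" and X Y
  proof -
    obtain k where k: "f = (X, k, Y)" "k \<in> extensional (pts X)" "contraction X Y k"
      using f by (auto simp: App_hom_iff App_Ar_iff)
    then show ?thesis
      using contraction_in[OF k(3)] by (auto simp: compose_def extensional_def intro!: ext)
  qed
  show "f \<cdot>\<^bsub>App\<^esub> Id App X = f" if "f \<in> hom App X Y" for f :: "'u amap" and X Y
    using that by (auto simp: App_hom_iff App_Ar_iff compose_def extensional_def intro!: ext)
  show "(h \<cdot>\<^bsub>App\<^esub> g) \<cdot>\<^bsub>App\<^esub> f = h \<cdot>\<^bsub>App\<^esub> g \<cdot>\<^bsub>App\<^esub> f"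
    if fgh: "f \<in> hom App W X" "g \<in> hom App X Y" "h \<in> hom App Y Z"
    for f g h :: "'u amap" and W X Y Z
  proof -
    obtain k l m where k: "f = (W, k, X)" "g = (X, l, Y)" "h = (Y, m, Z)" "contraction W X k"
      using fgh by (auto simp: App_hom_iff App_Ar_iff)
    then show ?thesis
      using contraction_in[OF k(4)] by (auto simp: compose_def intro!: ext)
  qed
qed

section \<open>Subspaces and initial embeddings\<close>

lemma subspace_eq:
  "subspace X S = \<lparr>pts = S, dist = restrict (\<lambda>(x, T). snd (str_bot X S) x T) (S \<times> Pow S)\<rparr>"
  by (auto simp: subspace_def str_bot_def restrict_def intro!: ext)

lemma pts_subspace [simp]: "pts (subspace X S) = S"
  by (simp add: subspace_def)

lemma dist_subspace [simp]:
  "x \<in> S \<Longrightarrow> T \<subseteq> S \<Longrightarrow> dist (subspace X S) (x, T) = dist X (x, T)"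
  by (simp add: subspace_def)

lemma subspace_approach_space:
  assumes X: "approach_space X" and S: "S \<subseteq> pts X"
  shows "approach_space (subspace X S)"
  unfolding subspace_eq
  by (rule approach_spaceI[OF coarse_strs[OF str_bot_coarse[OF X S]]])
    (use aspace_empty[OF X] S in \<open>auto simp: str_bot_def\<close>)

lemma small_subset: "small TYPE('u) A \<Longrightarrow> B \<subseteq> A \<Longrightarrow> small TYPE('u) B"
  by (rule small_inj[of id]) auto

lemma subspace_Ob: "X \<in> Ob App \<Longrightarrow> S \<subseteq> pts X \<Longrightarrow> subspace X S \<in> Ob App"
  using subspace_approach_space[of X S] small_subset by auto

lemma initial_embeddings_iff:
  "(A, m, X) \<in> initial_embeddings \<longleftrightarrow> (A, m, X) \<in> Ar App \<and> inj_on m (pts A) \<and>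
     (\<forall>x \<in> pts A. \<forall>S \<subseteq> pts A. dist A (x, S) = dist X (m x, m ` S))"
proof
  assume m: "(A, m, X) \<in> initial_embeddings"
  then have Ar: "(A, m, X) \<in> Ar App" and inj: "inj_on m (pts A)"
    and univ: "\<And>Z h. Z \<in> Ob App \<Longrightarrow> h \<in> pts Z \<rightarrow> pts A \<Longrightarrow> contraction Z X (m \<circ> h) \<Longrightarrow> contraction Z A h"
    by (auto simp: initial_embeddings_def)
  from Ar have X: "approach_space X" and c: "contraction A X m" and A: "small TYPE('a) (pts A)"
    by (auto simp: App_Ar_iff)
  \<comment> \<open>The test object for initiality is the set of points of \<open>A\<close> with the
    distance induced from \<open>X\<close>. Its identity map to \<open>A\<close> must be a
    contraction, which is the missing inequality.\<close>
  let ?K = "pb m (pts A) (str_bot X (pts X))"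
  let ?Z = "\<lparr>pts = pts A, dist = restrict (\<lambda>(x, S). snd ?K x S) (pts A \<times> Pow (pts A))\<rparr>"
  have Z_dist: "dist ?Z (x, S) = dist X (m x, m ` S)" if "x \<in> pts A" "S \<subseteq> pts A" for x S
    using that contraction_in[OF c] contraction_image[OF c] by (simp add: pb_def str_bot_def)
  have "approach_space ?Z"
    using contraction_in[OF c] aspace_empty[OF X]
    by (intro approach_spaceI pb_strs[OF str_bot_whole_strs[OF X]]) (auto simp: pb_def str_bot_def)
  then have Z: "?Z \<in> Ob App" using A by simp
  have "contraction ?Z A id"
    using Z_dist contraction_in[OF c] by (intro univ[OF Z] contractionI) auto
  then have "dist A (x, S) \<le> dist X (m x, m ` S)" if "x \<in> pts A" "S \<subseteq> pts A" for x S
    using that Z_dist[OF that] contraction_dist[of ?Z A id x S] by simp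
  then show "(A, m, X) \<in> Ar App \<and> inj_on m (pts A) \<and>
     (\<forall>x \<in> pts A. \<forall>S \<subseteq> pts A. dist A (x, S) = dist X (m x, m ` S))"
    using Ar inj contraction_dist[OF c] by (auto intro: order.antisym)
next
  assume *: "(A, m, X) \<in> Ar App \<and> inj_on m (pts A) \<and>
     (\<forall>x \<in> pts A. \<forall>S \<subseteq> pts A. dist A (x, S) = dist X (m x, m ` S))"
  have "contraction Z A h" if h: "h \<in> pts Z \<rightarrow> pts A" and c: "contraction Z X (m \<circ> h)" for Z h
  proof (rule contractionI)
    show "dist A (h x, h ` S) \<le> dist Z (x, S)" if "x \<in> pts Z" "S \<subseteq> pts Z" for x S
    proof -
      have "h ` S \<subseteq> pts A" "h x \<in> pts A" using that h by auto
      then show ?thesis using contraction_dist[OF c that] * by (simp add: image_comp)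
    qed
  qed (use h in auto)
  then show "(A, m, X) \<in> initial_embeddings" using * by (auto simp: initial_embeddings_def)
qed

lemma surjective_contractions_iff:
  "(X, f, Y) \<in> surjective_contractions \<longleftrightarrow> (X, f, Y) \<in> Ar App \<and> f ` pts X = pts Y"
  by (simp add: surjective_contractions_def)

lemma subspace_embedding:
  assumes "X \<in> Ob App" "S \<subseteq> pts X"
  shows "(subspace X S, restrict id S, X) \<in> initial_embeddings"
proof -
  have im: "restrict id S ` T = T" if "T \<subseteq> S" for T using that by force
  have "contraction (subspace X S) X (restrict id S)"
    using assms im by (intro contractionI) auto
  then show ?thesis
    using assms subspace_Ob[OF assms] im by (simp add: initial_embeddings_iff App_Ar_iff)
qed

text \<open>Equality of records, and not only isomorphism, is reached because both distances are
  extensional on \<open>S \<times> Pow S\<close>.\<close>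

lemma initial_subset_iff:
  assumes X: "X \<in> Ob App" and S: "S \<subseteq> pts X" and A: "A \<in> Ob App" "pts A = S"
  shows "(A, restrict id S, X) \<in> initial_embeddings \<longleftrightarrow> A = subspace X S"
proof
  assume m: "(A, restrict id S, X) \<in> initial_embeddings"
  have im: "restrict id S ` T = T" if "T \<subseteq> S" for T using that by force
  have "dist A = dist (subspace X S)"
  proof (rule extensionalityI)
    show "dist A \<in> extensional (S \<times> Pow S)" using A by (simp add: approach_space_def)
    show "dist (subspace X S) \<in> extensional (S \<times> Pow S)" by (simp add: subspace_def)
    show "dist A z = dist (subspace X S) z" if "z \<in> S \<times> Pow S" for z
      using that m A im by (auto simp: initial_embeddings_iff)
  qed
  then show "A = subspace X S" using A by (intro aspace.equality) auto
qed (use subspace_embedding[OF X S] in simp)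

section \<open>Factorization, lifting and descent of contractions\<close>

lemma image_factorization:
  assumes f: "(X, f, Y) \<in> Ar App"
  shows "(X, f, subspace Y (f ` pts X)) \<in> surjective_contractions"
    and "(subspace Y (f ` pts X), restrict id (f ` pts X), Y) \<in> initial_embeddings"
    and "(X, f, Y) = (subspace Y (f ` pts X), restrict id (f ` pts X), Y) \<cdot>\<^bsub>App\<^esub> (X, f, subspace Y (f ` pts X))"
proof -
  have c: "contraction X Y f" and Y: "Y \<in> Ob App" and X: "X \<in> Ob App" and ext: "f \<in> extensional (pts X)"
    using f by (auto simp: App_Ar_iff)
  have im: "f ` pts X \<subseteq> pts Y" using contraction_image[OF c] by simp
  show "(X, f, subspace Y (f ` pts X)) \<in> surjective_contractions"
    using X ext subspace_Ob[OF Y im] contraction_dist[OF c]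
    by (auto simp: surjective_contractions_iff App_Ar_iff image_mono intro!: contractionI)
  show "(subspace Y (f ` pts X), restrict id (f ` pts X), Y) \<in> initial_embeddings"
    by (rule subspace_embedding[OF Y im])
  show "(X, f, Y) = (subspace Y (f ` pts X), restrict id (f ` pts X), Y) \<cdot>\<^bsub>App\<^esub> (X, f, subspace Y (f ` pts X))"
    using ext by (auto simp: compose_def extensional_def intro!: ext)
qed

lemma lift_through_embedding:
  assumes m: "(A, m, X) \<in> initial_embeddings" and f: "(Z, f, X) \<in> Ar App"
    and im: "f ` pts Z \<subseteq> m ` pts A"
  shows "\<exists>h. (Z, h, A) \<in> Ar App \<and> (\<forall>z \<in> pts Z. m (h z) = f z)"
proof (intro exI conjI)
  let ?h = "restrict (\<lambda>z. inv_into (pts A) m (f z)) (pts Z)"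
  have h: "?h z \<in> pts A" "m (?h z) = f z" if "z \<in> pts Z" for z
    using that im f_inv_into_f[of "f z" m "pts A"] inv_into_into[of "f z" m "pts A"] by auto
  have "contraction Z A ?h"
  proof (rule contractionI)
    show "dist A (?h z, ?h ` S) \<le> dist Z (z, S)" if z: "z \<in> pts Z" and S: "S \<subseteq> pts Z" for z S
    proof -
      have "?h ` S \<subseteq> pts A" using h S by blast
      then have "dist A (?h z, ?h ` S) = dist X (m (?h z), m ` ?h ` S)"
        using m h(1)[OF z] by (simp only: initial_embeddings_iff)
      also have "m ` ?h ` S = f ` S"
        unfolding image_image using h S by (intro image_cong) auto
      finally show ?thesis
        using h(2)[OF z] contraction_dist[OF _ z S, of X f] f by (simp add: App_Ar_iff)
    qed
  qed (rule h)
  then show "(Z, ?h, A) \<in> Ar App" using m f by (simp add: App_Ar_iff initial_embeddings_iff)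
  show "\<forall>z \<in> pts Z. m (?h z) = f z" using h by blast
qed

text \<open>The hypotheses \<open>eq\<close> and \<open>le\<close> are what inequality of the
  kernels of \<open>p\<close> and \<open>g\<close> unfolds to. Every subset of \<open>Q\<close> is
  the image of a subset of \<open>X\<close>, so they bound all distances of the induced map.\<close>

lemma descend_along_surjection:
  assumes p: "(X, p, Q) \<in> surjective_contractions" and g: "(X, g, Z) \<in> Ar App"
    and eq: "\<And>x y. x \<in> pts X \<Longrightarrow> y \<in> pts X \<Longrightarrow> p x = p y \<Longrightarrow> g x = g y"
    and le: "\<And>x S. x \<in> pts X \<Longrightarrow> S \<subseteq> pts X \<Longrightarrow> dist Z (g x, g ` S) \<le> dist Q (p x, p ` S)"
  shows "\<exists>h. (Q, h, Z) \<in> Ar App \<and> (\<forall>x \<in> pts X. h (p x) = g x)"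
proof -
  define h where "h = restrict (\<lambda>q. g (inv_into (pts X) p q)) (pts Q)"
  have pX: "p ` pts X = pts Q" using p by (simp add: surjective_contractions_iff)
  have h: "h (p x) = g x" if "x \<in> pts X" for x
    using that pX inv_into_into[of "p x" p "pts X"] f_inv_into_f[of "p x" p "pts X"]
      eq[of "inv_into (pts X) p (p x)" x] by (auto simp: h_def)
  have gc: "contraction X Z g" using g by (simp add: App_Ar_iff)
  have "contraction Q Z h"
  proof (rule contractionI)
    fix q assume "q \<in> pts Q"
    then obtain x where x: "x \<in> pts X" "q = p x" using pX by auto
    then show "h q \<in> pts Z" using h contraction_in[OF gc] by simp
    fix T assume "T \<subseteq> pts Q"
    then obtain S where S: "S \<subseteq> pts X" "T = p ` S" using pX by (metis subset_image_iff)
    have "h ` T = g ` S" unfolding S(2) image_image using h S(1) by (intro image_cong) auto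
    then show "dist Z (h q, h ` T) \<le> dist Q (q, T)"
      using le[OF x(1) S(1)] h[OF x(1)] x(2) S(2) by simp
  qed
  then have "(Q, h, Z) \<in> Ar App"
    using p g by (simp add: App_Ar_iff surjective_contractions_iff h_def)
  then show ?thesis using h by blast
qed

lemma App_eqI:
  assumes "(X, f, Y) \<in> Ar App" "(X, g, Y) \<in> Ar App" "\<And>x. x \<in> pts X \<Longrightarrow> f x = g x"
  shows "(X, f, Y) = (X, g, Y)"
  using assms extensionalityI[of f "pts X" g] by (simp add: App_Ar_iff)

lemma App_comp_eq_iff:
  assumes "(X, f, Y) \<in> Ar App" "(Y, g, Z) \<in> Ar App" "(X, k, Z) \<in> Ar App"
  shows "(Y, g, Z) \<cdot>\<^bsub>App\<^esub> (X, f, Y) = (X, k, Z) \<longleftrightarrow> (\<forall>x \<in> pts X. g (f x) = k x)"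
proof
  assume "\<forall>x \<in> pts X. g (f x) = k x"
  then show "(Y, g, Z) \<cdot>\<^bsub>App\<^esub> (X, f, Y) = (X, k, Z)"
    using assms(3) by (auto simp: App_Ar_iff compose_def extensional_def intro!: ext)
qed (auto simp: compose_def dest: fun_cong)

lemma App_comp_Ar: "(X, f, Y) \<in> Ar App \<Longrightarrow> (Y, g, Z) \<in> Ar App \<Longrightarrow> (X, compose (pts X) g f, Z) \<in> Ar App"
  by (auto simp: App_Ar_iff intro: contraction_compose compose_extensional)

section \<open>The proper factorization system\<close>

lemma App_factorization_system:
  "category.proper_factorization_system App surjective_contractions
     (initial_embeddings :: 'u amap set)"
proof -
  interpret category "App :: ('u aspace, 'u amap) cat" by (rule category_App)
  show ?thesis
    unfolding proper_factorization_system_def orthogonal_factorization_system_def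
  proof (intro conjI ballI allI impI)
    fix \<phi> :: "'u amap" assume iso: "iso \<phi>"
    obtain X f Y where \<phi>: "\<phi> = (X, f, Y)" by (cases \<phi>)
    obtain \<psi> where \<psi>: "\<phi> \<in> Ar App" "\<psi> \<in> hom App Y X" "\<psi> \<cdot>\<^bsub>App\<^esub> \<phi> = Id App X" "\<phi> \<cdot>\<^bsub>App\<^esub> \<psi> = Id App Y"
      using iso by (auto simp: iso_def \<phi>)
    then obtain g where g: "\<psi> = (Y, g, X)" "(Y, g, X) \<in> Ar App" by (auto simp: App_hom_iff)
    have f: "contraction X Y f" "contraction Y X g" using \<psi> g by (auto simp: \<phi> App_Ar_iff)
    have gf: "g (f x) = x" if "x \<in> pts X" for x
      using \<psi>(3) that by (auto simp: \<phi> g compose_def dest: fun_cong[of _ _ x])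
    have fg: "f (g y) = y" if "y \<in> pts Y" for y
      using \<psi>(4) that by (auto simp: \<phi> g compose_def dest: fun_cong[of _ _ y])
    have "f ` pts X = pts Y"
    proof
      show "pts Y \<subseteq> f ` pts X"
        using fg contraction_in[OF f(2)] by (metis image_eqI subsetI)
    qed (rule contraction_image[OF f(1) order.refl])
    then show "\<phi> \<in> surjective_contractions" using \<psi> by (simp add: \<phi> surjective_contractions_iff)
    have "dist X (x, S) = dist Y (f x, f ` S)" if x: "x \<in> pts X" and S: "S \<subseteq> pts X" for x S
    proof (rule order.antisym)
      have "g ` f ` S = (\<lambda>x. x) ` S" unfolding image_image using gf S by (intro image_cong) auto
      then show "dist X (x, S) \<le> dist Y (f x, f ` S)"
        using contraction_dist[OF f(2) contraction_in[OF f(1) x] contraction_image[OF f(1) S]] gf[OF x]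
        by simp
    qed (rule contraction_dist[OF f(1) x S])
    moreover have "inj_on f (pts X)" using gf by (rule inj_on_inverseI)
    ultimately show "\<phi> \<in> initial_embeddings" using \<psi> by (simp add: \<phi> initial_embeddings_iff)
  next
    fix \<phi> \<psi> :: "'u amap"
    assume \<phi>\<psi>: "\<phi> \<in> surjective_contractions" "\<psi> \<in> surjective_contractions" "Cod App \<phi> = Dom App \<psi>"
    obtain X f Y where \<phi>: "\<phi> = (X, f, Y)" by (cases \<phi>)
    with \<phi>\<psi> obtain g Z where \<psi>: "\<psi> = (Y, g, Z)" by (cases \<psi>) simp
    have "compose (pts X) g f ` pts X = g ` f ` pts X" by (force simp: compose_def)
    then show "\<psi> \<cdot>\<^bsub>App\<^esub> \<phi> \<in> surjective_contractions"
      using \<phi>\<psi> App_comp_Ar[of X f Y g Z] by (simp add: \<phi> \<psi> surjective_contractions_iff)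
  next
    fix \<phi> \<psi> :: "'u amap"
    assume \<phi>\<psi>: "\<phi> \<in> initial_embeddings" "\<psi> \<in> initial_embeddings" "Cod App \<phi> = Dom App \<psi>"
    obtain X f Y where \<phi>: "\<phi> = (X, f, Y)" by (cases \<phi>)
    with \<phi>\<psi> obtain g Z where \<psi>: "\<psi> = (Y, g, Z)" by (cases \<psi>) simp
    have f: "(X, f, Y) \<in> Ar App" "inj_on f (pts X)"
        "\<And>x S. x \<in> pts X \<Longrightarrow> S \<subseteq> pts X \<Longrightarrow> dist X (x, S) = dist Y (f x, f ` S)"
      and g: "(Y, g, Z) \<in> Ar App" "inj_on g (pts Y)"
        "\<And>x S. x \<in> pts Y \<Longrightarrow> S \<subseteq> pts Y \<Longrightarrow> dist Y (x, S) = dist Z (g x, g ` S)"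
      using \<phi>\<psi> by (simp_all add: \<phi> \<psi> initial_embeddings_iff)
    have c: "contraction X Y f" using f by (simp add: App_Ar_iff)
    have im: "compose (pts X) g f ` S = g ` f ` S" if "S \<subseteq> pts X" for S
      unfolding image_image using that by (intro image_cong) (auto simp: compose_def)
    have "inj_on (compose (pts X) g f) (pts X)"
      using f(2) g(2) contraction_in[OF c] by (auto simp: inj_on_def compose_def)
    then show "\<psi> \<cdot>\<^bsub>App\<^esub> \<phi> \<in> initial_embeddings"
      using App_comp_Ar[OF f(1) g(1)] f(3) g(3) contraction_in[OF c] contraction_image[OF c] im
      by (simp add: \<phi> \<psi> initial_embeddings_iff compose_eq)
  next
    fix \<phi> :: "'u amap" assume \<phi>A: "\<phi> \<in> Ar App"
    obtain X f Y where \<phi>: "\<phi> = (X, f, Y)" by (cases \<phi>)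
    show "\<exists>e \<in> surjective_contractions. \<exists>m \<in> initial_embeddings. Cod App e = Dom App m \<and> \<phi> = m \<cdot>\<^bsub>App\<^esub> e"
      using image_factorization[of X f Y] \<phi>A unfolding \<phi> by (metis App_simps(2,3))
  next
    fix \<epsilon> \<mu> :: "'u amap" assume \<epsilon>\<mu>: "\<epsilon> \<in> surjective_contractions" "\<mu> \<in> initial_embeddings"
    obtain A e B where \<epsilon>: "\<epsilon> = (A, e, B)" by (cases \<epsilon>)
    obtain X m Y where \<mu>: "\<mu> = (X, m, Y)" by (cases \<mu>)
    have e: "(A, e, B) \<in> Ar App" "e ` pts A = pts B" using \<epsilon>\<mu> by (simp_all add: \<epsilon> surjective_contractions_iff)
    have m: "(X, m, Y) \<in> Ar App" "inj_on m (pts X)" using \<epsilon>\<mu> by (simp_all add: \<mu> initial_embeddings_iff)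
    show "orthogonal \<epsilon> \<mu>"
      unfolding orthogonal_def
    proof (intro ballI impI)
      fix \<upsilon> \<nu> assume "\<upsilon> \<in> hom App (Dom App \<epsilon>) (Dom App \<mu>)" "\<nu> \<in> hom App (Cod App \<epsilon>) (Cod App \<mu>)"
        and sq: "\<mu> \<cdot>\<^bsub>App\<^esub> \<upsilon> = \<nu> \<cdot>\<^bsub>App\<^esub> \<epsilon>"
      then obtain u v where u: "\<upsilon> = (A, u, X)" "(A, u, X) \<in> Ar App"
        and v: "\<nu> = (B, v, Y)" "(B, v, Y) \<in> Ar App"
        by (auto simp: App_hom_iff \<epsilon> \<mu>)
      have uc: "contraction A X u" using u by (simp add: App_Ar_iff)
      have mu: "m (u a) = v (e a)" if "a \<in> pts A" for a
        using sq that by (auto simp: \<epsilon> \<mu> u v compose_def dest: fun_cong[of _ _ a])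
      \<comment> \<open>Since \<open>e\<close> is onto, commutativity places all values of
        \<open>v\<close> in the image of \<open>m\<close>. This gives the diagonal with its lower
        triangle; injectivity of \<open>m\<close> then yields the upper one.\<close>
      have "v ` pts B \<subseteq> m ` pts X"
      proof
        fix y assume "y \<in> v ` pts B"
        then have "y \<in> v ` e ` pts A" by (simp only: e(2))
        then obtain a where a: "a \<in> pts A" "y = v (e a)" by blast
        then have "y = m (u a)" "u a \<in> pts X" using mu contraction_in[OF uc] by auto
        then show "y \<in> m ` pts X" by blast
      qed
      then obtain d where d: "(B, d, X) \<in> Ar App" "\<And>b. b \<in> pts B \<Longrightarrow> m (d b) = v b"
        using lift_through_embedding[of X m Y B v] \<epsilon>\<mu>(2) v(2) unfolding \<mu> by blast
      have dc: "contraction B X d" "contraction A B e" using d e by (simp_all add: App_Ar_iff)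
      have de: "d (e a) = u a" if "a \<in> pts A" for a
      proof (rule inj_onD[OF m(2)])
        show "m (d (e a)) = m (u a)"
          using d(2)[OF contraction_in[OF dc(2) that]] mu[OF that] by simp
      qed (use that contraction_in[OF uc] contraction_in[OF dc(1)] contraction_in[OF dc(2)] in auto)
      show "\<exists>!\<delta>. \<delta> \<in> hom App (Cod App \<epsilon>) (Dom App \<mu>) \<and> \<delta> \<cdot>\<^bsub>App\<^esub> \<epsilon> = \<upsilon> \<and> \<mu> \<cdot>\<^bsub>App\<^esub> \<delta> = \<nu>"
      proof (rule ex1I[of _ "(B, d, X)"])
        have "(B, d, X) \<cdot>\<^bsub>App\<^esub> \<epsilon> = \<upsilon>"
          unfolding \<epsilon> u(1) using App_comp_eq_iff[OF e(1) d(1) u(2)] de by blast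
        moreover have "\<mu> \<cdot>\<^bsub>App\<^esub> (B, d, X) = \<nu>"
          unfolding \<mu> v(1) using App_comp_eq_iff[OF d(1) m(1) v(2)] d(2) by blast
        ultimately show "(B, d, X) \<in> hom App (Cod App \<epsilon>) (Dom App \<mu>) \<and> (B, d, X) \<cdot>\<^bsub>App\<^esub> \<epsilon> = \<upsilon> \<and> \<mu> \<cdot>\<^bsub>App\<^esub> (B, d, X) = \<nu>"
          using d(1) by (simp add: \<epsilon> \<mu>)
      next
        fix \<delta> assume \<delta>: "\<delta> \<in> hom App (Cod App \<epsilon>) (Dom App \<mu>) \<and> \<delta> \<cdot>\<^bsub>App\<^esub> \<epsilon> = \<upsilon> \<and> \<mu> \<cdot>\<^bsub>App\<^esub> \<delta> = \<nu>"
        then obtain d' where d': "\<delta> = (B, d', X)" "(B, d', X) \<in> Ar App" by (auto simp: App_hom_iff \<epsilon> \<mu>)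
        have "d' (e a) = u a" if "a \<in> pts A" for a
          using \<delta> that App_comp_eq_iff[OF e(1) d'(2) u(2)] unfolding \<epsilon> d'(1) u(1) by blast
        then have "d' b = d b" if "b \<in> pts B" for b
          using that de e(2) by force
        then show "\<delta> = (B, d, X)" unfolding d'(1) by (intro App_eqI d'(2) d(1))
      qed
    qed
  next
    fix \<epsilon> :: "'u amap" assume e: "\<epsilon> \<in> surjective_contractions"
    obtain A e B where \<epsilon>: "\<epsilon> = (A, e, B)" by (cases \<epsilon>)
    have eA: "(A, e, B) \<in> Ar App" "e ` pts A = pts B" using e by (simp_all add: \<epsilon> surjective_contractions_iff)
    show "epi \<epsilon>"
      unfolding epi_def
    proof (intro conjI ballI impI)
      fix Z \<gamma> \<eta> assume "\<gamma> \<in> hom App (Cod App \<epsilon>) Z" "\<eta> \<in> hom App (Cod App \<epsilon>) Z"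
        and eq: "\<gamma> \<cdot>\<^bsub>App\<^esub> \<epsilon> = \<eta> \<cdot>\<^bsub>App\<^esub> \<epsilon>"
      then obtain g h where g: "\<gamma> = (B, g, Z)" "(B, g, Z) \<in> Ar App" and h: "\<eta> = (B, h, Z)" "(B, h, Z) \<in> Ar App"
        by (auto simp: App_hom_iff \<epsilon>)
      have "g (e a) = h (e a)" if "a \<in> pts A" for a
        using eq that by (auto simp: \<epsilon> g h compose_def dest: fun_cong[of _ _ a])
      then have "g b = h b" if "b \<in> pts B" for b
        using that eA(2) by force
      then show "\<gamma> = \<eta>" unfolding g(1) h(1) by (intro App_eqI g(2) h(2))
    qed (use eA \<epsilon> in simp)
  next
    fix \<mu> :: "'u amap" assume m: "\<mu> \<in> initial_embeddings"
    obtain A m B where \<mu>: "\<mu> = (A, m, B)" by (cases \<mu>)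
    have mA: "(A, m, B) \<in> Ar App" "inj_on m (pts A)" using m by (simp_all add: \<mu> initial_embeddings_iff)
    show "mono \<mu>"
      unfolding mono_def
    proof (intro conjI ballI impI)
      fix Z \<gamma> \<eta> assume "\<gamma> \<in> hom App Z (Dom App \<mu>)" "\<eta> \<in> hom App Z (Dom App \<mu>)"
        and eq: "\<mu> \<cdot>\<^bsub>App\<^esub> \<gamma> = \<mu> \<cdot>\<^bsub>App\<^esub> \<eta>"
      then obtain g h where g: "\<gamma> = (Z, g, A)" "(Z, g, A) \<in> Ar App" and h: "\<eta> = (Z, h, A)" "(Z, h, A) \<in> Ar App"
        by (auto simp: App_hom_iff \<mu>)
      have c: "contraction Z A g" "contraction Z A h" using g h by (simp_all add: App_Ar_iff)
      have "m (g z) = m (h z)" if "z \<in> pts Z" for z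
        using eq that by (auto simp: \<mu> g h compose_def dest: fun_cong[of _ _ z])
      then have "g z = h z" if "z \<in> pts Z" for z
        using that inj_onD[OF mA(2)] contraction_in[OF c(1)] contraction_in[OF c(2)] by blast
      then show "\<gamma> = \<eta>" unfolding g(1) h(1) by (intro App_eqI g(2) h(2))
    qed (use mA \<mu> in simp)
  qed (auto simp: surjective_contractions_def initial_embeddings_def)
qed

section \<open>The form of clusters\<close>

definition enc :: "'u aspace \<Rightarrow> 'u cluster \<Rightarrow> 'u" where
  "enc X = (SOME e. inj_on e (clusters X))"

definition dec :: "'u aspace \<Rightarrow> 'u \<Rightarrow> 'u cluster" where
  "dec X = inv_into (clusters X) (enc X)"

definition fibre :: "'u aspace \<Rightarrow> 'u gorder" where
  "fibre X = \<lparr>carrier = enc X ` clusters X, eq = (=), le = (\<lambda>u v. cl_le (dec X u) (dec X v))\<rparr>"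

definition app_pull :: "'u amap \<Rightarrow> 'u \<Rightarrow> 'u" where
  "app_pull = (\<lambda>(X, f, Y) u. enc X (cl_pull X f (dec Y u)))"

locale grothendieck_universe =
  fixes U :: "'u itself"
  assumes universe: "universe TYPE('u)"
begin

lemma dec_enc: "X \<in> Ob App \<Longrightarrow> \<kappa> \<in> clusters X \<Longrightarrow> dec X (enc X \<kappa>) = \<kappa>" for X :: "'u aspace"
proof -
  assume X: "X \<in> Ob App" and \<kappa>: "\<kappa> \<in> clusters X"
  have "small TYPE('u) (clusters X)" using small_clusters[OF universe] X by simp
  then have "|clusters X| \<le>o |UNIV :: 'u set|"
    unfolding small_def by (rule ordLess_imp_ordLeq)
  then obtain e :: "'u cluster \<Rightarrow> 'u" where "inj_on e (clusters X)"
    by (auto simp: card_of_ordLeq[symmetric])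
  then have "inj_on (enc X) (clusters X)" unfolding enc_def by (rule someI[of "\<lambda>e. inj_on e (clusters X)"])
  then show ?thesis using \<kappa> by (simp add: dec_def)
qed

lemma fibre_carrier: "carrier (fibre X) = enc X ` clusters X"
  by (simp add: fibre_def)

lemma enc_carrier [simp]: "\<kappa> \<in> clusters X \<Longrightarrow> enc X \<kappa> \<in> carrier (fibre X)"
  by (simp add: fibre_def)

lemma fibre_le_iff:
  "X \<in> Ob App \<Longrightarrow> \<kappa> \<in> clusters X \<Longrightarrow> \<mu> \<in> clusters X \<Longrightarrow>
    enc X \<kappa> \<sqsubseteq>\<^bsub>fibre X\<^esub> enc X \<mu> \<longleftrightarrow> cl_le \<kappa> \<mu>" for X :: "'u aspace"
  by (simp only: fibre_def gorder.simps dec_enc)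

lemma fibre_partial_order:
  assumes X: "X \<in> Ob (App :: ('u aspace, 'u amap) cat)"
  shows "partial_order (fibre X)"
proof
  have "x = y" if "x \<sqsubseteq>\<^bsub>fibre X\<^esub> y" "y \<sqsubseteq>\<^bsub>fibre X\<^esub> x" "x \<in> carrier (fibre X)" "y \<in> carrier (fibre X)" for x y
    using that X by (auto simp: fibre_carrier fibre_le_iff dest: cl_le_antisym)
  then show "x .=\<^bsub>fibre X\<^esub> y" if "x \<sqsubseteq>\<^bsub>fibre X\<^esub> y" "y \<sqsubseteq>\<^bsub>fibre X\<^esub> x" "x \<in> carrier (fibre X)" "y \<in> carrier (fibre X)" for x y
    using that by (simp add: fibre_def)
  show "(.=\<^bsub>fibre X\<^esub>) = (=)" by (simp add: fibre_def)
qed (auto simp: fibre_def cl_le_refl intro: cl_le_trans)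

lemma fibre_inf_greatest:
  assumes X: "X \<in> Ob (App :: ('u aspace, 'u amap) cat)" and \<S>: "\<S> \<subseteq> clusters X"
  shows "greatest (fibre X) (enc X (cl_Inf X \<S>)) (Lower (fibre X) (enc X ` \<S>))"
proof (rule greatest_LowerI)
  have I: "cl_Inf X \<S> \<in> clusters X" using X \<S> by (intro cl_Inf_closed) auto
  then show "enc X (cl_Inf X \<S>) \<in> carrier (fibre X)" by simp
  show "enc X ` \<S> \<subseteq> carrier (fibre X)" using \<S> by auto
  show "enc X (cl_Inf X \<S>) \<sqsubseteq>\<^bsub>fibre X\<^esub> u" if u: "u \<in> enc X ` \<S>" for u
  proof -
    obtain \<kappa> where \<kappa>: "\<kappa> \<in> \<S>" "u = enc X \<kappa>" using u by blast
    then show ?thesis using fibre_le_iff[OF X I] \<S> cl_Inf_lower[OF \<S>] by auto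
  qed
  show "u \<sqsubseteq>\<^bsub>fibre X\<^esub> enc X (cl_Inf X \<S>)" if u: "u \<in> Lower (fibre X) (enc X ` \<S>)" for u
  proof -
    have "u \<in> carrier (fibre X)" using u by (simp add: Lower_def)
    then obtain \<mu> where \<mu>: "\<mu> \<in> clusters X" "u = enc X \<mu>" by (auto simp: fibre_carrier)
    have "cl_le \<mu> \<kappa>" if "\<kappa> \<in> \<S>" for \<kappa>
    proof -
      have "enc X \<mu> \<sqsubseteq>\<^bsub>fibre X\<^esub> enc X \<kappa>" using that u \<S> \<mu>(2) by (auto simp: Lower_def)
      then show ?thesis using fibre_le_iff[OF X \<mu>(1)] that \<S> by auto
    qed
    then show ?thesis using fibre_le_iff[OF X \<mu>(1) I] cl_Inf_greatest[OF \<mu>(1)] \<mu>(2) by simp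
  qed
qed

lemma fibre_complete_lattice:
  assumes X: "X \<in> Ob (App :: ('u aspace, 'u amap) cat)"
  shows "complete_lattice (fibre X)"
proof -
  interpret partial_order "fibre X" by (rule fibre_partial_order[OF X])
  show ?thesis
  proof (rule complete_lattice_criterion1)
    have t: "cl_sub X (pts X) \<in> clusters X" using X by (intro cl_sub_closed) simp
    have "u \<sqsubseteq>\<^bsub>fibre X\<^esub> enc X (cl_sub X (pts X))" if u: "u \<in> carrier (fibre X)" for u
    proof -
      obtain \<kappa> where \<kappa>: "\<kappa> \<in> clusters X" "u = enc X \<kappa>" using u by (auto simp: fibre_carrier)
      then show ?thesis using fibre_le_iff[OF X \<kappa>(1) t] cl_sub_top[OF \<kappa>(1)] X by simp
    qed
    then show "\<exists>g. greatest (fibre X) g (carrier (fibre X))"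
      using t by (intro exI[of _ "enc X (cl_sub X (pts X))"]) (auto simp: greatest_def)
    show "\<exists>i. greatest (fibre X) i (Lower (fibre X) A)" if A: "A \<subseteq> carrier (fibre X)" for A
    proof -
      obtain \<S> where "\<S> \<subseteq> clusters X" "A = enc X ` \<S>"
        using A by (auto simp: fibre_carrier subset_image_iff)
      then show ?thesis using fibre_inf_greatest[OF X] by blast
    qed
  qed
qed

lemma fibre_inf:
  assumes X: "X \<in> Ob (App :: ('u aspace, 'u amap) cat)" and \<S>: "\<S> \<subseteq> clusters X"
  shows "\<Sqinter>\<^bsub>fibre X\<^esub>(enc X ` \<S>) = enc X (cl_Inf X \<S>)"
proof -
  interpret complete_lattice "fibre X" by (rule fibre_complete_lattice[OF X])
  have "enc X ` \<S> \<subseteq> carrier (fibre X)" using \<S> by auto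
  then show ?thesis
    by (rule greatest_unique[OF inf_glb fibre_inf_greatest[OF X \<S>]])
qed

lemma app_pull_enc:
  "Y \<in> Ob App \<Longrightarrow> \<kappa> \<in> clusters Y \<Longrightarrow> app_pull (X, f, Y) (enc Y \<kappa>) = enc X (cl_pull X f \<kappa>)"
  for X Y :: "'u aspace"
  by (simp only: app_pull_def prod.case dec_enc)

lemma small_hom_App:
  fixes X Y :: "'u aspace"
  assumes "X \<in> Ob App" "Y \<in> Ob App"
  shows "small TYPE('u) (hom App X Y)"
proof (rule small_inj)
  show "small TYPE('u) (Pow (pts X \<times> pts Y))"
    using assms by (intro small_Pow[OF universe] small_Times[OF universe]) auto
  let ?g = "\<lambda>(X', f, Y'). {(x, f x) | x. x \<in> pts X}"
  show "?g ` hom App X Y \<subseteq> Pow (pts X \<times> pts Y)"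
    by (auto simp: App_hom_iff App_Ar_iff contraction_def)
  show "inj_on ?g (hom App X Y)"
  proof (rule inj_onI)
    fix \<phi> \<psi> :: "'u amap" assume "\<phi> \<in> hom App X Y" "\<psi> \<in> hom App X Y" and eq: "?g \<phi> = ?g \<psi>"
    then obtain f g where f: "\<phi> = (X, f, Y)" "(X, f, Y) \<in> Ar App" and g: "\<psi> = (X, g, Y)" "(X, g, Y) \<in> Ar App"
      by (auto simp: App_hom_iff)
    have graph: "{(x, f x) | x. x \<in> pts X} = {(x, g x) | x. x \<in> pts X}"
      using eq unfolding f(1) g(1) by simp
    have "f x = g x" if "x \<in> pts X" for x
    proof -
      have "(x, f x) \<in> {(x, g x) | x. x \<in> pts X}" unfolding graph[symmetric] using that by blast
      then show ?thesis by blast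
    qed
    then show "\<phi> = \<psi>" unfolding f(1) g(1) by (rule App_eqI[OF f(2) g(2)])
  qed
qed

lemma inverse_image_form_App: "inverse_image_form App (fibre :: 'u aspace \<Rightarrow> 'u gorder) app_pull"
proof (intro inverse_image_form.intro inverse_image_form_axioms.intro category_App)
  show "small TYPE('u) (hom App X Y)" if "X \<in> Ob App" "Y \<in> Ob App" for X Y :: "'u aspace"
    by (rule small_hom_App[OF that])
  show "small TYPE('u) (carrier (fibre X))" if "X \<in> Ob App" for X :: "'u aspace"
  proof -
    have "small TYPE('u) (clusters X)" using small_clusters[OF universe] that by simp
    then show ?thesis
      unfolding fibre_carrier small_def using card_of_image ordLeq_ordLess_trans by blast
  qed
  show "complete_lattice (fibre X)" if "X \<in> Ob App" for X :: "'u aspace"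
    by (rule fibre_complete_lattice[OF that])
  fix \<phi> :: "'u amap" and X Y assume "\<phi> \<in> hom App X Y"
  then obtain f where \<phi>: "\<phi> = (X, f, Y)" and X: "X \<in> Ob App" and Y: "Y \<in> Ob App" and f: "contraction X Y f"
    by (auto simp: App_hom_iff App_Ar_iff)
  show "app_pull \<phi> u \<in> carrier (fibre X)" if "u \<in> carrier (fibre Y)" for u
    using that cl_pull_closed[OF f] by (auto simp: fibre_carrier \<phi> app_pull_enc[OF Y])
  show "app_pull \<phi> (\<Sqinter>\<^bsub>fibre Y\<^esub>\<T>) = \<Sqinter>\<^bsub>fibre X\<^esub>(app_pull \<phi> ` \<T>)" if \<T>: "\<T> \<subseteq> carrier (fibre Y)" for \<T>
  proof -
    obtain \<S> where \<S>: "\<S> \<subseteq> clusters Y" "\<T> = enc Y ` \<S>"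
      using \<T> by (auto simp: fibre_carrier subset_image_iff)
    have "app_pull \<phi> ` \<T> = enc X ` cl_pull X f ` \<S>"
      unfolding \<S>(2) image_image \<phi> using \<S>(1) app_pull_enc[OF Y] by (intro image_cong) auto
    moreover have "cl_pull X f ` \<S> \<subseteq> clusters X" using \<S>(1) cl_pull_closed[OF f] by auto
    moreover have "cl_Inf Y \<S> \<in> clusters Y" using Y \<S>(1) by (intro cl_Inf_closed) auto
    ultimately show ?thesis
      using \<S> by (simp add: fibre_inf[OF X] fibre_inf[OF Y] \<phi> app_pull_enc[OF Y] cl_pull_Inf[OF f])
  qed
  fix \<psi> :: "'u amap" and Z u assume "\<psi> \<in> hom App Y Z" and u: "u \<in> carrier (fibre Z)"
  then obtain g where \<psi>: "\<psi> = (Y, g, Z)" and Z: "Z \<in> Ob App" and g: "contraction Y Z g"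
    by (auto simp: App_hom_iff App_Ar_iff)
  obtain \<kappa> where \<kappa>: "\<kappa> \<in> clusters Z" "u = enc Z \<kappa>" using u by (auto simp: fibre_carrier)
  have "cl_pull X (compose (pts X) g f) \<kappa> = cl_pull X f (cl_pull Y g \<kappa>)"
    by (rule cl_pull_comp[OF f]) (simp add: compose_def)
  then show "app_pull (\<psi> \<cdot>\<^bsub>App\<^esub> \<phi>) u = app_pull \<phi> (app_pull \<psi> u)"
    using \<kappa> cl_pull_closed[OF g \<kappa>(1)]
    by (simp add: \<phi> \<psi> app_pull_enc[OF Z] app_pull_enc[OF Y])
next
  fix X :: "'u aspace" and u assume X: "X \<in> Ob App" and u: "u \<in> carrier (fibre X)"
  obtain \<kappa> where \<kappa>: "\<kappa> \<in> clusters X" "u = enc X \<kappa>" using u by (auto simp: fibre_carrier)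
  then show "app_pull (Id App X) u = u"
    using X cl_pull_id[OF \<kappa>(1), of "restrict id (pts X)"] by (simp add: app_pull_enc[OF X])
qed

sublocale app: inverse_image_form App "fibre :: 'u aspace \<Rightarrow> 'u gorder" app_pull
  by (rule inverse_image_form_App)

section \<open>Kernels and images in the form\<close>

lemma fibre_bot:
  assumes X: "X \<in> Ob (App :: ('u aspace, 'u amap) cat)"
  shows "\<bottom>\<^bsub>fibre X\<^esub> = enc X (cl_sub X {})"
proof -
  interpret complete_lattice "fibre X" by (rule fibre_complete_lattice[OF X])
  have c: "cl_sub X {} \<in> clusters X" using X by (intro cl_sub_closed) simp
  obtain \<kappa> where \<kappa>: "\<kappa> \<in> clusters X" "\<bottom>\<^bsub>fibre X\<^esub> = enc X \<kappa>"
    using bottom_closed by (auto simp: fibre_carrier)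
  have "enc X (cl_sub X {}) \<sqsubseteq>\<^bsub>fibre X\<^esub> \<bottom>\<^bsub>fibre X\<^esub>"
    using fibre_le_iff[OF X c \<kappa>(1)] cl_sub_bot[OF \<kappa>(1)] X \<kappa>(2) by simp
  then show ?thesis using c by (intro le_antisym bottom_lower) auto
qed

lemma fibre_top:
  assumes X: "X \<in> Ob (App :: ('u aspace, 'u amap) cat)"
  shows "\<top>\<^bsub>fibre X\<^esub> = enc X (cl_sub X (pts X))"
proof -
  interpret complete_lattice "fibre X" by (rule fibre_complete_lattice[OF X])
  have c: "cl_sub X (pts X) \<in> clusters X" using X by (intro cl_sub_closed) simp
  obtain \<kappa> where \<kappa>: "\<kappa> \<in> clusters X" "\<top>\<^bsub>fibre X\<^esub> = enc X \<kappa>"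
    using top_closed by (auto simp: fibre_carrier)
  have "\<top>\<^bsub>fibre X\<^esub> \<sqsubseteq>\<^bsub>fibre X\<^esub> enc X (cl_sub X (pts X))"
    using fibre_le_iff[OF X \<kappa>(1) c] cl_sub_top[OF \<kappa>(1)] X \<kappa>(2) by simp
  then show ?thesis using c by (intro le_antisym top_higher) auto
qed

lemma Ker_eq:
  assumes f: "(X, f, Y) \<in> Ar (App :: ('u aspace, 'u amap) cat)"
  shows "app.Ker (X, f, Y) = enc X (cl_ker X f Y)"
proof -
  have Y: "Y \<in> Ob App" using f by (simp add: App_Ar_iff)
  then have "cl_sub Y {} \<in> clusters Y" by (intro cl_sub_closed) simp
  then show ?thesis
    using Y by (simp only: app.Ker_def app.the_form_simps App_simps(3) fibre_bot app_pull_enc cl_ker_def)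
qed

lemma cl_ker_closed: "(X, f, Y) \<in> Ar App \<Longrightarrow> cl_ker X f Y \<in> clusters X"
  by (auto simp: cl_ker_def App_Ar_iff intro: cl_pull_closed cl_sub_closed)

text \<open>Both sides have the same upper bounds: adjunction reduces those of the image to
  \<open>cl_sub_image_iff\<close>.\<close>

lemma Im_eq:
  assumes f: "(X, f, Y) \<in> Ar (App :: ('u aspace, 'u amap) cat)"
  shows "app.Im (X, f, Y) = enc Y (cl_sub Y (f ` pts X))"
proof -
  have X: "X \<in> Ob App" and Y: "Y \<in> Ob App" and fc: "contraction X Y f"
    using f by (simp_all add: App_Ar_iff)
  have h: "(X, f, Y) \<in> hom App X Y" using f by simp
  interpret complete_lattice "fibre Y" by (rule fibre_complete_lattice[OF Y])
  have t: "cl_sub X (pts X) \<in> clusters X" and c: "cl_sub Y (f ` pts X) \<in> clusters Y"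
    using X Y by (simp_all add: cl_sub_closed)
  have I: "app.Im (X, f, Y) = app.push (X, f, Y) (enc X (cl_sub X (pts X)))"
    using fibre_top[OF X] by (simp only: app.Im_def app.the_form_simps App_simps(2))
  have iff: "app.Im (X, f, Y) \<sqsubseteq>\<^bsub>fibre Y\<^esub> enc Y \<kappa> \<longleftrightarrow> enc Y (cl_sub Y (f ` pts X)) \<sqsubseteq>\<^bsub>fibre Y\<^esub> enc Y \<kappa>"
    if \<kappa>: "\<kappa> \<in> clusters Y" for \<kappa>
    using app.push_pull_adjoint[OF h, of "enc X (cl_sub X (pts X))" "enc Y \<kappa>"] t \<kappa>
      cl_sub_image_iff[OF fc _ _ \<kappa>] X Y fibre_le_iff[OF X t cl_pull_closed[OF fc \<kappa>]]
      fibre_le_iff[OF Y c \<kappa>]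
    by (simp add: I app_pull_enc)
  have Ic: "app.Im (X, f, Y) \<in> carrier (fibre Y)" unfolding I by (rule app.push_carrier[OF h])
  then obtain \<kappa> where \<kappa>: "\<kappa> \<in> clusters Y" "app.Im (X, f, Y) = enc Y \<kappa>" by (auto simp: fibre_carrier)
  have "app.Im (X, f, Y) \<sqsubseteq>\<^bsub>fibre Y\<^esub> enc Y (cl_sub Y (f ` pts X))" using iff[OF c] c by simp
  moreover have "enc Y (cl_sub Y (f ` pts X)) \<sqsubseteq>\<^bsub>fibre Y\<^esub> app.Im (X, f, Y)"
    using iff[OF \<kappa>(1)] \<kappa> Ic by simp
  ultimately show ?thesis using Ic c by (intro le_antisym) auto
qed

text \<open>Kernels are compared on the whole space alone. The resulting condition is the one under
  which \<open>g\<close> descends along \<open>f\<close> when \<open>f\<close> is onto.\<close>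

lemma Ker_le_iff:
  assumes f: "(X, f, Y) \<in> Ar (App :: ('u aspace, 'u amap) cat)" and g: "(X, g, Z) \<in> Ar App"
  shows "app.Ker (X, f, Y) \<sqsubseteq>\<^bsub>fibre X\<^esub> app.Ker (X, g, Z) \<longleftrightarrow>
    (\<forall>x \<in> pts X. \<forall>y \<in> pts X. f x = f y \<longrightarrow> g x = g y) \<and>
    (\<forall>x \<in> pts X. \<forall>S \<subseteq> pts X. dist Z (g x, g ` S) \<le> dist Y (f x, f ` S))"
proof -
  have c: "contraction X Y f" "contraction X Z g" and X: "X \<in> Ob App" and Y: "approach_space Y"
    using f g by (auto simp: App_Ar_iff)
  have "app.Ker (X, f, Y) \<sqsubseteq>\<^bsub>fibre X\<^esub> app.Ker (X, g, Z) \<longleftrightarrow> cl_le (cl_ker X f Y) (cl_ker X g Z)"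
    unfolding Ker_eq[OF f] Ker_eq[OF g] using X cl_ker_closed f g by (intro fibre_le_iff)
  also have "\<dots> \<longleftrightarrow> str_le (cl_ker X f Y (pts X)) (cl_ker X g Z (pts X))"
    by (rule cl_ker_le_iff[OF c(1) Y cl_ker_closed[OF g]])
  also have "\<dots> \<longleftrightarrow> (\<forall>x \<in> pts X. \<forall>y \<in> pts X. f x = f y \<longrightarrow> g x = g y) \<and>
    (\<forall>x \<in> pts X. \<forall>S \<subseteq> pts X. dist Z (g x, g ` S) \<le> dist Y (f x, f ` S))"
    by (auto simp: str_le_def cl_ker_eq[OF c(1)] cl_ker_eq[OF c(2)])
  finally show ?thesis .
qed

lemma Im_le_iff:
  assumes f: "(Y, f, X) \<in> Ar (App :: ('u aspace, 'u amap) cat)" and g: "(Z, g, X) \<in> Ar App"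
  shows "app.Im (Y, f, X) \<sqsubseteq>\<^bsub>fibre X\<^esub> app.Im (Z, g, X) \<longleftrightarrow> f ` pts Y \<subseteq> g ` pts Z"
proof -
  have X: "X \<in> Ob App" and Xa: "approach_space X" and im: "f ` pts Y \<subseteq> pts X"
    using f contraction_image[of Y X f "pts Y"] by (auto simp: App_Ar_iff)
  show ?thesis
    unfolding Im_eq[OF f] Im_eq[OF g] fibre_le_iff[OF X cl_sub_closed[OF Xa] cl_sub_closed[OF Xa]]
    by (rule cl_sub_le_iff[OF Xa im])
qed

lemma Im_eq_if:
  "(Y, f, X) \<in> Ar App \<Longrightarrow> (Z, g, X) \<in> Ar App \<Longrightarrow> f ` pts Y = g ` pts Z \<Longrightarrow>
    app.Im (Y, f, X) = app.Im (Z, g, X)"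
  by (simp add: Im_eq)

section \<open>Quotients and embeddings\<close>

lemma surjection_is_quotient:
  assumes p: "(X, p, Q) \<in> surjective_contractions"
  shows "app.is_quotient X (app.Ker (X, p, Q)) (X, p, Q)"
proof -
  have pA: "(X, p, Q) \<in> Ar App" "p ` pts X = pts Q" using p by (simp_all add: surjective_contractions_iff)
  have "\<exists>!\<eta>. \<eta> \<in> hom App Q (Cod App \<gamma>) \<and> \<gamma> = \<eta> \<cdot>\<^bsub>App\<^esub> (X, p, Q)"
    if \<gamma>: "\<gamma> \<in> Ar App" "Dom App \<gamma> = X" "app.Ker (X, p, Q) \<sqsubseteq>\<^bsub>fibre X\<^esub> app.Ker \<gamma>" for \<gamma> :: "'u amap"
  proof -
    obtain g Z where g: "\<gamma> = (X, g, Z)" "(X, g, Z) \<in> Ar App" using \<gamma>(1,2) by (cases \<gamma>) auto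
    have le: "(\<forall>x \<in> pts X. \<forall>y \<in> pts X. p x = p y \<longrightarrow> g x = g y) \<and>
        (\<forall>x \<in> pts X. \<forall>S \<subseteq> pts X. dist Z (g x, g ` S) \<le> dist Q (p x, p ` S))"
      using \<gamma>(3) unfolding g(1) Ker_le_iff[OF pA(1) g(2)] .
    have "\<exists>h. (Q, h, Z) \<in> Ar App \<and> (\<forall>x \<in> pts X. h (p x) = g x)"
      by (rule descend_along_surjection[OF p g(2) conjunct1[OF le, rule_format]
            conjunct2[OF le, rule_format]])
    then obtain h where h: "(Q, h, Z) \<in> Ar App" "\<And>x. x \<in> pts X \<Longrightarrow> h (p x) = g x"
      by blast
    show ?thesis
    proof (rule ex1I[of _ "(Q, h, Z)"])
      show "(Q, h, Z) \<in> hom App Q (Cod App \<gamma>) \<and> \<gamma> = (Q, h, Z) \<cdot>\<^bsub>App\<^esub> (X, p, Q)"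
        using h App_comp_eq_iff[OF pA(1) h(1) g(2)] unfolding g(1) by simp
    next
      fix \<eta> assume \<eta>: "\<eta> \<in> hom App Q (Cod App \<gamma>) \<and> \<gamma> = \<eta> \<cdot>\<^bsub>App\<^esub> (X, p, Q)"
      then obtain k where k: "\<eta> = (Q, k, Z)" "(Q, k, Z) \<in> Ar App" by (auto simp: App_hom_iff g(1))
      have "k (p x) = g x" if "x \<in> pts X" for x
        using \<eta> that App_comp_eq_iff[OF pA(1) k(2) g(2)] unfolding g(1) k(1) by metis
      then have "k q = h q" if "q \<in> pts Q" for q using that h(2) pA(2) by force
      then show "\<eta> = (Q, h, Z)" unfolding k(1) by (intro App_eqI k(2) h(1))
    qed
  qed
  moreover have "app.normal X (app.Ker (X, p, Q))"
    unfolding app.normal_def using pA(1) by (intro bexI[of _ "(X, p, Q)"]) auto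
  ultimately show ?thesis using pA(1) by (simp add: app.is_quotient_def)
qed

lemma initial_is_embedding:
  assumes m: "(A, m, X) \<in> initial_embeddings"
  shows "app.is_embedding X (app.Im (A, m, X)) (A, m, X)"
proof -
  have mA: "(A, m, X) \<in> Ar App" "inj_on m (pts A)" using m by (simp_all add: initial_embeddings_iff)
  have "\<exists>!\<eta>. \<eta> \<in> hom App (Dom App \<gamma>) A \<and> \<gamma> = (A, m, X) \<cdot>\<^bsub>App\<^esub> \<eta>"
    if \<gamma>: "\<gamma> \<in> Ar App" "Cod App \<gamma> = X" "app.Im \<gamma> \<sqsubseteq>\<^bsub>fibre X\<^esub> app.Im (A, m, X)" for \<gamma> :: "'u amap"
  proof -
    obtain g Z where g: "\<gamma> = (Z, g, X)" "(Z, g, X) \<in> Ar App" using \<gamma>(1,2) by (cases \<gamma>) auto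
    then obtain h where h: "(Z, h, A) \<in> Ar App" "\<And>z. z \<in> pts Z \<Longrightarrow> m (h z) = g z"
      using lift_through_embedding[OF m g(2)] \<gamma>(3) Im_le_iff[OF g(2) mA(1)] by blast
    show ?thesis
    proof (rule ex1I[of _ "(Z, h, A)"])
      show "(Z, h, A) \<in> hom App (Dom App \<gamma>) A \<and> \<gamma> = (A, m, X) \<cdot>\<^bsub>App\<^esub> (Z, h, A)"
        using h App_comp_eq_iff[OF h(1) mA(1) g(2)] unfolding g(1) by simp
    next
      fix \<eta> assume \<eta>: "\<eta> \<in> hom App (Dom App \<gamma>) A \<and> \<gamma> = (A, m, X) \<cdot>\<^bsub>App\<^esub> \<eta>"
      then obtain k where k: "\<eta> = (Z, k, A)" "(Z, k, A) \<in> Ar App" by (auto simp: App_hom_iff g(1))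
      have c: "contraction Z A k" "contraction Z A h" using k(2) h(1) by (simp_all add: App_Ar_iff)
      have "m (k z) = g z" if "z \<in> pts Z" for z
        using \<eta> that App_comp_eq_iff[OF k(2) mA(1) g(2)] unfolding g(1) k(1) by metis
      then have "k z = h z" if "z \<in> pts Z" for z
        using that h(2) inj_onD[OF mA(2)] contraction_in[OF c(1)] contraction_in[OF c(2)] by metis
      then show "\<eta> = (Z, h, A)" unfolding k(1) by (intro App_eqI k(2) h(1))
    qed
  qed
  moreover have "app.conormal X (app.Im (A, m, X))"
    unfolding app.conormal_def using mA(1) by (intro bexI[of _ "(A, m, X)"]) auto
  ultimately show ?thesis using mA(1) by (simp add: app.is_embedding_def)
qed

text \<open>A kernel sees the codomain only through distances inside the image, and these are
  unchanged in the subspace.\<close>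

lemma Ker_factor:
  assumes f: "(X, f, Y) \<in> Ar (App :: ('u aspace, 'u amap) cat)"
  shows "app.Ker (X, f, subspace Y (f ` pts X)) = app.Ker (X, f, Y)"
proof -
  have e: "(X, f, subspace Y (f ` pts X)) \<in> Ar App"
    using image_factorization(1)[OF f] by (simp add: surjective_contractions_iff)
  have X: "X \<in> Ob App" using f by (simp add: App_Ar_iff)
  interpret complete_lattice "fibre X" by (rule fibre_complete_lattice[OF X])
  show ?thesis
  proof (rule le_antisym)
    show "app.Ker (X, f, subspace Y (f ` pts X)) \<sqsubseteq>\<^bsub>fibre X\<^esub> app.Ker (X, f, Y)"
      unfolding Ker_le_iff[OF e f] by (simp add: image_mono)
    show "app.Ker (X, f, Y) \<sqsubseteq>\<^bsub>fibre X\<^esub> app.Ker (X, f, subspace Y (f ` pts X))"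
      unfolding Ker_le_iff[OF f e] by (simp add: image_mono)
  qed (simp_all add: Ker_eq[OF f] Ker_eq[OF e] cl_ker_closed[OF f] cl_ker_closed[OF e])
qed

lemma Im_factor:
  assumes f: "(X, f, Y) \<in> Ar (App :: ('u aspace, 'u amap) cat)"
  shows "app.Im (subspace Y (f ` pts X), restrict id (f ` pts X), Y) = app.Im (X, f, Y)"
  using image_factorization(2)[OF f] f by (intro Im_eq_if) (simp_all add: initial_embeddings_iff)

section \<open>Joins of normal and meets of conormal clusters\<close>

text \<open>The join is formed on the whole space as the least coarser structure above both kernels,
  and realized as a kernel once its distance to the empty set is known to be infinite. It is the
  join among all clusters because a kernel is compared with a cluster at \<open>pts X\<close>
  alone.\<close>

lemma normal_join:
  assumes K: "app.normal X K" and L: "app.normal X L"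
  shows "app.normal X (K \<squnion>\<^bsub>fibre X\<^esub> L)"
proof -
  obtain f Y where f: "(X, f, Y) \<in> Ar App" "app.Ker (X, f, Y) = K"
    using K unfolding app.normal_def by auto
  obtain g Z where g: "(X, g, Z) \<in> Ar App" "app.Ker (X, g, Z) = L"
    using L unfolding app.normal_def by auto
  have fc: "contraction X Y f" and gc: "contraction X Z g" and X: "X \<in> Ob App"
    and Y: "approach_space Y" and Z: "approach_space Z" and Xa: "approach_space X"
    using f g by (auto simp: App_Ar_iff)
  interpret complete_lattice "fibre X" by (rule fibre_complete_lattice[OF X])
  let ?\<kappa> = "cl_ker X f Y" and ?\<mu> = "cl_ker X g Z"
  have kc: "?\<kappa> \<in> clusters X" "?\<mu> \<in> clusters X" using cl_ker_closed f g by auto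
  have ks: "?\<kappa> (pts X) \<in> strs (pts X)" "?\<mu> (pts X) \<in> strs (pts X)" using kc cl_strs by blast+
  let ?\<U> = "{M \<in> coarse X (pts X). str_le (?\<kappa> (pts X)) M \<and> str_le (?\<mu> (pts X)) M}"
  define J where "J = str_Inf (pts X) ?\<U>"
  have \<U>: "?\<U> \<subseteq> coarse X (pts X)" "?\<U> \<subseteq> strs (pts X)" by (auto simp: coarse_def)
  have J: "J \<in> coarse X (pts X)" unfolding J_def by (rule str_Inf_coarse[OF \<U>(1) _ Xa]) simp
  \<comment> \<open>This is the kernel of the map to a one-point space: all points are identified
    and only the empty set is far away. Being above both kernels, it forces the meet
    \<open>J\<close> of all upper bounds to be infinite at the empty set.\<close>
  let ?I = "(pts X \<times> pts X, \<lambda>x S. if x \<in> pts X \<and> S = {} then \<infinity> else 0) :: 'u str"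
  have "?I \<in> strs (pts X)"
    by (rule strsI) (auto simp: equiv_def refl_on_def sym_def trans_def)
  then have "?I \<in> coarse X (pts X)" using aspace_empty[OF Xa] by (auto simp: coarse_def)
  moreover have "str_le M ?I" if "M \<in> strs (pts X)" "\<And>x. x \<in> pts X \<Longrightarrow> snd M x {} = \<infinity>" for M
    using strs_rel_subset[OF that(1)] that(2) by (auto simp: str_le_def)
  moreover have "snd (?\<kappa> (pts X)) x {} = \<infinity>" "snd (?\<mu> (pts X)) x {} = \<infinity>" if "x \<in> pts X" for x
    using that aspace_empty[OF Y contraction_in[OF fc that]] aspace_empty[OF Z contraction_in[OF gc that]]
    by (simp_all add: cl_ker_eq[OF fc] cl_ker_eq[OF gc])
  ultimately have "str_le J ?I" unfolding J_def using ks by (intro str_Inf_lower[OF \<U>(2)]) simp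
  then have "snd J x {} = \<infinity>" if "x \<in> pts X" for x
    using that by (auto simp: str_le_def top.extremum_unique dest!: spec[of _ x] spec[of _ "{}"])
  then obtain Q h where h: "approach_space Q" "pts Q \<subseteq> pts X" "h \<in> extensional (pts X)"
    "contraction X Q h" "cl_ker X h Q (pts X) = J"
    using kernel_exists[OF J] by blast
  have hA: "(X, h, Q) \<in> Ar App" using h X small_subset by (auto simp: App_Ar_iff)
  have hk: "cl_ker X h Q \<in> clusters X" by (rule cl_ker_closed[OF hA])
  have le_J: "str_le M J" if M: "M \<in> strs (pts X)" "\<And>N. N \<in> ?\<U> \<Longrightarrow> str_le M N" for M
    unfolding J_def using strs_rel_subset[OF M(1)] strs_Un[OF M(1)] M(2)
    by (intro str_Inf_greatest) auto
  have upper: "cl_le ?\<kappa> (cl_ker X h Q)" "cl_le ?\<mu> (cl_ker X h Q)"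
    unfolding cl_ker_le_iff[OF fc Y hk] cl_ker_le_iff[OF gc Z hk] h(5)
    by (rule le_J[OF ks(1)], simp, rule le_J[OF ks(2)], simp)
  have least: "cl_le (cl_ker X h Q) \<nu>" if \<nu>: "\<nu> \<in> clusters X" "cl_le ?\<kappa> \<nu>" "cl_le ?\<mu> \<nu>" for \<nu>
    unfolding cl_ker_le_iff[OF h(4,1) \<nu>(1)] h(5) J_def
    using cl_coarse[OF \<nu>(1)] cl_leD[OF \<nu>(2)] cl_leD[OF \<nu>(3)]
    by (intro str_Inf_lower[OF \<U>(2)]) simp
  have KL: "K = enc X ?\<kappa>" "L = enc X ?\<mu>" using f g by (simp_all add: Ker_eq)
  have "enc X ?\<kappa> \<squnion>\<^bsub>fibre X\<^esub> enc X ?\<mu> = enc X (cl_ker X h Q)"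
  proof (rule le_antisym)
    show "enc X ?\<kappa> \<squnion>\<^bsub>fibre X\<^esub> enc X ?\<mu> \<sqsubseteq>\<^bsub>fibre X\<^esub> enc X (cl_ker X h Q)"
      using upper kc hk X by (intro join_le) (simp_all only: fibre_le_iff enc_carrier)
    have "enc X ?\<kappa> \<squnion>\<^bsub>fibre X\<^esub> enc X ?\<mu> \<in> carrier (fibre X)" using kc by simp
    then obtain \<nu> where \<nu>: "\<nu> \<in> clusters X" "enc X ?\<kappa> \<squnion>\<^bsub>fibre X\<^esub> enc X ?\<mu> = enc X \<nu>"
      by (auto simp: fibre_carrier)
    have "cl_le ?\<kappa> \<nu>" "cl_le ?\<mu> \<nu>"
      using join_left[of "enc X ?\<kappa>" "enc X ?\<mu>"] join_right[of "enc X ?\<kappa>" "enc X ?\<mu>"] kc \<nu>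
        fibre_le_iff[OF X kc(1) \<nu>(1)] fibre_le_iff[OF X kc(2) \<nu>(1)] by simp_all
    then show "enc X (cl_ker X h Q) \<sqsubseteq>\<^bsub>fibre X\<^esub> enc X ?\<kappa> \<squnion>\<^bsub>fibre X\<^esub> enc X ?\<mu>"
      unfolding \<nu>(2) fibre_le_iff[OF X hk \<nu>(1)] by (rule least[OF \<nu>(1)])
  qed (use kc hk in simp_all)
  then show ?thesis
    unfolding app.normal_def KL using hA Ker_eq[OF hA] by (intro bexI[of _ "(X, h, Q)"]) simp_all
qed

text \<open>On a subset outside the intersection one of the two clusters already takes the least
  value, so any common lower bound is least there.\<close>

lemma conormal_meet:
  assumes S: "app.conormal X S" and T: "app.conormal X T"
  shows "app.conormal X (S \<sqinter>\<^bsub>fibre X\<^esub> T)"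
proof -
  obtain f Y where f: "(Y, f, X) \<in> Ar App" "app.Im (Y, f, X) = S"
    using S unfolding app.conormal_def by auto
  obtain g Z where g: "(Z, g, X) \<in> Ar App" "app.Im (Z, g, X) = T"
    using T unfolding app.conormal_def by auto
  have X: "X \<in> Ob App" and Xa: "approach_space X" and im: "f ` pts Y \<subseteq> pts X"
    using f contraction_image[of Y X f "pts Y"] by (auto simp: App_Ar_iff)
  interpret complete_lattice "fibre X" by (rule fibre_complete_lattice[OF X])
  let ?A = "f ` pts Y" and ?B = "g ` pts Z"
  have AB: "?A \<inter> ?B \<subseteq> pts X" using im by auto
  note c = cl_sub_closed[OF Xa]
  have ST: "S = enc X (cl_sub X ?A)" "T = enc X (cl_sub X ?B)" using f g by (simp_all add: Im_eq)
  have "enc X (cl_sub X ?A) \<sqinter>\<^bsub>fibre X\<^esub> enc X (cl_sub X ?B) = enc X (cl_sub X (?A \<inter> ?B))"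
  proof (rule le_antisym)
    show "enc X (cl_sub X (?A \<inter> ?B)) \<sqsubseteq>\<^bsub>fibre X\<^esub> enc X (cl_sub X ?A) \<sqinter>\<^bsub>fibre X\<^esub> enc X (cl_sub X ?B)"
      using cl_sub_le_iff[OF Xa AB] c by (intro meet_le) (simp_all only: fibre_le_iff[OF X] enc_carrier, auto)
    have "enc X (cl_sub X ?A) \<sqinter>\<^bsub>fibre X\<^esub> enc X (cl_sub X ?B) \<in> carrier (fibre X)" using c by simp
    then obtain \<nu> where \<nu>: "\<nu> \<in> clusters X"
      "enc X (cl_sub X ?A) \<sqinter>\<^bsub>fibre X\<^esub> enc X (cl_sub X ?B) = enc X \<nu>"
      by (auto simp: fibre_carrier)
    have le: "cl_le \<nu> (cl_sub X ?A)" "cl_le \<nu> (cl_sub X ?B)"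
      using meet_left[of "enc X (cl_sub X ?A)" "enc X (cl_sub X ?B)"]
        meet_right[of "enc X (cl_sub X ?A)" "enc X (cl_sub X ?B)"] c \<nu>
        fibre_le_iff[OF X \<nu>(1) c] by simp_all
    have "cl_le \<nu> (cl_sub X (?A \<inter> ?B))"
    proof (rule cl_leI[OF \<nu>(1) c])
      show "str_le (\<nu> D) (cl_sub X (?A \<inter> ?B) D)" if "D \<subseteq> pts X" for D
        using that cl_leD[OF le(1), of D] cl_leD[OF le(2), of D]
        by (cases "D \<subseteq> ?A"; cases "D \<subseteq> ?B") (simp_all add: cl_sub_in cl_sub_out)
    qed
    then show "enc X (cl_sub X ?A) \<sqinter>\<^bsub>fibre X\<^esub> enc X (cl_sub X ?B) \<sqsubseteq>\<^bsub>fibre X\<^esub> enc X (cl_sub X (?A \<inter> ?B))"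
      unfolding \<nu>(2) fibre_le_iff[OF X \<nu>(1) c] .
  qed (use c in simp_all)
  moreover have m: "(subspace X (?A \<inter> ?B), restrict id (?A \<inter> ?B), X) \<in> Ar App"
    using subspace_embedding[OF X AB] by (simp add: initial_embeddings_iff)
  moreover have "app.Im (subspace X (?A \<inter> ?B), restrict id (?A \<inter> ?B), X) = enc X (cl_sub X (?A \<inter> ?B))"
    using Im_eq[OF m] by simp
  ultimately show ?thesis
    unfolding app.conormal_def ST
    by (intro bexI[of _ "(subspace X (?A \<inter> ?B), restrict id (?A \<inter> ?B), X)"]) simp_all
qed

section \<open>The axioms and the induced classes\<close>

lemma noetherian_App: "noetherian_form App app.the_form"
proof (intro noetherian_form.intro noetherian_form_axioms.intro app.orean; (unfold app.the_form_simps)?)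
  fix \<phi> :: "'u amap" and X Y u assume \<phi>: "\<phi> \<in> hom App X Y" and u: "u \<in> carrier (fibre X)"
  obtain f where f: "\<phi> = (X, f, Y)" "(X, f, Y) \<in> Ar App" using \<phi> by (auto simp: App_hom_iff)
  have X: "X \<in> Ob App" and Y: "Y \<in> Ob App" and fc: "contraction X Y f"
    using f(2) by (simp_all add: App_Ar_iff)
  show "app_pull \<phi> (app.push \<phi> u) = u \<squnion>\<^bsub>fibre X\<^esub> app.Ker \<phi>"
  proof (rule app.pull_push_if_exact[OF \<phi> u])
    fix v assume v: "v \<in> carrier (fibre X)" "app.Ker \<phi> \<sqsubseteq>\<^bsub>fibre X\<^esub> v"
    obtain \<kappa> where \<kappa>: "\<kappa> \<in> clusters X" "v = enc X \<kappa>" using v(1) by (auto simp: fibre_carrier)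
    have "cl_le (cl_ker X f Y) \<kappa>"
      using v(2) fibre_le_iff[OF X cl_ker_closed[OF f(2)] \<kappa>(1)] unfolding f(1) Ker_eq[OF f(2)] \<kappa>(2) by simp
    then obtain \<mu> where "\<mu> \<in> clusters Y" "\<kappa> = cl_pull X f \<mu>"
      using cl_pull_exact[OF fc _ _ \<kappa>(1)] X Y by (auto simp: cl_ker_def)
    then show "\<exists>T \<in> carrier (fibre Y). v = app_pull \<phi> T"
      using Y by (intro bexI[of _ "enc Y \<mu>"]) (simp_all only: \<kappa>(2) f(1) app_pull_enc enc_carrier)
  qed
next
  fix \<phi> :: "'u amap" and X Y u assume \<phi>: "\<phi> \<in> hom App X Y" and u: "u \<in> carrier (fibre Y)"
  obtain f where f: "\<phi> = (X, f, Y)" "(X, f, Y) \<in> Ar App" using \<phi> by (auto simp: App_hom_iff)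
  have X: "X \<in> Ob App" and Y: "Y \<in> Ob App" and fc: "contraction X Y f"
    using f(2) by (simp_all add: App_Ar_iff)
  show "app.push \<phi> (app_pull \<phi> u) = u \<sqinter>\<^bsub>fibre Y\<^esub> app.Im \<phi>"
  proof (rule app.push_pull_if_reflecting[OF \<phi> u])
    fix v w assume v: "v \<in> carrier (fibre Y)" and w: "w \<in> carrier (fibre Y)"
      and le: "v \<sqsubseteq>\<^bsub>fibre Y\<^esub> app.Im \<phi>" "app_pull \<phi> v \<sqsubseteq>\<^bsub>fibre X\<^esub> app_pull \<phi> w"
    obtain \<kappa> \<mu> where \<kappa>: "\<kappa> \<in> clusters Y" "v = enc Y \<kappa>" and \<mu>: "\<mu> \<in> clusters Y" "w = enc Y \<mu>"
      using v w by (auto simp: fibre_carrier)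
    have c: "cl_sub Y (f ` pts X) \<in> clusters Y" using Y by (simp add: cl_sub_closed)
    have "cl_le \<kappa> (cl_sub Y (f ` pts X))"
      using le(1) unfolding f(1) Im_eq[OF f(2)] \<kappa>(2) fibre_le_iff[OF Y \<kappa>(1) c] .
    moreover have "cl_le (cl_pull X f \<kappa>) (cl_pull X f \<mu>)"
      using le(2) fibre_le_iff[OF X cl_pull_closed[OF fc \<kappa>(1)] cl_pull_closed[OF fc \<mu>(1)]]
      unfolding f(1) \<kappa>(2) \<mu>(2) app_pull_enc[OF Y \<kappa>(1)] app_pull_enc[OF Y \<mu>(1)] by simp
    ultimately have "cl_le \<kappa> \<mu>" by (intro cl_pull_reflect[OF fc \<kappa>(1) \<mu>(1)])
    then show "v \<sqsubseteq>\<^bsub>fibre Y\<^esub> w" unfolding \<kappa>(2) \<mu>(2) fibre_le_iff[OF Y \<kappa>(1) \<mu>(1)] .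
  qed
next
  fix \<phi> :: "'u amap" and X Y assume "\<phi> \<in> hom App X Y"
  then obtain f where f: "\<phi> = (X, f, Y)" "(X, f, Y) \<in> Ar App" by (auto simp: App_hom_iff)
  let ?I = "subspace Y (f ` pts X)"
  let ?e = "(X, f, ?I)" and ?m = "(?I, restrict id (f ` pts X), Y)"
  have "app.is_quotient X (app.Ker \<phi>) ?e"
    using surjection_is_quotient[OF image_factorization(1)[OF f(2)]] unfolding Ker_factor[OF f(2)] f(1) .
  moreover have "app.is_embedding Y (app.Im \<phi>) ?m"
    using initial_is_embedding[OF image_factorization(2)[OF f(2)]] unfolding Im_factor[OF f(2)] f(1) .
  moreover have "\<phi> = ?m \<cdot>\<^bsub>App\<^esub> ?e" unfolding f(1) by (rule image_factorization(3)[OF f(2)])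
  ultimately show "\<exists>e m. app.is_quotient X (app.Ker \<phi>) e \<and> app.is_embedding Y (app.Im \<phi>) m \<and>
      Cod App e = Dom App m \<and> \<phi> = m \<cdot>\<^bsub>App\<^esub> e"
    by (intro exI[of _ ?e] exI[of _ ?m] conjI) simp_all
qed (blast intro: normal_join conormal_meet)+

text \<open>To see that a quotient \<open>p\<close> is onto, note that its corestriction to the
  image has the same kernel and so factors through \<open>p\<close>. Uniqueness in the universal
  property then makes the inclusion of the image a split epimorphism.\<close>

lemma quotients_eq: "app.quotients = surjective_contractions"
proof (intro equalityI subsetI)
  fix \<pi> assume "\<pi> \<in> app.quotients"
  then obtain X K where q: "app.is_quotient X K \<pi>" by (auto simp: app.quotients_def)
  then obtain p Q where p: "\<pi> = (X, p, Q)" "(X, p, Q) \<in> Ar App" "app.Ker (X, p, Q) = K"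
    by (cases \<pi>) (auto simp: app.is_quotient_def)
  let ?I = "subspace Q (p ` pts X)"
  let ?e = "(X, p, ?I)" and ?m = "(?I, restrict id (p ` pts X), Q)"
  have X: "X \<in> Ob App" and Q: "Q \<in> Ob App" and pc: "contraction X Q p"
    using p(2) by (simp_all add: App_Ar_iff)
  interpret complete_lattice "fibre X" by (rule fibre_complete_lattice[OF X])
  have K: "K \<in> carrier (fibre X)" using Ker_eq[OF p(2)] cl_ker_closed[OF p(2)] p(3) by auto
  have uni: "\<exists>!\<eta>. \<eta> \<in> hom App Q (Cod App \<gamma>) \<and> \<gamma> = \<eta> \<cdot>\<^bsub>App\<^esub> (X, p, Q)"
    if "\<gamma> \<in> Ar App" "Dom App \<gamma> = X" "K \<sqsubseteq>\<^bsub>fibre X\<^esub> app.Ker \<gamma>" for \<gamma>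
    using q that unfolding p(1) by (auto simp: app.is_quotient_def)
  have e: "?e \<in> Ar App" using image_factorization(1)[OF p(2)] by (simp add: surjective_contractions_iff)
  have m: "?m \<in> Ar App" using image_factorization(2)[OF p(2)] by (simp add: initial_embeddings_iff)
  have "K \<sqsubseteq>\<^bsub>fibre X\<^esub> app.Ker ?e" using K unfolding Ker_factor[OF p(2)] p(3) by simp
  then obtain \<eta> where \<eta>: "\<eta> \<in> hom App Q ?I" "?e = \<eta> \<cdot>\<^bsub>App\<^esub> (X, p, Q)"
    using uni[OF e] by auto
  have "?m \<cdot>\<^bsub>App\<^esub> \<eta> = Id App Q"
  proof (rule ex1E[OF uni[OF p(2)]])
    fix \<theta> assume *: "\<forall>\<eta>. \<eta> \<in> hom App Q (Cod App (X, p, Q)) \<and> (X, p, Q) = \<eta> \<cdot>\<^bsub>App\<^esub> (X, p, Q) \<longrightarrow> \<eta> = \<theta>"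
    have mh: "?m \<in> hom App ?I Q" and ph: "(X, p, Q) \<in> hom App X Q" using m p(2) by auto
    have "(X, p, Q) = (?m \<cdot>\<^bsub>App\<^esub> \<eta>) \<cdot>\<^bsub>App\<^esub> (X, p, Q)"
      using image_factorization(3)[OF p(2)] app.comp_assoc[OF ph \<eta>(1) mh] \<eta>(2) by simp
    moreover have "?m \<cdot>\<^bsub>App\<^esub> \<eta> \<in> hom App Q Q" by (rule app.comp_hom[OF \<eta>(1) mh])
    moreover have "Id App Q \<in> hom App Q Q" by (rule app.id_hom[OF Q])
    moreover have "(X, p, Q) = Id App Q \<cdot>\<^bsub>App\<^esub> (X, p, Q)" by (rule app.id_left[OF ph, symmetric])
    ultimately show ?thesis using * by (metis App_simps(3))
  qed (use K p(3) in simp_all)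
  moreover obtain h where h: "\<eta> = (Q, h, ?I)" "contraction Q ?I h"
    using \<eta>(1) by (auto simp: App_hom_iff App_Ar_iff)
  ultimately have "h y = y" if "y \<in> pts Q" for y
    using that contraction_in[OF h(2) that] by (auto simp: compose_def dest: fun_cong[of _ _ y])
  then have "pts Q \<subseteq> p ` pts X" using contraction_in[OF h(2)] by (metis pts_subspace subsetI)
  then show "\<pi> \<in> surjective_contractions"
    using p contraction_image[OF pc order.refl] by (auto simp: surjective_contractions_iff)
next
  fix \<pi> :: "'u amap" assume "\<pi> \<in> surjective_contractions"
  then obtain X p Q where p: "\<pi> = (X, p, Q)" "(X, p, Q) \<in> surjective_contractions" by (cases \<pi>) auto
  then have A: "(X, p, Q) \<in> Ar App" by (simp add: surjective_contractions_iff)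
  then have "X \<in> Ob App" "app.Ker (X, p, Q) \<in> carrier (fibre X)"
    using Ker_eq[OF A] cl_ker_closed[OF A] by (auto simp: App_Ar_iff)
  then show "\<pi> \<in> app.quotients"
    unfolding app.quotients_def p(1) using surjection_is_quotient[OF p(2)] by auto
qed

text \<open>Dually, the inclusion of the image of an embedding \<open>i\<close> factors through
  \<open>i\<close>, and uniqueness makes the factor \<open>h\<close> a left inverse of
  \<open>i\<close> on its image. This gives injectivity, and contractivity of \<open>h\<close> is
  the remaining inequality for initiality.\<close>

lemma embeddings_eq: "app.embeddings = initial_embeddings"
proof (intro equalityI subsetI)
  fix \<iota> assume "\<iota> \<in> app.embeddings"
  then obtain X S where q: "app.is_embedding X S \<iota>" by (auto simp: app.embeddings_def)
  then obtain i A where i: "\<iota> = (A, i, X)" "(A, i, X) \<in> Ar App" "app.Im (A, i, X) = S"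
    by (cases \<iota>) (auto simp: app.is_embedding_def)
  let ?I = "subspace X (i ` pts A)"
  let ?e = "(A, i, ?I)" and ?m = "(?I, restrict id (i ` pts A), X)"
  have X: "X \<in> Ob App" and A: "A \<in> Ob App" and ic: "contraction A X i"
    using i(2) by (simp_all add: App_Ar_iff)
  interpret complete_lattice "fibre X" by (rule fibre_complete_lattice[OF X])
  have S: "S \<in> carrier (fibre X)" using enc_carrier[OF cl_sub_closed[of X "i ` pts A"]] X unfolding i(3)[symmetric] Im_eq[OF i(2)] by simp
  have uni: "\<exists>!\<eta>. \<eta> \<in> hom App (Dom App \<gamma>) A \<and> \<gamma> = (A, i, X) \<cdot>\<^bsub>App\<^esub> \<eta>"
    if "\<gamma> \<in> Ar App" "Cod App \<gamma> = X" "app.Im \<gamma> \<sqsubseteq>\<^bsub>fibre X\<^esub> S" for \<gamma>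
    using q that unfolding i(1) by (auto simp: app.is_embedding_def)
  have e: "?e \<in> Ar App" using image_factorization(1)[OF i(2)] by (simp add: surjective_contractions_iff)
  have m: "?m \<in> Ar App" using image_factorization(2)[OF i(2)] by (simp add: initial_embeddings_iff)
  have "app.Im ?m \<sqsubseteq>\<^bsub>fibre X\<^esub> S" using S unfolding Im_factor[OF i(2)] i(3) by simp
  then obtain \<eta> where \<eta>: "\<eta> \<in> hom App ?I A" "?m = (A, i, X) \<cdot>\<^bsub>App\<^esub> \<eta>"
    using uni[OF m] by auto
  have "\<eta> \<cdot>\<^bsub>App\<^esub> ?e = Id App A"
  proof (rule ex1E[OF uni[OF i(2)]])
    fix \<theta> assume *: "\<forall>\<eta>. \<eta> \<in> hom App (Dom App (A, i, X)) A \<and> (A, i, X) = (A, i, X) \<cdot>\<^bsub>App\<^esub> \<eta> \<longrightarrow> \<eta> = \<theta>"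
    have eh: "?e \<in> hom App A ?I" and ih: "(A, i, X) \<in> hom App A X" using e i(2) by auto
    have "(A, i, X) = (A, i, X) \<cdot>\<^bsub>App\<^esub> (\<eta> \<cdot>\<^bsub>App\<^esub> ?e)"
      using image_factorization(3)[OF i(2)] app.comp_assoc[OF eh \<eta>(1) ih] \<eta>(2) by simp
    moreover have "\<eta> \<cdot>\<^bsub>App\<^esub> ?e \<in> hom App A A" by (rule app.comp_hom[OF eh \<eta>(1)])
    moreover have "Id App A \<in> hom App A A" by (rule app.id_hom[OF A])
    moreover have "(A, i, X) = (A, i, X) \<cdot>\<^bsub>App\<^esub> Id App A" by (rule app.id_right[OF ih, symmetric])
    ultimately show ?thesis using * by (metis App_simps(2))
  qed (use S i(3) in simp_all)
  moreover obtain h where h: "\<eta> = (?I, h, A)" "contraction ?I A h"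
    using \<eta>(1) by (auto simp: App_hom_iff App_Ar_iff)
  ultimately have hi: "h (i a) = a" if "a \<in> pts A" for a
    using that by (auto simp: compose_def dest: fun_cong[of _ _ a])
  have "dist A (a, T) = dist X (i a, i ` T)" if a: "a \<in> pts A" and T: "T \<subseteq> pts A" for a T
  proof (rule order.antisym)
    have "h ` i ` T = (\<lambda>a. a) ` T" unfolding image_image using hi T by (intro image_cong) auto
    then show "dist A (a, T) \<le> dist X (i a, i ` T)"
      using contraction_dist[OF h(2), of "i a" "i ` T"] hi[OF a] a T by (simp add: image_mono)
  qed (rule contraction_dist[OF ic a T])
  moreover have "inj_on i (pts A)" using hi by (rule inj_on_inverseI)
  ultimately show "\<iota> \<in> initial_embeddings" using i by (simp add: initial_embeddings_iff)
next
  fix \<iota> :: "'u amap" assume "\<iota> \<in> initial_embeddings"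
  then obtain A i X where i: "\<iota> = (A, i, X)" "(A, i, X) \<in> initial_embeddings" by (cases \<iota>) auto
  then have iA: "(A, i, X) \<in> Ar App" by (simp add: initial_embeddings_iff)
  then have "X \<in> Ob App" "app.Im (A, i, X) \<in> carrier (fibre X)"
    using Im_eq[OF iA] enc_carrier[OF cl_sub_closed] by (auto simp: App_Ar_iff)
  then show "\<iota> \<in> app.embeddings"
    unfolding app.embeddings_def i(1) using initial_is_embedding[OF i(2)] by auto
qed

lemma induces_App: "app.induces surjective_contractions initial_embeddings"
  by (simp add: app.induces_def quotients_eq embeddings_eq App_factorization_system)

end

theorem corollary4p44:
  assumes "universe TYPE('u)"
  shows "(\<exists>F :: ('u aspace, 'u amap, 'u) form.
            noetherian_form App F \<and>
            orean_form.induces App F surjective_contractions initial_embeddings) \<and>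
         (\<forall>X \<in> Ob (App :: ('u aspace, 'u amap) cat). \<forall>S \<subseteq> pts X.
            subspace X S \<in> Ob App \<and>
            (\<forall>A \<in> Ob App. pts A = S \<longrightarrow>
               ((A, restrict id S, X) \<in> initial_embeddings \<longleftrightarrow> A = subspace X S)))"
proof -
  interpret grothendieck_universe "TYPE('u)" by unfold_locales (rule assms)
  show ?thesis
    using noetherian_App induces_App subspace_Ob initial_subset_iff by blast
qed

end
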